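(* Let $R$ be $\mathbb{Z}$ or $\mathbb{F}_p[t]$, $F$ its fraction field, $K/F$ finite separable, $\mathcal{O}_K$ the integral closure of $R$ in $K$, $T=\{\mathfrak{p}_1,\dots,\mathfrak{p}_n\}$ a finite set of nonzero primes of $\mathcal{O}_K$, and $\mathcal{O}_{K,S}=\{x\in K:\operatorname{ord}_{\mathfrak{p}_i}(x)\ge0,\ i=1,\dots,n\}$. Let $\varphi$ be a normal sentence whose linear system $L_\varphi$ is solvable over $F$, and let $(A,\bar c)$ be a parametrization of its solution set as described in the context. If $\mathbf{K}_{\mathfrak{p}}\models\varphi_{\mathfrak{p}}$ for every $\mathfrak{p}\in T$, then $\overline{\mathcal{M}}_S\models\varphi$.
   Context: $\overline{\mathcal{M}}_S$ is $\mathcal{O}_{K,S}$ with $0,1,+,=$, (multiplication by $t$ when $R=\mathbb{F}_p[t]$), $\neq$ (inequality), $\|$ ($x\|y$ iff $x$ divides $y$ in $\mathcal{O}_{K,S}$ and $y\ne0$), and $o_j$ ($o_j(x,y)$ iff $x\ne0$ and $\operatorname{ord}_{\mathfrak{p}_j}(x)>\operatorname{ord}_{\mathfrak{p}_j}(y)$). A normal sentence is $\exists\bar x\bigwedge_i\varphi_i(\bar x)$ where each $\varphi_i$ is one of $l_1(\bar x)\|l_2(\bar x)$, $l_1(\bar x)=0$, $l_1(\bar x)\ne0$, $o_j(l_1(\bar x),l_2(\bar x))$, with $l_1,l_2$ linear polynomials with coefficients in $R$. $L_\varphi$ is the system of equations $l(\bar x)=0$ over all conjuncts of the form $l(\bar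 x)=0$. A parametrization is a matrix $A$ and vector $\bar c$ with entries in $F$ such that every $A\bar y+\bar c$ ($\bar y\in F^m$) solves $L_\varphi$ and every solution of $L_\varphi$ over $F$ equals $A\bar y+\bar c$ for some $\bar y$ (if $L_\varphi$ is empty, $A$ is the identity and $\bar c=0$). $\mathbf{K}_{\mathfrak{p}}$ is the completion of $K$ at $\mathfrak{p}$, with $\operatorname{ord}$ its valuation. The sentence $\varphi_{\mathfrak{p}}$ is $\exists\bar y\big(\bigwedge_i\varphi_{\mathfrak{p},i}(\bar y)\wedge\operatorname{ord}(A\bar y+\bar c)\ge0\big)$ (every entry has nonnegative valuation), where: if $\varphi_i$ is $l_1\|l_2$, then $\varphi_{\mathfrak{p},i}$ is $\exists z_1\exists z_2\,(l_1(A\bar y+\bar c)z_1=l_2(A\bar y+\bar c)\wedge\operatorname{ord}(z_1)\ge0\wedge l_2(A\bar y+\bar c)z_2=1)$; if $\varphi_i$ is $l_1=0$, then $\varphi_{\mathfrak{p},i}$ is $0=0$; if $\varphi_i$ is $l_1\ne0$, then $\varphi_{\mathfrak{p},i}$ is $\exists z\,(l_1(A\bar y+\bar c)z=1)$; if $\varphi_i$ is $o_j(l_1,l_2)$, then $\varphi_{\mathfrak{p},i}$ is $\operatorname{ord}(l_1(A\bar y+\bar c))>\operatorname{ord}(l_2(A\bar y+\bar c))$ when $\mathfrak{p}=\mathfrak{p}_j$ and $0=0$ otherwise.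
   Formalization: T is assumed nonempty (n ≥ 1), and the local translate of o_j(l1,l2) at p_j also requires l1(Ay+c) ≠ 0; without these the claim fails, e.g. for ∃x(x=0 ∧ x≠0) with T empty, or ∃x(x=0 ∧ o_1(x,1)), since ord 0 = ∞. *)

theory Defs
  imports
    "HOL-Algebra.Algebraic_Closure_Type"
    "HOL-Algebra.Ideal_Product"
    "HOL-Algebra.Embedded_Algebras"
    "HOL-Algebra.QuotRing"
    "HOL-Algebra.Divisibility"
    "HOL-Analysis.Extended_Real_Limits"
begin

text \<open>
  The field \<open>K\<close> is a type \<open>'k\<close> of class \<open>field\<close>. The rings \<open>R \<subseteq> F \<subseteq> K\<close>, \<open>O\<^sub>K\<close> and \<open>O\<^sub>K\<^sub>,\<^sub>S\<close> are
  subsets of \<open>'k\<close>, turned into records where the notions of HOL-Algebra are needed.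
\<close>

abbreviation ring_on :: "'k::field set \<Rightarrow> 'k ring" where
  "ring_on B \<equiv> ring_of_type_algebra\<lparr>carrier := B\<rparr>"

definition poly_over :: "'k::field set \<Rightarrow> 'k poly set" where
  "poly_over B = {f. \<forall>i. poly.coeff f i \<in> B}"

text \<open>
  \<open>\<int> :: 'k set\<close> is the image of the integers, hence a copy of the integers in characteristic \<open>0\<close>
  and the prime field \<open>F\<^sub>p\<close> in characteristic \<open>p\<close>. In the second case \<open>R\<close> is a polynomial ring
  because \<open>t\<close> is transcendental over \<open>F\<^sub>p\<close>.
\<close>

definition is_Z_or_Fp_t :: "'k::field set \<Rightarrow> bool" where
  "is_Z_or_Fp_t R \<longleftrightarrow>
     (CHAR('k) = 0 \<and> R = \<int>) \<or>
     (prime CHAR('k) \<and>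
       (\<exists>t. (\<forall>f\<in>poly_over \<int>. poly f t = 0 \<longrightarrow> f = 0) \<and> R = (\<lambda>f. poly f t) ` poly_over \<int>))"

definition fraction_field :: "'k::field set \<Rightarrow> 'k set" where
  "fraction_field R = {a / b | a b. a \<in> R \<and> b \<in> R \<and> b \<noteq> 0}"

definition finite_extension :: "'k::field set \<Rightarrow> bool" where
  "finite_extension F \<longleftrightarrow> ring.finite_dimension (ring_of_type_algebra :: 'k ring) F UNIV"

definition is_minimal_poly :: "'k::field set \<Rightarrow> 'k \<Rightarrow> 'k poly \<Rightarrow> bool" where
  "is_minimal_poly F x f \<longleftrightarrow>
     f \<in> poly_over F \<and> lead_coeff f = 1 \<and> poly f x = 0 \<and>
     (\<forall>g\<in>poly_over F. g \<noteq> 0 \<and> poly g x = 0 \<longrightarrow> degree f \<le> degree g)"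

text \<open>Separable: minimal polynomials have no multiple roots in an algebraic closure.\<close>

definition separable_extension :: "'k::field set \<Rightarrow> bool" where
  "separable_extension F \<longleftrightarrow>
     (\<forall>x::'k. \<exists>f. is_minimal_poly F x f \<and> rsquarefree (map_poly to_ac f))"

definition integral_closure :: "'k::field set \<Rightarrow> 'k set" where
  "integral_closure R = {x. \<exists>f\<in>poly_over R. lead_coeff f = 1 \<and> poly f x = 0}"

definition nonzero_prime :: "'k::field set \<Rightarrow> 'k set \<Rightarrow> bool" where
  "nonzero_prime OK P \<longleftrightarrow> primeideal P (ring_on OK) \<and> P \<noteq> {0}"

text \<open>
  For nonzero \<open>a \<in> O\<^sub>K\<close> the order is the exponent of \<open>P\<close> in the factorization of the ideal \<open>(a)\<close>,
  that is, the largest \<open>k\<close> such that \<open>P\<^sup>k\<close> contains \<open>a\<close>; it is extended to \<open>K\<close> by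
  \<open>ord (a / b) = ord a - ord b\<close> and \<open>ord 0 = \<infinity>\<close>.
\<close>

definition integral_ord :: "'k::field set \<Rightarrow> 'k set \<Rightarrow> 'k \<Rightarrow> nat" where
  "integral_ord OK P a = (GREATEST k::nat. a \<in> P [^]\<^bsub>ideals_set (ring_on OK)\<^esub> k)"

definition prime_ord :: "'k::field set \<Rightarrow> 'k set \<Rightarrow> 'k \<Rightarrow> ereal" where
  "prime_ord OK P x =
     (if x = 0 then \<infinity>
      else ereal (of_int (THE v. \<exists>a b. a \<in> OK - {0} \<and> b \<in> OK - {0} \<and> x = a / b \<and>
                                  v = int (integral_ord OK P a) - int (integral_ord OK P b))))"

definition S_integers :: "'k::field set \<Rightarrow> 'k set set \<Rightarrow> 'k set" where
  "S_integers OK T = {x. \<forall>P\<in>T. prime_ord OK P x \<ge> 0}"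


text \<open>The completion of \<open>K\<close> at \<open>P\<close>: Cauchy sequences modulo null sequences.\<close>

definition cauchy_ring :: "('k::field \<Rightarrow> ereal) \<Rightarrow> (nat \<Rightarrow> 'k) ring" where
  "cauchy_ring v =
     \<lparr>carrier = {s. \<forall>B::real. \<exists>M. \<forall>i\<ge>M. \<forall>j\<ge>M. v (s i - s j) > ereal B},
      monoid.mult = (\<lambda>s s' i. s i * s' i), one = (\<lambda>i. 1),
      ring.zero = (\<lambda>i. 0), add = (\<lambda>s s' i. s i + s' i)\<rparr>"

definition null_seqs :: "('k::field \<Rightarrow> ereal) \<Rightarrow> (nat \<Rightarrow> 'k) set" where
  "null_seqs v = {s. (\<lambda>i. v (s i)) \<longlonglongrightarrow> \<infinity>}"

definition completion :: "('k::field \<Rightarrow> ereal) \<Rightarrow> (nat \<Rightarrow> 'k) set ring" where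
  "completion v = cauchy_ring v Quot null_seqs v"

definition completion_emb :: "('k::field \<Rightarrow> ereal) \<Rightarrow> 'k \<Rightarrow> (nat \<Rightarrow> 'k) set" where
  "completion_emb v x = null_seqs v +>\<^bsub>cauchy_ring v\<^esub> (\<lambda>i. x)"

definition completion_ord :: "('k::field \<Rightarrow> ereal) \<Rightarrow> (nat \<Rightarrow> 'k) set \<Rightarrow> ereal" where
  "completion_ord v C = (THE l. \<forall>s\<in>C. (\<lambda>i. v (s i)) \<longlonglongrightarrow> l)"


text \<open>
  A linear polynomial in the variables \<open>x\<^sub>0, \<dots>, x\<^sub>N\<^sub>-\<^sub>1\<close> is given by its constant term and its
  coefficients; only the coefficients with index below \<open>N\<close> matter. A normal sentence in \<open>N\<close>
  variables is the list of its conjuncts.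
\<close>

type_synonym 'a linear_poly = "'a \<times> (nat \<Rightarrow> 'a)"

datatype 'a conjunct =
    Div "'a linear_poly" "'a linear_poly"
  | Eq0 "'a linear_poly"
  | Neq0 "'a linear_poly"
  | Ord_gt nat "'a linear_poly" "'a linear_poly"

definition linear_poly_over :: "'a set \<Rightarrow> nat \<Rightarrow> 'a linear_poly \<Rightarrow> bool" where
  "linear_poly_over R N l \<longleftrightarrow> fst l \<in> R \<and> (\<forall>i<N. snd l i \<in> R)"

fun normal_conjunct :: "'a set \<Rightarrow> nat \<Rightarrow> nat \<Rightarrow> 'a conjunct \<Rightarrow> bool" where
  "normal_conjunct R n N (Div l1 l2) \<longleftrightarrow> linear_poly_over R N l1 \<and> linear_poly_over R N l2"
| "normal_conjunct R n N (Eq0 l) \<longleftrightarrow> linear_poly_over R N l"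
| "normal_conjunct R n N (Neq0 l) \<longleftrightarrow> linear_poly_over R N l"
| "normal_conjunct R n N (Ord_gt j l1 l2) \<longleftrightarrow>
     j \<in> {1..n} \<and> linear_poly_over R N l1 \<and> linear_poly_over R N l2"

definition normal_sentence :: "'a set \<Rightarrow> nat \<Rightarrow> nat \<Rightarrow> 'a conjunct list \<Rightarrow> bool" where
  "normal_sentence R n N \<phi> \<longleftrightarrow> (\<forall>\<psi>\<in>set \<phi>. normal_conjunct R n N \<psi>)"

text \<open>
  Evaluation takes place in a ring \<open>E\<close> into which the coefficients are mapped by \<open>h\<close>.
\<close>

definition lin_eval ::
  "('b, 'm) ring_scheme \<Rightarrow> ('a \<Rightarrow> 'b) \<Rightarrow> nat \<Rightarrow> 'a linear_poly \<Rightarrow> (nat \<Rightarrow> 'b) \<Rightarrow> 'b" where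
  "lin_eval E h N l x = h (fst l) \<oplus>\<^bsub>E\<^esub> (\<Oplus>\<^bsub>E\<^esub>i\<in>{..<N}. h (snd l i) \<otimes>\<^bsub>E\<^esub> x i)"

definition affine_map ::
  "('b, 'm) ring_scheme \<Rightarrow> ('a \<Rightarrow> 'b) \<Rightarrow> nat \<Rightarrow> (nat \<Rightarrow> nat \<Rightarrow> 'a) \<Rightarrow> (nat \<Rightarrow> 'a) \<Rightarrow> (nat \<Rightarrow> 'b)
    \<Rightarrow> nat \<Rightarrow> 'b" where
  "affine_map E h m A c y i = (\<Oplus>\<^bsub>E\<^esub>k\<in>{..<m}. h (A i k) \<otimes>\<^bsub>E\<^esub> y k) \<oplus>\<^bsub>E\<^esub> h (c i)"

definition tuples :: "('b, 'm) ring_scheme \<Rightarrow> nat \<Rightarrow> (nat \<Rightarrow> 'b) set" where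
  "tuples E N = {x. \<forall>i<N. x i \<in> carrier E}"

definition linear_system :: "'a conjunct list \<Rightarrow> 'a linear_poly set" where
  "linear_system \<phi> = {l. Eq0 l \<in> set \<phi>}"

definition solves_system ::
  "'k::field set \<Rightarrow> nat \<Rightarrow> 'k conjunct list \<Rightarrow> (nat \<Rightarrow> 'k) \<Rightarrow> bool" where
  "solves_system F N \<phi> x \<longleftrightarrow>
     x \<in> tuples (ring_on F) N \<and> (\<forall>l\<in>linear_system \<phi>. lin_eval (ring_on F) id N l x = 0)"

definition parametrization ::
  "'k::field set \<Rightarrow> nat \<Rightarrow> nat \<Rightarrow> 'k conjunct list \<Rightarrow> (nat \<Rightarrow> nat \<Rightarrow> 'k) \<Rightarrow> (nat \<Rightarrow> 'k) \<Rightarrow> bool" where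
  "parametrization F N m \<phi> A c \<longleftrightarrow>
     (\<forall>i<N. \<forall>k<m. A i k \<in> F) \<and> (\<forall>i<N. c i \<in> F) \<and>
     (\<forall>y\<in>tuples (ring_on F) m. solves_system F N \<phi> (affine_map (ring_on F) id m A c y)) \<and>
     (\<forall>x. solves_system F N \<phi> x \<longrightarrow>
        (\<exists>y\<in>tuples (ring_on F) m. \<forall>i<N. x i = affine_map (ring_on F) id m A c y i)) \<and>
     (linear_system \<phi> = {} \<longrightarrow>
        m = N \<and> (\<forall>i<N. \<forall>k<m. A i k = (if i = k then 1 else 0)) \<and> (\<forall>i<N. c i = 0))"

text \<open>
  The relation \<open>o\<^sub>j\<close>, used both in \<open>O\<^sub>K\<^sub>,\<^sub>S\<close> and in the completions. The proviso \<open>x \<noteq> 0\<close> cannot be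
  dropped in the completions: since \<open>ord 0 = \<infinity>\<close>, the local sentences of \<open>x = 0 \<and> o\<^sub>j(x, 1)\<close> would
  be true everywhere, whereas that sentence is false in \<open>O\<^sub>K\<^sub>,\<^sub>S\<close>.
\<close>

definition ord_gt :: "('b, 'm) ring_scheme \<Rightarrow> ('b \<Rightarrow> ereal) \<Rightarrow> 'b \<Rightarrow> 'b \<Rightarrow> bool" where
  "ord_gt E w x y \<longleftrightarrow> x \<noteq> \<zero>\<^bsub>E\<^esub> \<and> w x > w y"

fun global_conjunct ::
  "'k::field set \<Rightarrow> (nat \<Rightarrow> 'k set) \<Rightarrow> 'k set \<Rightarrow> nat \<Rightarrow> (nat \<Rightarrow> 'k) \<Rightarrow> 'k conjunct \<Rightarrow> bool" where
  "global_conjunct OK p OS N x (Div l1 l2) \<longleftrightarrow>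
     lin_eval (ring_on OS) id N l1 x divides\<^bsub>ring_on OS\<^esub> lin_eval (ring_on OS) id N l2 x \<and>
     lin_eval (ring_on OS) id N l2 x \<noteq> 0"
| "global_conjunct OK p OS N x (Eq0 l) \<longleftrightarrow> lin_eval (ring_on OS) id N l x = 0"
| "global_conjunct OK p OS N x (Neq0 l) \<longleftrightarrow> lin_eval (ring_on OS) id N l x \<noteq> 0"
| "global_conjunct OK p OS N x (Ord_gt j l1 l2) \<longleftrightarrow>
     ord_gt (ring_on OS) (prime_ord OK (p j))
       (lin_eval (ring_on OS) id N l1 x) (lin_eval (ring_on OS) id N l2 x)"

definition global_sat ::
  "'k::field set \<Rightarrow> nat \<Rightarrow> (nat \<Rightarrow> 'k set) \<Rightarrow> nat \<Rightarrow> 'k conjunct list \<Rightarrow> bool" where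
  "global_sat OK n p N \<phi> \<longleftrightarrow>
     (let OS = S_integers OK (p ` {1..n}) in
      \<exists>x\<in>tuples (ring_on OS) N. \<forall>\<psi>\<in>set \<phi>. global_conjunct OK p OS N x \<psi>)"

text \<open>
  In \<open>local_conjunct E h w p P N x\<close>, the valued field \<open>(E, w)\<close> is the completion at \<open>P\<close>, \<open>h\<close> is the
  embedding of \<open>K\<close>, and \<open>x\<close> stands for \<open>A y + c\<close>.
\<close>

fun local_conjunct ::
  "('b, 'm) ring_scheme \<Rightarrow> ('k \<Rightarrow> 'b) \<Rightarrow> ('b \<Rightarrow> ereal) \<Rightarrow> (nat \<Rightarrow> 'k set) \<Rightarrow> 'k set \<Rightarrow> nat \<Rightarrow>
    (nat \<Rightarrow> 'b) \<Rightarrow> 'k conjunct \<Rightarrow> bool" where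
  "local_conjunct E h w p P N x (Div l1 l2) \<longleftrightarrow>
     (\<exists>z1\<in>carrier E. \<exists>z2\<in>carrier E.
        lin_eval E h N l1 x \<otimes>\<^bsub>E\<^esub> z1 = lin_eval E h N l2 x \<and> w z1 \<ge> 0 \<and>
        lin_eval E h N l2 x \<otimes>\<^bsub>E\<^esub> z2 = \<one>\<^bsub>E\<^esub>)"
| "local_conjunct E h w p P N x (Eq0 l) \<longleftrightarrow> True"
| "local_conjunct E h w p P N x (Neq0 l) \<longleftrightarrow>
     (\<exists>z\<in>carrier E. lin_eval E h N l x \<otimes>\<^bsub>E\<^esub> z = \<one>\<^bsub>E\<^esub>)"
| "local_conjunct E h w p P N x (Ord_gt j l1 l2) \<longleftrightarrow>
     (P = p j \<longrightarrow> ord_gt E w (lin_eval E h N l1 x) (lin_eval E h N l2 x))"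

definition local_sat ::
  "'k::field set \<Rightarrow> (nat \<Rightarrow> 'k set) \<Rightarrow> 'k set \<Rightarrow> nat \<Rightarrow> nat \<Rightarrow> (nat \<Rightarrow> nat \<Rightarrow> 'k) \<Rightarrow> (nat \<Rightarrow> 'k) \<Rightarrow>
    'k conjunct list \<Rightarrow> bool" where
  "local_sat OK p P N m A c \<phi> \<longleftrightarrow>
     (let v = prime_ord OK P; E = completion v; h = completion_emb v; w = completion_ord v in
      \<exists>y\<in>tuples E m.
        (\<forall>\<psi>\<in>set \<phi>. local_conjunct E h w p P N (affine_map E h m A c y) \<psi>) \<and>
        (\<forall>i<N. w (affine_map E h m A c y i) \<ge> 0))"

end

theory Submission
  imports Defs "Jordan_Normal_Form.Char_Poly" "HOL-Number_Theory.Cong"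
begin

text \<open>
  Every local condition on \<open>y\<close> is open, so in each completion a solution can be replaced by a tuple
  over \<open>K\<close>, and weak approximation merges these tuples for the finitely many primes in \<open>T\<close> into one
  \<open>y\<close>; the equations hold for every \<open>y\<close>, since an affine form that vanishes on \<open>F\<^sup>m\<close> is zero.
  An \<open>x = A y + c\<close> that satisfies all local conditions is a global solution because membership and
  divisibility in \<open>O\<^sub>K\<^sub>,\<^sub>S\<close> are tested at the primes in \<open>T\<close>.

  That \<open>ord\<^sub>P\<close> is a valuation rests on the finiteness of \<open>O\<^sub>K / a\<close> for nonzero \<open>a\<close>. It yields, by
  pigeonhole, that \<open>P\<close> is maximal and that \<open>u\<close> is integral as soon as all \<open>u\<^sup>n a\<close> are; hence \<open>P\<close> is
  locally principal and its powers have zero intersection.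
\<close>

section \<open>Integral closures\<close>

text \<open>The order is defined by powers of ideals, but its additivity is proved with elements.
  Some \<open>u\<close> in \<open>K\<close> carries \<open>P\<close> into \<open>OK\<close> but not
  into \<open>P\<close> and acts as the inverse of a uniformizer: if \<open>k\<close> is the order
  of \<open>a\<close>, then \<open>u ^ k * a\<close> lies in \<open>OK\<close> and outside
  \<open>P\<close>, and the elements outside a prime are closed under products.

  Density of \<open>K\<close> in a completion takes no separate argument. Elements of the completion
  are classes of Cauchy sequences, so the \<open>j\<close>-th entries of representatives already
  form a tuple over \<open>K\<close>, and every local condition holds at this tuple for all large
  \<open>j\<close>.

  Openness rests on nonvanishing: the value of a linear form is locally constant where the form is
  nonzero. In a divisibility conjunct the divisor is nonzero because its value is bounded by the
  finite value of the dividend. In \<open>o_j(l1, l2)\<close> the form \<open>l1\<close> is nonzero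
  by the proviso, and \<open>l2\<close> because its value is strictly smaller. Equations are not
  open conditions; this is why the parametrization takes them out of the local sentences.\<close>

lemma ring_of_type_algebra_simps [simp]:
  "carrier ring_of_type_algebra = UNIV"
  "x \<otimes>\<^bsub>ring_of_type_algebra\<^esub> y = x * y" "x \<oplus>\<^bsub>ring_of_type_algebra\<^esub> y = x + y"
  "\<one>\<^bsub>ring_of_type_algebra\<^esub> = 1" "\<zero>\<^bsub>ring_of_type_algebra\<^esub> = 0"
  by (simp_all add: ring_of_type_algebra_def)

text \<open>Subrings are handled through membership rules, so that the arithmetic stays that of the
  type class. \<open>cring_ring_on\<close> and \<open>finsum_ring_on\<close> make the connection
  with the records of HOL-Algebra.\<close>

locale field_subring =
  fixes B :: "'k::field set"
  assumes zero_mem [simp, intro]: "0 \<in> B"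
    and one_mem [simp, intro]: "1 \<in> B"
    and add_mem [intro]: "x \<in> B \<Longrightarrow> y \<in> B \<Longrightarrow> x + y \<in> B"
    and uminus_mem [intro]: "x \<in> B \<Longrightarrow> - x \<in> B"
    and mult_mem [intro]: "x \<in> B \<Longrightarrow> y \<in> B \<Longrightarrow> x * y \<in> B"
begin

lemma diff_mem [intro]: "x \<in> B \<Longrightarrow> y \<in> B \<Longrightarrow> x - y \<in> B"
  using add_mem[of x "- y"] uminus_mem[of y] by simp

lemma power_mem [intro]: "x \<in> B \<Longrightarrow> x ^ n \<in> B"
  by (induction n) auto

lemma sum_mem [intro]: "(\<And>i. i \<in> I \<Longrightarrow> f i \<in> B) \<Longrightarrow> sum f I \<in> B"
  by (induction I rule: infinite_finite_induct) auto

lemma prod_mem [intro]: "(\<And>i. i \<in> I \<Longrightarrow> f i \<in> B) \<Longrightarrow> prod f I \<in> B"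
  by (induction I rule: infinite_finite_induct) auto

lemma cring_ring_on: "cring (ring_on B)"
proof -
  have "\<exists>y\<in>B. x + y = 0" if "x \<in> B" for x
    using that by (intro bexI[of _ "- x"]) auto
  thus ?thesis
    unfolding ring_of_type_algebra_def
    by unfold_locales (auto simp: algebra_simps Units_def)
qed

lemma finsum_ring_on:
  assumes "finite I" "\<And>i. i \<in> I \<Longrightarrow> f i \<in> B"
  shows "finsum (ring_on B) f I = sum f I"
proof -
  interpret cring "ring_on B" by (rule cring_ring_on)
  show ?thesis
    using assms
  proof (induction I rule: finite_induct)
    case (insert x I)
    thus ?case by (subst finsum_insert) auto
  qed (simp add: finsum_empty)
qed

lemma poly_over_add: "f \<in> poly_over B \<Longrightarrow> g \<in> poly_over B \<Longrightarrow> f + g \<in> poly_over B"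
  by (auto simp: poly_over_def)

lemma poly_over_mult: "f \<in> poly_over B \<Longrightarrow> g \<in> poly_over B \<Longrightarrow> f * g \<in> poly_over B"
  by (auto simp: poly_over_def coeff_mult)

lemma poly_over_uminus: "f \<in> poly_over B \<Longrightarrow> - f \<in> poly_over B"
  by (auto simp: poly_over_def)

lemma poly_over_one: "1 \<in> poly_over B"
  by (auto simp: poly_over_def)

lemma poly_over_sum: "(\<And>i. i \<in> I \<Longrightarrow> f i \<in> poly_over B) \<Longrightarrow> sum f I \<in> poly_over B"
  by (auto simp: poly_over_def coeff_sum)

lemma poly_over_prod: "(\<And>i. i \<in> I \<Longrightarrow> f i \<in> poly_over B) \<Longrightarrow> prod f I \<in> poly_over B"
  by (induction I rule: infinite_finite_induct) (auto intro: poly_over_one poly_over_mult)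

text \<open>Solving a monic equation for its leading term replaces polynomials by plain sums. The
  degree \<open>n\<close> is automatically positive, since for \<open>n = 0\<close> the equation
  reads \<open>1 = 0\<close>.\<close>

lemma integral_closure_iff:
  "x \<in> integral_closure B \<longleftrightarrow> (\<exists>n c. (\<forall>i. c i \<in> B) \<and> x ^ n = (\<Sum>i<n. c i * x ^ i))"
proof
  assume "x \<in> integral_closure B"
  then obtain f where f: "f \<in> poly_over B" "lead_coeff f = 1" "poly f x = 0"
    by (auto simp: integral_closure_def)
  have "0 = (\<Sum>i<degree f. poly.coeff f i * x ^ i) + x ^ degree f"
    using f(2,3) by (simp add: poly_altdef lessThan_Suc_atMost[symmetric])
  hence "x ^ degree f = (\<Sum>i<degree f. (- poly.coeff f i) * x ^ i)"
    by (simp add: sum_negf eq_neg_iff_add_eq_0 add.commute)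
  moreover have "\<forall>i. - poly.coeff f i \<in> B"
    using f(1) by (auto simp: poly_over_def)
  ultimately show "\<exists>n c. (\<forall>i. c i \<in> B) \<and> x ^ n = (\<Sum>i<n. c i * x ^ i)"
    by (intro exI[of _ "degree f"] exI[of _ "\<lambda>i. - poly.coeff f i"]) auto
next
  assume "\<exists>n c. (\<forall>i. c i \<in> B) \<and> x ^ n = (\<Sum>i<n. c i * x ^ i)"
  then obtain n c where c: "\<And>i. c i \<in> B" and x: "x ^ n = (\<Sum>i<n. c i * x ^ i)"
    by blast
  define f where "f = Polynomial.monom 1 n - (\<Sum>i<n. Polynomial.monom (c i) i)"
  have coeff: "poly.coeff f i = (if i = n then 1 else if i < n then - c i else 0)" for i
    by (auto simp: f_def coeff_sum)
  have "degree f = n"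
    by (intro antisym degree_le le_degree) (auto simp: coeff)
  moreover have "poly f x = 0"
    by (simp add: f_def poly_monom poly_sum x)
  moreover have "f \<in> poly_over B"
    using c by (auto simp: poly_over_def coeff)
  ultimately show "x \<in> integral_closure B"
    by (auto simp: integral_closure_def coeff intro!: bexI[of _ f])
qed

text \<open>The Leibniz formula builds the determinant from the entries by sums, products and signs,
  none of which leaves \<open>poly_over B\<close>.\<close>

lemma char_poly_over:
  assumes M: "M \<in> carrier_mat n n" and ent: "\<And>i j. i < n \<Longrightarrow> j < n \<Longrightarrow> M $$ (i, j) \<in> B"
  shows "char_poly M \<in> poly_over B"
proof -
  have lin: "[:a, b:] \<in> poly_over B" if "a \<in> B" "b \<in> B" for a b
    using that by (auto simp: poly_over_def coeff_pCons split: nat.split)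
  have cm: "char_poly_matrix M \<in> carrier_mat n n"
    using M by simp
  have ent': "char_poly_matrix M $$ (i, j) \<in> poly_over B" if "i < n" "j < n" for i j
    using that M ent[OF that] lin[of "- M $$ (i, j)" 1] lin[of "- M $$ (i, j)" 0]
    by (auto simp: char_poly_matrix_def one_pCons)
  have "signof q * (\<Prod>i = 0..<n. char_poly_matrix M $$ (i, q i)) \<in> poly_over B"
    if q: "q permutes {0..<n}" for q
  proof -
    have "(\<Prod>i = 0..<n. char_poly_matrix M $$ (i, q i)) \<in> poly_over B"
      using q by (intro poly_over_prod ent') (auto simp: permutes_in_image)
    thus ?thesis
      by (auto simp: sign_def intro: poly_over_uminus)
  qed
  thus ?thesis
    unfolding char_poly_def det_def'[OF cm] by (intro poly_over_sum) auto
qed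

text \<open>The determinant trick: the coefficients form a matrix over \<open>B\<close> that has
  \<open>z\<close> as an eigenvalue with eigenvector \<open>v\<close>, which is nonzero because of
  \<open>i0\<close>. So \<open>z\<close> is a root of a monic characteristic polynomial over
  \<open>B\<close>.\<close>

lemma integral_closureI_module:
  fixes v :: "'i \<Rightarrow> 'k"
  assumes I: "finite I" and i0: "i0 \<in> I" "v i0 \<noteq> 0"
    and stable: "\<And>i. i \<in> I \<Longrightarrow> \<exists>c. (\<forall>j. c j \<in> B) \<and> z * v i = (\<Sum>j\<in>I. c j * v j)"
  shows "z \<in> integral_closure B"
proof -
  obtain C where C: "\<And>i j. i \<in> I \<Longrightarrow> C i j \<in> B"
    and zC: "\<And>i. i \<in> I \<Longrightarrow> z * v i = (\<Sum>j\<in>I. C i j * v j)"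
    using stable by metis
  define n where "n = card I"
  obtain h where h: "bij_betw h {0..<n} I"
    using ex_bij_betw_nat_finite[OF I] unfolding n_def by blast
  have hI: "h i \<in> I" if "i < n" for i
    using h that by (auto simp: bij_betw_def)
  define M where "M = mat n n (\<lambda>(i, j). C (h i) (h j))"
  define w where "w = vec n (\<lambda>i. v (h i))"
  have M: "M \<in> carrier_mat n n" by (simp add: M_def)
  obtain j0 where j0: "j0 < n" "h j0 = i0"
    using h i0(1) by (auto simp: bij_betw_def)
  have "M *\<^sub>v w = z \<cdot>\<^sub>v w"
  proof (rule eq_vecI)
    fix i assume "i < dim_vec (z \<cdot>\<^sub>v w)"
    hence i: "i < n" by (simp add: w_def)
    have "(M *\<^sub>v w) $ i = (\<Sum>j = 0..<n. C (h i) (h j) * v (h j))"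
      using i by (simp add: M_def w_def scalar_prod_def)
    also have "\<dots> = (\<Sum>j\<in>I. C (h i) j * v j)"
      using h by (rule sum.reindex_bij_betw)
    finally show "(M *\<^sub>v w) $ i = (z \<cdot>\<^sub>v w) $ i"
      using i zC[OF hI[OF i]] by (simp add: w_def)
  qed (simp add: M_def w_def)
  moreover have "w \<noteq> 0\<^sub>v n"
  proof
    assume "w = 0\<^sub>v n"
    hence "vec_index w j0 = 0" using j0(1) by simp
    thus False using j0 i0(2) by (simp add: w_def)
  qed
  ultimately have "eigenvalue M z"
    unfolding eigenvalue_def eigenvector_def by (intro exI[of _ w]) (auto simp: w_def M_def)
  hence "poly (char_poly M) z = 0"
    using eigenvalue_root_char_poly[OF M] by simp
  moreover have "char_poly M \<in> poly_over B"
    using C hI by (intro char_poly_over[OF M]) (auto simp: M_def)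
  moreover have "lead_coeff (char_poly M) = 1"
    using degree_monic_char_poly[OF M] by simp
  ultimately show ?thesis
    by (auto simp: integral_closure_def)
qed

lemma subset_integral_closure: "B \<subseteq> integral_closure B"
proof
  fix x assume "x \<in> B"
  thus "x \<in> integral_closure B"
    unfolding integral_closure_iff by (intro exI[of _ 1] exI[of _ "\<lambda>_. x"]) auto
qed

text \<open>The monomials \<open>x ^ i * y ^ j\<close> with \<open>i < n\<close> and
  \<open>j < m\<close> span a module \<open>S\<close> that is stable under \<open>x\<close> and
  under \<open>y\<close>, because the integral equations reduce the exponents \<open>n\<close> and
  \<open>m\<close>. Hence it is stable under the sum and the product, and the determinant trick
  applies.\<close>

lemma integral_closure_add_mult:
  assumes x: "x \<in> integral_closure B" and y: "y \<in> integral_closure B"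
  shows "x + y \<in> integral_closure B" "x * y \<in> integral_closure B"
proof -
  obtain n c where c: "\<And>i. c i \<in> B" and xn: "x ^ n = (\<Sum>i<n. c i * x ^ i)"
    using x unfolding integral_closure_iff by blast
  obtain m e where e: "\<And>i. e i \<in> B" and ym: "y ^ m = (\<Sum>i<m. e i * y ^ i)"
    using y unfolding integral_closure_iff by blast
  \<comment> \<open>Positive degrees put the monomial \<open>1 = x ^ 0 * y ^ 0\<close> among the
    generators; it is the nonzero entry of the eigenvector.\<close>
  have n: "n > 0" and m: "m > 0"
    using xn ym by (auto intro!: Nat.gr0I)
  define I where "I = {..<n} \<times> {..<m}"
  define v where "v = (\<lambda>(i, j). x ^ i * y ^ j)"
  define S where "S = {a. \<exists>c. (\<forall>j. c j \<in> B) \<and> a = (\<Sum>j\<in>I. c j * v j)}"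
  have I: "finite I" by (simp add: I_def)
  have SI: "(\<Sum>j\<in>I. c j * v j) \<in> S" if "\<And>j. c j \<in> B" for c
    using that by (auto simp: S_def)
  have S_add: "a + b \<in> S" if ab: "a \<in> S" "b \<in> S" for a b
  proof -
    obtain c d where "\<forall>j. c j \<in> B" "a = (\<Sum>j\<in>I. c j * v j)" "\<forall>j. d j \<in> B" "b = (\<Sum>j\<in>I. d j * v j)"
      using ab by (auto simp: S_def simp del: split_paired_All)
    moreover from this have "c j + d j \<in> B" for j
      by blast
    ultimately show ?thesis
      using SI[of "\<lambda>j. c j + d j"] by (simp add: sum.distrib distrib_right)
  qed
  have S_scale: "r * a \<in> S" if ra: "r \<in> B" "a \<in> S" for r a
  proof -
    obtain c where "\<forall>j. c j \<in> B" "a = (\<Sum>j\<in>I. c j * v j)"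
      using ra by (auto simp: S_def simp del: split_paired_All)
    moreover from this have "r * c j \<in> B" for j
      using ra by blast
    ultimately show ?thesis
      using SI[of "\<lambda>j. r * c j"] by (simp add: sum_distrib_left mult.assoc)
  qed
  have v_S: "v i \<in> S" if "i \<in> I" for i
  proof -
    have "v i = (\<Sum>j\<in>I. (if j = i then 1 else 0) * v j)"
      using I that by (simp add: if_distrib[of "\<lambda>a. a * _"] cong: if_cong)
    thus ?thesis using SI[of "\<lambda>j. if j = i then 1 else 0"] by simp
  qed
  have S_sum: "sum f J \<in> S" if "\<And>j. j \<in> J \<Longrightarrow> f j \<in> S" "finite J" for f :: "'j \<Rightarrow> 'k" and J
    using that(2,1)
  proof (induction J rule: finite_induct)
    case empty
    show ?case using SI[of "\<lambda>_. 0"] by simp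
  qed (auto intro: S_add)
  have xv: "x * v i \<in> S" if i: "i \<in> I" for i
  proof -
    obtain a b where ab: "i = (a, b)" "a < n" "b < m" using i by (auto simp: I_def)
    show ?thesis
    proof (cases "Suc a < n")
      case True
      thus ?thesis using v_S[of "(Suc a, b)"] ab by (simp add: I_def v_def mult.assoc)
    next
      case False
      hence "x * v i = x ^ n * y ^ b"
        using ab by (cases "Suc a = n") (auto simp: v_def)
      also have "\<dots> = (\<Sum>k<n. c k * v (k, b))"
        by (simp add: xn sum_distrib_right v_def mult.assoc)
      also have "\<dots> \<in> S"
        using ab c by (intro S_sum[OF S_scale[OF _ v_S]]) (auto simp: I_def)
      finally show ?thesis .
    qed
  qed
  have yv: "y * v i \<in> S" if i: "i \<in> I" for i
  proof -
    obtain a b where ab: "i = (a, b)" "a < n" "b < m" using i by (auto simp: I_def)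
    show ?thesis
    proof (cases "Suc b < m")
      case True
      thus ?thesis using v_S[of "(a, Suc b)"] ab by (simp add: I_def v_def algebra_simps)
    next
      case False
      hence "y * v i = x ^ a * y ^ m"
        using ab by (cases "Suc b = m") (auto simp: v_def)
      also have "\<dots> = (\<Sum>k<m. e k * v (a, k))"
        by (simp add: ym sum_distrib_left v_def mult_ac)
      also have "\<dots> \<in> S"
        using ab e by (intro S_sum[OF S_scale[OF _ v_S]]) (auto simp: I_def)
      finally show ?thesis .
    qed
  qed
  have xS: "x * a \<in> S" if aS: "a \<in> S" for a
  proof -
    obtain d where d: "\<forall>j. d j \<in> B" "a = (\<Sum>j\<in>I. d j * v j)"
      using aS by (auto simp: S_def simp del: split_paired_All)
    hence "x * a = (\<Sum>j\<in>I. d j * (x * v j))"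
      by (simp add: sum_distrib_left mult_ac)
    also have "\<dots> \<in> S"
      by (rule S_sum[OF S_scale I]) (use d xv in blast)+
    finally show ?thesis .
  qed
  have i0: "(0, 0) \<in> I" "v (0, 0) \<noteq> 0"
    using n m by (auto simp: I_def v_def)
  have "(x + y) * v i \<in> S" if "i \<in> I" for i
    using S_add[OF xv[OF that] yv[OF that]] by (simp add: algebra_simps)
  thus "x + y \<in> integral_closure B"
    unfolding S_def by (intro integral_closureI_module[where v = v, OF I i0]) blast
  have "(x * y) * v i \<in> S" if "i \<in> I" for i
    using xS[OF yv[OF that]] by (simp add: algebra_simps)
  thus "x * y \<in> integral_closure B"
    unfolding S_def by (intro integral_closureI_module[where v = v, OF I i0]) blast
qed

lemma field_subring_integral_closure: "field_subring (integral_closure B)"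
proof
  show "0 \<in> integral_closure B" "1 \<in> integral_closure B"
    using subset_integral_closure by auto
  show "- x \<in> integral_closure B" if "x \<in> integral_closure B" for x
    using integral_closure_add_mult(2)[of "- 1" x] that subset_integral_closure by auto
qed (auto intro: integral_closure_add_mult)

end

section \<open>Euclidean base rings and their fraction fields\<close>

text \<open>The size \<open>d\<close> is the absolute value on the integers and the degree on
  polynomials. The remainder \<open>0\<close> is a separate alternative because the degree of
  \<open>0\<close> does not lie below that of a nonzero constant. \<open>finite_size\<close> makes
  residue rings finite; \<open>size_mult\<close> gives descent along nonunit factors.\<close>

locale euclidean_subring = field_subring R for R :: "'k::field set" +
  fixes d :: "'k \<Rightarrow> nat"
  assumes division: "a \<in> R \<Longrightarrow> b \<in> R \<Longrightarrow> b \<noteq> 0 \<Longrightarrow>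
      \<exists>q\<in>R. \<exists>r\<in>R. a = b * q + r \<and> (r = 0 \<or> d r < d b)"
    and finite_size: "finite {r \<in> R. d r < n}"
    and size_mult: "a \<in> R \<Longrightarrow> b \<in> R \<Longrightarrow> a \<noteq> 0 \<Longrightarrow> b \<noteq> 0 \<Longrightarrow> inverse b \<notin> R \<Longrightarrow> d a < d (a * b)"

lemma field_subring_Ints: "field_subring (\<int> :: 'k::field set)"
  by unfold_locales auto

lemma euclidean_subring_Ints:
  assumes "CHAR('k::field) = 0"
  shows "\<exists>d. euclidean_subring (\<int> :: 'k set) d"
proof -
  have inj: "inj (of_int :: int \<Rightarrow> 'k)"
    using assms by (auto simp: inj_def of_int_eq_iff_cong_CHAR)
  define d :: "'k \<Rightarrow> nat" where "d x = nat \<bar>inv_into UNIV of_int x\<bar>" for x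
  have d: "d (of_int i) = nat \<bar>i\<bar>" for i
    using inj by (simp add: d_def)
  interpret field_subring "\<int> :: 'k set" by (rule field_subring_Ints)
  have "euclidean_subring (\<int> :: 'k set) d"
  proof
    fix a b :: 'k assume "a \<in> \<int>" "b \<in> \<int>" "b \<noteq> 0"
    then obtain i j where ij: "a = of_int i" "b = of_int j" "j \<noteq> 0"
      by (metis Ints_cases of_int_0)
    have "a = b * of_int (i div j) + of_int (i mod j)"
      by (simp add: ij flip: of_int_mult of_int_add)
    moreover have "d (of_int (i mod j)) < d b"
      using abs_mod_less[OF ij(3), of i] by (simp add: d ij)
    ultimately show "\<exists>q\<in>\<int>. \<exists>r\<in>\<int>. a = b * q + r \<and> (r = 0 \<or> d r < d b)"
      by (intro bexI[of _ "of_int (i div j)"] bexI[of _ "of_int (i mod j)"]) auto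
  next
    fix n
    have "{r \<in> \<int>. d r < n} \<subseteq> of_int ` {- int n..int n}"
      by (auto elim!: Ints_cases simp: d intro!: imageI)
    thus "finite {r \<in> \<int>. d r < n}"
      by (rule finite_subset) auto
  next
    fix a b :: 'k assume "a \<in> \<int>" "b \<in> \<int>" "a \<noteq> 0" "b \<noteq> 0" and nu: "inverse b \<notin> \<int>"
    then obtain i j where ij: "a = of_int i" "b = of_int j" "i \<noteq> 0" "j \<noteq> 0"
      by (metis Ints_cases of_int_0)
    have "\<bar>j\<bar> \<noteq> 1"
      using nu ij by (auto simp: abs_if split: if_splits)
    hence "1 < \<bar>j\<bar>" using ij(4) by linarith
    hence "\<bar>i\<bar> * 1 < \<bar>i\<bar> * \<bar>j\<bar>"
      using ij(3) by (intro mult_strict_left_mono) auto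
    thus "d a < d (a * b)"
      by (simp add: ij d abs_mult flip: of_int_mult)
  qed
  thus ?thesis by blast
qed

text \<open>Here the integers have image \<open>F_p\<close>, and an integer prime to
  \<open>p\<close> is invertible modulo \<open>p\<close>.\<close>

lemma Ints_inverse_prime_CHAR:
  assumes "prime CHAR('k::field)" "x \<in> (\<int> :: 'k set)"
  shows "inverse x \<in> \<int>"
proof (cases "x = 0")
  case False
  obtain i where i: "x = of_int i" using assms(2) by (auto elim: Ints_cases)
  have "\<not> int CHAR('k) dvd i"
    using False of_int_eq_iff_cong_CHAR[of i 0, where 'a = 'k] by (auto simp: i cong_0_iff)
  moreover have "prime (int CHAR('k))"
    using assms(1) by simp
  ultimately have "coprime i (int CHAR('k))"
    using prime_imp_coprime coprime_commute by blast
  then obtain j where "[i * j = 1] (mod int CHAR('k))"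
    using cong_solve_coprime_int by blast
  hence "of_int i * of_int j = (1 :: 'k)"
    using of_int_eq_iff_cong_CHAR[of "i * j" 1, where 'a = 'k] by simp
  hence "inverse x = of_int j"
    by (simp add: i inverse_unique)
  thus ?thesis by simp
qed simp

lemma finite_Ints_CHAR_pos:
  assumes "CHAR('k::field) > 0"
  shows "finite (\<int> :: 'k set)"
proof -
  have "(\<int> :: 'k set) \<subseteq> of_int ` {0..<int CHAR('k)}"
  proof
    fix x :: 'k assume "x \<in> \<int>"
    then obtain i where i: "x = of_int i" by (auto elim: Ints_cases)
    have "x = of_int (i mod int CHAR('k))"
      unfolding i of_int_eq_iff_cong_CHAR by (simp add: cong_def)
    thus "x \<in> of_int ` {0..<int CHAR('k)}"
      using assms by (intro image_eqI) auto
  qed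
  thus ?thesis by (rule finite_subset) auto
qed

text \<open>Long division does not leave \<open>B\<close>: the leading term of the quotient only
  takes the inverse of the leading coefficient of \<open>g\<close>.\<close>

lemma poly_over_division:
  fixes B :: "'k::field set"
  assumes B: "field_subring B" and inv_B: "\<And>x. x \<in> B \<Longrightarrow> inverse x \<in> B"
    and g: "g \<in> poly_over B" "g \<noteq> 0" and f: "f \<in> poly_over B"
  shows "\<exists>q\<in>poly_over B. \<exists>r\<in>poly_over B. f = g * q + r \<and> (r = 0 \<or> degree r < degree g)"
  using f
proof (induction "degree f" arbitrary: f rule: less_induct)
  case less
  interpret field_subring B by (rule B)
  have W0: "0 \<in> poly_over B" by (simp add: poly_over_def)
  show ?case
  proof (cases "f = 0 \<or> degree f < degree g")
    case True
    thus ?thesis using less.prems W0 by (intro bexI[of _ 0] bexI[of _ f]) auto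
  next
    case False
    define q where "q = Polynomial.monom (lead_coeff f * inverse (lead_coeff g)) (degree f - degree g)"
    have q: "q \<in> poly_over B"
      using less.prems g(1) inv_B by (auto simp: q_def poly_over_def)
    define f' where "f' = f - g * q"
    have f': "f' \<in> poly_over B"
      using poly_over_add[OF less.prems poly_over_uminus[OF poly_over_mult[OF g(1) q]]]
      by (simp add: f'_def)
    have deg_q: "degree (g * q) = degree f"
      using False g(2) by (simp add: q_def degree_mult_eq degree_monom_eq)
    have "lead_coeff (g * q) = lead_coeff f"
      using g(2) False by (simp add: lead_coeff_mult) (simp add: q_def degree_monom_eq)
    hence "poly.coeff f' (degree f) = 0"
      by (simp add: f'_def deg_q)
    moreover have "degree f' \<le> degree f"
      unfolding f'_def by (rule degree_diff_le) (auto simp: deg_q)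
    ultimately have "f' = 0 \<or> degree f' < degree f"
      using degree_less_if_less_eqI by blast
    hence "\<exists>q'\<in>poly_over B. \<exists>r\<in>poly_over B. f' = g * q' + r \<and> (r = 0 \<or> degree r < degree g)"
    proof
      assume "f' = 0"
      thus ?thesis using W0 by (intro bexI[of _ 0]) auto
    qed (use less.hyps f' in blast)
    then obtain q' r where "q' \<in> poly_over B" "r \<in> poly_over B" "f' = g * q' + r"
      "r = 0 \<or> degree r < degree g" by blast
    moreover from this have "f = g * (q + q') + r"
      by (simp add: f'_def algebra_simps)
    ultimately show ?thesis using poly_over_add[OF q] by blast
  qed
qed

lemma finite_poly_over_degree_less:
  assumes "finite B"
  shows "finite {f \<in> poly_over B. degree f < n}"
proof -
  have "{f \<in> poly_over B. degree f < n} \<subseteq> Poly ` {xs. set xs \<subseteq> B \<and> length xs \<le> n}"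
  proof
    fix f assume f: "f \<in> {f \<in> poly_over B. degree f < n}"
    have "set (coeffs f) \<subseteq> B"
      using f by (auto simp: coeffs_def poly_over_def split: if_splits)
    moreover have "length (coeffs f) \<le> n"
      using f by (auto simp: length_coeffs_degree coeffs_def)
    ultimately show "f \<in> Poly ` {xs. set xs \<subseteq> B \<and> length xs \<le> n}"
      by (intro image_eqI[of _ _ "coeffs f"]) auto
  qed
  thus ?thesis
    using finite_lists_length_le[OF assms] finite_surj by blast
qed

text \<open>Transcendence of \<open>t\<close> makes evaluation at \<open>t\<close> injective on the
  polynomials over the prime field, so degree and division can be transported to the image.\<close>

lemma euclidean_subring_poly:
  fixes t :: "'k::field"
  assumes p: "prime CHAR('k)" and t: "\<forall>f\<in>poly_over \<int>. poly f t = 0 \<longrightarrow> f = 0"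
  shows "\<exists>d. euclidean_subring ((\<lambda>f. poly f t) ` poly_over \<int>) d"
proof -
  interpret Z: field_subring "\<int> :: 'k set" by (rule field_subring_Ints)
  define W where "W = (poly_over \<int> :: 'k poly set)"
  define h where "h f = poly f t" for f
  have W_diff: "f - g \<in> W" if "f \<in> W" "g \<in> W" for f g
    using that by (auto simp: W_def poly_over_def)
  have W_const: "[:x:] \<in> W" if "x \<in> \<int>" for x
    using that by (auto simp: W_def poly_over_def coeff_pCons split: nat.split)
  have inj: "inj_on h W"
  proof (rule inj_onI)
    fix f g assume "f \<in> W" "g \<in> W" "h f = h g"
    hence "f - g = 0" using t W_diff[of f g] by (auto simp: W_def h_def)
    thus "f = g" by simp
  qed
  define d where "d x = degree (the_inv_into W h x)" for x
  have d: "d (h f) = degree f" if "f \<in> W" for f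
    using that inj by (simp add: d_def the_inv_into_f_f)
  have h0: "h f = 0 \<longleftrightarrow> f = 0" if "f \<in> W" for f
    using that t by (auto simp: h_def W_def)
  have fs: "field_subring (h ` W)"
  proof
    show "0 \<in> h ` W" by (intro image_eqI[of _ _ 0]) (auto simp: h_def W_def poly_over_def)
    show "1 \<in> h ` W" by (intro image_eqI[of _ _ 1]) (auto simp: h_def W_def intro: Z.poly_over_one)
    fix x y assume "x \<in> h ` W" "y \<in> h ` W"
    then obtain f g where fg: "f \<in> W" "x = h f" "g \<in> W" "y = h g" by blast
    show "x + y \<in> h ` W"
      using fg by (intro image_eqI[of _ _ "f + g"]) (auto simp: h_def W_def intro: Z.poly_over_add)
    show "x * y \<in> h ` W"
      using fg by (intro image_eqI[of _ _ "f * g"]) (auto simp: h_def W_def intro: Z.poly_over_mult)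
  next
    fix x assume "x \<in> h ` W"
    then obtain f where f: "f \<in> W" "x = h f" by blast
    show "- x \<in> h ` W"
      using f by (intro image_eqI[of _ _ "- f"]) (auto simp: h_def W_def intro: Z.poly_over_uminus)
  qed
  interpret field_subring "h ` W" by (rule fs)
  have "euclidean_subring (h ` W) d"
  proof
    fix a b assume "a \<in> h ` W" "b \<in> h ` W" "b \<noteq> 0"
    then obtain f g where fg: "f \<in> W" "a = h f" "g \<in> W" "b = h g" "g \<noteq> 0"
      using h0 by auto
    obtain q r where qr: "q \<in> W" "r \<in> W" "f = g * q + r" "r = 0 \<or> degree r < degree g"
      using poly_over_division[OF field_subring_Ints Ints_inverse_prime_CHAR[OF p], of g f] fg
      unfolding W_def by blast
    show "\<exists>q\<in>h ` W. \<exists>r\<in>h ` W. a = b * q + r \<and> (r = 0 \<or> d r < d b)"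
      using qr fg by (intro bexI[of _ "h q"] bexI[of _ "h r"]) (auto simp: d h0, auto simp: h_def)
  next
    fix n
    have "{r \<in> h ` W. d r < n} \<subseteq> h ` {f \<in> W. degree f < n}"
      using d by auto
    moreover have "finite {f \<in> W. degree f < n}"
      unfolding W_def
      using p by (intro finite_poly_over_degree_less finite_Ints_CHAR_pos) (simp add: prime_gt_0_nat)
    ultimately show "finite {r \<in> h ` W. d r < n}"
      using finite_surj by blast
  next
    fix a b assume "a \<in> h ` W" "b \<in> h ` W" "a \<noteq> 0" "b \<noteq> 0" and nu: "inverse b \<notin> h ` W"
    then obtain f g where fg: "f \<in> W" "a = h f" "g \<in> W" "b = h g" "f \<noteq> 0" "g \<noteq> 0"
      using h0 by auto
    \<comment> \<open>Nonzero constants are units, because the prime field is closed under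
      inverses.\<close>
    have "degree g > 0"
    proof (rule ccontr)
      assume "\<not> degree g > 0"
      then obtain x where x: "g = [:x:]" by (auto elim: degree_eq_zeroE)
      hence "x \<in> \<int>" using fg(3) by (auto simp: W_def poly_over_def dest: spec[of _ 0])
      hence "[:inverse x:] \<in> W"
        by (intro W_const Ints_inverse_prime_CHAR[OF p])
      hence "h [:inverse x:] \<in> h ` W" by blast
      thus False using nu by (simp add: h_def fg(4) x)
    qed
    moreover have "f * g \<in> W" using fg by (auto simp: W_def intro: Z.poly_over_mult)
    moreover have "a * b = h (f * g)" by (simp add: h_def fg)
    ultimately show "d a < d (a * b)"
      using fg by (simp add: d degree_mult_eq)
  qed
  thus ?thesis unfolding h_def W_def by blast
qed

lemma is_Z_or_Fp_t_euclidean: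
  assumes "is_Z_or_Fp_t R"
  shows "\<exists>d. euclidean_subring R d"
  using assms euclidean_subring_Ints euclidean_subring_poly unfolding is_Z_or_Fp_t_def by blast

section \<open>Fraction fields and common denominators\<close>

context field_subring
begin

lemma subset_fraction_field: "B \<subseteq> fraction_field B"
proof
  fix x assume "x \<in> B"
  moreover have "x = x / 1" by simp
  ultimately show "x \<in> fraction_field B"
    unfolding fraction_field_def mem_Collect_eq by (intro exI[of _ x] exI[of _ 1]) simp
qed

lemma field_subring_fraction_field: "field_subring (fraction_field B)"
proof
  show "0 \<in> fraction_field B" "1 \<in> fraction_field B" using subset_fraction_field by auto
  fix x y assume "x \<in> fraction_field B" "y \<in> fraction_field B"
  then obtain a b a' b' where *: "x = a / b" "y = a' / b'" "a \<in> B" "b \<in> B" "a' \<in> B" "b' \<in> B"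
    "b \<noteq> 0" "b' \<noteq> 0"
    by (auto simp: fraction_field_def)
  have "x + y = (a * b' + a' * b) / (b * b')" "x * y = (a * a') / (b * b')"
    using * by (auto simp: field_simps)
  moreover have "b * b' \<noteq> 0" "b * b' \<in> B" "a * b' + a' * b \<in> B" "a * a' \<in> B"
    using * by auto
  ultimately show "x + y \<in> fraction_field B" "x * y \<in> fraction_field B"
    unfolding fraction_field_def by blast+
next
  fix x assume "x \<in> fraction_field B"
  then obtain a b where "x = a / b" "a \<in> B" "b \<in> B" "b \<noteq> 0"
    by (auto simp: fraction_field_def)
  moreover have "- x = (- a) / b" "- a \<in> B" using calculation by auto
  ultimately show "- x \<in> fraction_field B"
    unfolding fraction_field_def by blast
qed

lemma fraction_field_inverse: "x \<in> fraction_field B \<Longrightarrow> inverse x \<in> fraction_field B"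
proof (cases "x = 0")
  case False
  assume "x \<in> fraction_field B"
  then obtain a b where "x = a / b" "a \<in> B" "b \<in> B" "b \<noteq> 0"
    by (auto simp: fraction_field_def)
  with False have "inverse x = b / a" "a \<noteq> 0" by auto
  thus ?thesis using \<open>a \<in> B\<close> \<open>b \<in> B\<close> unfolding fraction_field_def by blast
qed (use subset_fraction_field in auto)

lemma common_denominator:
  assumes "finite Y" "\<And>x. x \<in> Y \<Longrightarrow> f x \<in> fraction_field B"
  shows "\<exists>r\<in>B. r \<noteq> 0 \<and> (\<forall>x\<in>Y. r * f x \<in> B)"
  using assms
proof (induction Y rule: finite_induct)
  case empty
  thus ?case by (intro bexI[of _ 1]) auto
next
  case (insert x Y)
  then obtain r where r: "r \<in> B" "r \<noteq> 0" "\<forall>x\<in>Y. r * f x \<in> B" by auto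
  obtain a b where ab: "f x = a / b" "a \<in> B" "b \<in> B" "b \<noteq> 0"
    using insert.prems[of x] by (auto simp: fraction_field_def)
  have "(r * b) * f y \<in> B" if "y \<in> insert x Y" for y
  proof (cases "y = x")
    case False
    hence "b * (r * f y) \<in> B" using that r ab by blast
    thus ?thesis by (simp add: mult_ac)
  qed (use ab r in auto)
  thus ?case using r ab by (intro bexI[of _ "r * b"]) auto
qed

lemma subfield_fraction_field: "subfield (fraction_field B) (ring_of_type_algebra :: 'k ring)"
proof -
  interpret F: field_subring "fraction_field B" by (rule field_subring_fraction_field)
  interpret K: field "ring_of_type_algebra :: 'k ring" by (rule field_from_type_algebra)
  show ?thesis
  proof (rule K.subfieldI')
    have "\<ominus>\<^bsub>ring_of_type_algebra\<^esub> x = - x" for x :: 'k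
      by (rule K.minus_equality) auto
    thus "subring (fraction_field B) ring_of_type_algebra"
      by (intro K.subringI) auto
    fix x assume "x \<in> fraction_field B - {\<zero>\<^bsub>ring_of_type_algebra\<^esub>}"
    hence x: "x \<in> fraction_field B" "x \<noteq> 0" by auto
    have "inv\<^bsub>ring_of_type_algebra\<^esub> x = inverse x"
      using x by (intro K.comm_inv_char) auto
    thus "inv\<^bsub>ring_of_type_algebra\<^esub> x \<in> fraction_field B"
      using x fraction_field_inverse by simp
  qed
qed

text \<open>More than \<open>D = [K : F]\<close> elements are linearly dependent over
  \<open>F\<close>, and a common denominator moves the coefficients of the relation into
  \<open>B\<close>.\<close>

lemma finite_extension_dependent:
  assumes "finite_extension (fraction_field B)"
  shows "\<exists>D. \<forall>Y :: 'k set. finite Y \<longrightarrow> card Y > D \<longrightarrow>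
           (\<exists>c. (\<forall>x\<in>Y. c x \<in> B) \<and> (\<exists>x\<in>Y. c x \<noteq> 0) \<and> (\<Sum>x\<in>Y. c x * x) = 0)"
proof -
  interpret K: field "ring_of_type_algebra :: 'k ring" by (rule field_from_type_algebra)
  note sf = subfield_fraction_field
  obtain D where D: "K.dimension D (fraction_field B) UNIV"
    using assms unfolding finite_extension_def K.finite_dimension_def by blast
  \<comment> \<open>In a list without repetitions a coefficient depends only on the element, so the
    relation between lists becomes a sum over a set.\<close>
  have combine: "\<exists>c. K.combine Ks xs = (\<Sum>x\<in>set xs. c x * x) \<and> c ` set xs = set Ks"
    if "length Ks = length xs" "distinct xs" for Ks xs :: "'k list"
    using that
  proof (induction Ks xs rule: list_induct2)
    case (Cons k Ks x xs)
    then obtain c where c: "K.combine Ks xs = (\<Sum>x\<in>set xs. c x * x)" "c ` set xs = set Ks"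
      by auto
    have x: "x \<notin> set xs" using Cons.prems by simp
    have "(\<Sum>y\<in>set xs. (c(x := k)) y * y) = (\<Sum>y\<in>set xs. c y * y)"
      using x by (intro sum.cong) auto
    moreover have "(c(x := k)) ` set xs = c ` set xs"
      using x by (intro image_cong) auto
    ultimately show ?case
      using c x by (intro exI[of _ "c(x := k)"]) auto
  qed auto
  show ?thesis
  proof (intro exI[of _ D] allI impI)
    fix Y :: "'k set" assume Y: "finite Y" "card Y > D"
    obtain xs where xs: "set xs = Y" "distinct xs"
      using finite_distinct_list[OF Y(1)] by blast
    have dep: "K.dependent (fraction_field B) xs"
      using K.independent_length_le_dimension[OF sf D, of xs] Y xs distinct_card[of xs] by auto
    obtain Ks where Ks: "length Ks = length xs" "K.combine Ks xs = 0"
        "set Ks \<subseteq> fraction_field B" "set Ks \<noteq> {0}"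
      by (rule K.dependent_imp_non_trivial_combine[OF sf _ dep]) auto
    obtain c where c: "(\<Sum>x\<in>Y. c x * x) = 0" "c ` Y = set Ks"
      using combine[OF Ks(1) xs(2)] Ks(2) xs(1) by auto
    have "set Ks \<noteq> {}" using Ks(1) Y xs by auto
    hence "\<not> set Ks \<subseteq> {0}" using Ks(4) by (simp add: subset_singleton_iff)
    hence nz: "\<exists>x\<in>Y. c x \<noteq> 0" using c(2)[symmetric] by auto
    obtain r where r: "r \<in> B" "r \<noteq> 0" "\<forall>x\<in>Y. r * c x \<in> B"
      using common_denominator[OF Y(1), of c] c(2) Ks(3) by blast
    have "(\<Sum>x\<in>Y. (r * c x) * x) = r * (\<Sum>x\<in>Y. c x * x)"
      by (simp add: sum_distrib_left mult_ac)
    hence "(\<Sum>x\<in>Y. (r * c x) * x) = 0" using c(1) by simp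
    thus "\<exists>c. (\<forall>x\<in>Y. c x \<in> B) \<and> (\<exists>x\<in>Y. c x \<noteq> 0) \<and> (\<Sum>x\<in>Y. c x * x) = 0"
      using r nz by (intro exI[of _ "\<lambda>x. r * c x"]) auto
  qed
qed

text \<open>Multiplying the monic equation of degree \<open>n\<close> by \<open>r ^ n\<close> gives
  one for \<open>r * x\<close>. The coefficient of \<open>x ^ i\<close> acquires the factor
  \<open>r ^ (n - i)\<close>, one \<open>r\<close> of which clears its denominator.\<close>

lemma algebraic_integral_multiple:
  assumes f: "f \<in> poly_over (fraction_field B)" "lead_coeff f = 1" "poly f x = 0"
  shows "\<exists>r\<in>B. r \<noteq> 0 \<and> r * x \<in> integral_closure B"
proof -
  define n where "n = degree f"
  obtain r where r: "r \<in> B" "r \<noteq> 0" "\<forall>i\<in>{..<n}. r * poly.coeff f i \<in> B"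
    using common_denominator[of "{..<n}" "poly.coeff f"] f(1) by (auto simp: poly_over_def)
  have "0 = (\<Sum>i<n. poly.coeff f i * x ^ i) + x ^ n"
    using f(2,3) by (simp add: n_def poly_altdef lessThan_Suc_atMost[symmetric])
  hence xn: "x ^ n = - (\<Sum>i<n. poly.coeff f i * x ^ i)"
    by (simp add: eq_neg_iff_add_eq_0 add.commute)
  define c where "c i = (if i < n then - (r * poly.coeff f i) * r ^ (n - Suc i) else 0)" for i
  have "(r * x) ^ n = r ^ n * (- (\<Sum>i<n. poly.coeff f i * x ^ i))"
    by (simp add: power_mult_distrib xn)
  also have "\<dots> = (\<Sum>i<n. - (r ^ n * poly.coeff f i * x ^ i))"
    by (simp add: sum_distrib_left sum_negf mult_ac)
  also have "\<dots> = (\<Sum>i<n. c i * (r * x) ^ i)"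
  proof (rule sum.cong)
    fix i assume i: "i \<in> {..<n}"
    have "r ^ n = r * r ^ (n - Suc i) * r ^ i"
      using i by (simp flip: power_Suc power_add)
    thus "- (r ^ n * poly.coeff f i * x ^ i) = c i * (r * x) ^ i"
      using i by (simp add: c_def power_mult_distrib)
  qed auto
  finally have "(r * x) ^ n = (\<Sum>i<n. c i * (r * x) ^ i)" .
  moreover have "c i \<in> B" for i
    using r by (auto simp: c_def)
  ultimately have "r * x \<in> integral_closure B"
    unfolding integral_closure_iff by blast
  thus ?thesis using r by blast
qed

text \<open>In an equation of least degree for \<open>x\<close> the constant term is nonzero, and it
  is a multiple of \<open>x\<close> within the integral closure.\<close>

lemma integral_multiple_in_subring:
  assumes x: "x \<in> integral_closure B" "x \<noteq> 0"
  shows "\<exists>y\<in>integral_closure B. x * y \<in> B \<and> x * y \<noteq> 0"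
proof -
  interpret OK: field_subring "integral_closure B" by (rule field_subring_integral_closure)
  define Q where "Q n \<longleftrightarrow> (\<exists>c. (\<forall>i. c i \<in> B) \<and> x ^ n = (\<Sum>i<n. c i * x ^ i))" for n
  define n where "n = (LEAST n. Q n)"
  have "\<exists>n. Q n" using x(1) by (simp add: integral_closure_iff Q_def)
  hence "Q n" unfolding n_def by (rule LeastI_ex)
  then obtain c where c: "\<And>i. c i \<in> B" "x ^ n = (\<Sum>i<n. c i * x ^ i)"
    by (auto simp: Q_def)
  have "n > 0" using c(2) by (auto intro!: Nat.gr0I)
  then obtain k where k: "n = Suc k" by (auto simp: gr0_conv_Suc)
  have eq: "x ^ n = c 0 + x * (\<Sum>i<k. c (Suc i) * x ^ i)"
    unfolding c(2) unfolding k
    by (simp add: sum.lessThan_Suc_shift sum_distrib_left mult_ac del: sum.lessThan_Suc)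
  \<comment> \<open>Without a constant term the equation could be divided by \<open>x\<close>,
    against the minimality of \<open>n\<close>.\<close>
  have "c 0 \<noteq> 0"
  proof
    assume "c 0 = 0"
    hence "x * x ^ k = x * (\<Sum>i<k. c (Suc i) * x ^ i)"
      using eq by (simp add: k)
    hence "x ^ k = (\<Sum>i<k. c (Suc i) * x ^ i)" using x(2) by simp
    hence "Q k" unfolding Q_def using c(1) by (intro exI[of _ "\<lambda>i. c (Suc i)"]) auto
    hence "n \<le> k" unfolding n_def by (rule Least_le)
    thus False using k by simp
  qed
  define y where "y = x ^ k - (\<Sum>i<k. c (Suc i) * x ^ i)"
  have "x * y = c 0" using eq by (simp add: y_def k algebra_simps)
  moreover have "y \<in> integral_closure B"
    unfolding y_def using x(1) c(1) subset_integral_closure by blast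
  ultimately show ?thesis using \<open>c 0 \<noteq> 0\<close> c(1) by (intro bexI[of _ y]) simp_all
qed

end

section \<open>Finiteness of the residue rings\<close>

text \<open>Finiteness of \<open>B / a B\<close>, stated through a finite set of representatives,
  which may repeat classes.\<close>

definition finite_quotient :: "'k::field set \<Rightarrow> 'k \<Rightarrow> bool" where
  "finite_quotient B a \<longleftrightarrow> (\<exists>S. finite S \<and> S \<subseteq> B \<and> (\<forall>x\<in>B. \<exists>s\<in>S. \<exists>z\<in>B. x = s + a * z))"

context field_subring
begin

lemma finite_quotient_pigeonhole:
  assumes "finite_quotient B a" "\<And>n. f n \<in> B"
  shows "\<exists>i j. i < (j :: nat) \<and> (\<exists>z\<in>B. f j - f i = a * z)"
proof -
  obtain S where S: "finite S" "\<forall>x\<in>B. \<exists>s\<in>S. \<exists>z\<in>B. x = s + a * z"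
    using assms(1) by (auto simp: finite_quotient_def)
  define g where "g n = (SOME s. s \<in> S \<and> (\<exists>z\<in>B. f n = s + a * z))" for n
  have "\<exists>s. s \<in> S \<and> (\<exists>z\<in>B. f n = s + a * z)" for n
    using bspec[OF S(2) assms(2)] by blast
  hence g: "g n \<in> S \<and> (\<exists>z\<in>B. f n = g n + a * z)" for n
    unfolding g_def by (rule someI_ex)
  have "\<not> inj g"
  proof
    assume "inj g"
    hence "infinite (range g)" by (rule range_inj_infinite)
    moreover have "range g \<subseteq> S" using g by auto
    ultimately show False using S(1) finite_subset by blast
  qed
  then obtain k l where "k \<noteq> l" "g k = g l" by (auto simp: inj_def)
  then obtain i j where ij: "i < j" "g i = g j"
    by (cases k l rule: linorder_cases) auto
  obtain z w where "z \<in> B" "f i = g i + a * z" "w \<in> B" "f j = g j + a * w"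
    using g[of i] g[of j] by auto
  hence "f j - f i = a * (w - z)" "w - z \<in> B"
    using ij(2) by (auto simp: algebra_simps)
  thus ?thesis using ij(1) by auto
qed

text \<open>Representatives are formed like numbers with two digits: the quotient left after
  reduction modulo \<open>a\<close> is reduced modulo \<open>b\<close>.\<close>

lemma finite_quotient_mult:
  assumes a: "a \<in> B" "finite_quotient B a" and b: "finite_quotient B b"
  shows "finite_quotient B (a * b)"
proof -
  obtain S where S: "finite S" "S \<subseteq> B" "\<forall>x\<in>B. \<exists>s\<in>S. \<exists>z\<in>B. x = s + a * z"
    using a(2) by (auto simp: finite_quotient_def)
  obtain S' where S': "finite S'" "S' \<subseteq> B" "\<forall>x\<in>B. \<exists>s\<in>S'. \<exists>z\<in>B. x = s + b * z"
    using b by (auto simp: finite_quotient_def)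
  let ?U = "(\<lambda>(s, t). s + a * t) ` (S \<times> S')"
  have "\<exists>s\<in>?U. \<exists>z\<in>B. x = s + a * b * z" if x: "x \<in> B" for x
  proof -
    obtain s z where s: "s \<in> S" "z \<in> B" "x = s + a * z" using S(3) x by blast
    obtain t w where t: "t \<in> S'" "w \<in> B" "z = t + b * w" using S'(3) s(2) by blast
    have "x = (s + a * t) + a * b * w" by (simp add: s(3) t(3) algebra_simps)
    thus ?thesis using s(1) t(1,2) by force
  qed
  moreover have "?U \<subseteq> B" using S(2) S'(2) a(1) by auto
  ultimately show ?thesis
    using S(1) S'(1) unfolding finite_quotient_def by (intro exI[of _ ?U]) auto
qed

lemma finite_quotient_factor:
  assumes "finite_quotient B (a * y)" "y \<in> B"
  shows "finite_quotient B a"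
proof -
  obtain S where S: "finite S" "S \<subseteq> B" "\<forall>x\<in>B. \<exists>s\<in>S. \<exists>z\<in>B. x = s + a * y * z"
    using assms(1) by (auto simp: finite_quotient_def)
  have "\<exists>s\<in>S. \<exists>z\<in>B. x = s + a * z" if "x \<in> B" for x
    using S(3) that assms(2) by (metis mult.assoc mult_mem)
  thus ?thesis using S unfolding finite_quotient_def by blast
qed

text \<open>Substituting the monic polynomial \<open>Y\<^sup>j - Y\<^sup>i\<close> into an integral equation for \<open>u\<^sup>j - u\<^sup>i\<close>
  gives an integral equation for \<open>u\<close>.\<close>

lemma integral_closure_power_diff:
  assumes "u ^ j - u ^ i \<in> integral_closure B" "i < j"
  shows "u \<in> integral_closure B"
proof -
  obtain f where f: "f \<in> poly_over B" "lead_coeff f = 1" "poly f (u ^ j - u ^ i) = 0"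
    using assms(1) by (auto simp: integral_closure_def)
  define g :: "'k poly" where "g = Polynomial.monom 1 j - Polynomial.monom 1 i"
  have coeff: "poly.coeff g k = (if k = j then 1 else if k = i then - 1 else 0)" for k
    using assms(2) by (auto simp: g_def)
  have deg: "degree g = j"
    using assms(2) by (intro antisym degree_le le_degree) (auto simp: coeff)
  have g: "g \<in> poly_over B" by (auto simp: poly_over_def coeff)
  have "pcompose q g \<in> poly_over B" if "q \<in> poly_over B" for q
    using that
  proof (induction q rule: pCons_induct)
    case (pCons a q)
    have "a \<in> B" "q \<in> poly_over B"
      using pCons.prems by (auto simp: poly_over_def coeff_pCons split: nat.splits)
    moreover from this have "[:a:] \<in> poly_over B"
      by (auto simp: poly_over_def coeff_pCons split: nat.split)
    ultimately show ?case
      unfolding pcompose_pCons by (intro poly_over_add poly_over_mult g pCons.IH)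
  qed simp
  moreover have "lead_coeff (pcompose f g) = 1"
    using f(2) deg assms(2) by (subst lead_coeff_comp) (auto simp: coeff)
  moreover have "poly (pcompose f g) u = 0"
    using f(3) by (simp add: poly_pcompose g_def poly_monom)
  ultimately show ?thesis
    using f(1) unfolding integral_closure_def mem_Collect_eq by (intro bexI[of _ "pcompose f g"] conjI)
qed

end

context euclidean_subring
begin

text \<open>A nonzero element of least size in the ideal generated by \<open>a\<close> and
  \<open>b\<close> divides every element of it, since remainders stay in the ideal.\<close>

lemma bezout:
  assumes ab: "a \<in> R" "b \<in> R" "b \<noteq> 0"
  shows "\<exists>g\<in>R. (\<exists>x\<in>R. a = g * x) \<and> (\<exists>y\<in>R. b = g * y) \<and> (\<exists>u\<in>R. \<exists>w\<in>R. g = a * u + b * w)"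
proof -
  define I where "I = {a * u + b * w | u w. u \<in> R \<and> w \<in> R}"
  have I_R: "I \<subseteq> R" using ab by (auto simp: I_def)
  have I_comb: "x - y * q \<in> I" if xy: "x \<in> I" "y \<in> I" "q \<in> R" for x y q
  proof -
    obtain u w u' w' where *: "u \<in> R" "w \<in> R" "u' \<in> R" "w' \<in> R"
        "x = a * u + b * w" "y = a * u' + b * w'"
      using xy by (auto simp: I_def)
    have "x - y * q = a * (u - u' * q) + b * (w - w' * q)"
      by (simp add: * algebra_simps)
    moreover have "u - u' * q \<in> R" "w - w' * q \<in> R" using * xy(3) by auto
    ultimately show ?thesis by (auto simp: I_def)
  qed
  have a: "a \<in> I" unfolding I_def by (rule CollectI, rule exI[of _ 1], rule exI[of _ 0]) auto
  have b: "b \<in> I" unfolding I_def by (rule CollectI, rule exI[of _ 0], rule exI[of _ 1]) auto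
  obtain g where g: "g \<in> I" "g \<noteq> 0" "\<And>x. x \<in> I \<Longrightarrow> x \<noteq> 0 \<Longrightarrow> d g \<le> d x"
    using ex_has_least_nat[of "\<lambda>x. x \<in> I \<and> x \<noteq> 0" b d] b ab(3) by blast
  have dvd: "\<exists>x\<in>R. e = g * x" if e: "e \<in> I" for e
  proof -
    obtain q r where qr: "q \<in> R" "r \<in> R" "e = g * q + r" "r = 0 \<or> d r < d g"
      using division[of e g] e g I_R by blast
    have "r = e - g * q" using qr(3) by simp
    hence "r \<in> I" using I_comb e g(1) qr(1) by simp
    hence "r = 0" using g(3)[of r] qr(4) by fastforce
    thus ?thesis using qr by auto
  qed
  have "\<exists>u\<in>R. \<exists>w\<in>R. g = a * u + b * w" using g(1) by (auto simp: I_def)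
  thus ?thesis using dvd[OF a] dvd[OF b] g(1) I_R by blast
qed

text \<open>A nonunit divisor \<open>\<pi>\<close> of \<open>r\<close> of least size is prime. The
  last property says that \<open>R / \<pi>\<close> is a field, and \<open>d r' < d r\<close>
  supports induction on the size.\<close>

lemma prime_divisor:
  assumes r: "r \<in> R" "r \<noteq> 0" "inverse r \<notin> R"
  obtains \<pi> r' where "\<pi> \<in> R" "r' \<in> R" "r = \<pi> * r'" "inverse \<pi> \<notin> R" "d r' < d r"
    "\<And>x. x \<in> R \<Longrightarrow> (\<exists>y\<in>R. x = \<pi> * y) \<or> (\<exists>y\<in>R. \<exists>z\<in>R. x * y - 1 = \<pi> * z)"
proof -
  define Q where "Q q \<longleftrightarrow> q \<in> R \<and> inverse q \<notin> R \<and> (\<exists>s\<in>R. r = q * s)" for q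
  have "Q r" using r by (auto simp: Q_def intro!: bexI[of _ 1])
  then obtain \<pi> where "Q \<pi>" and min: "\<And>q. Q q \<Longrightarrow> d \<pi> \<le> d q"
    using ex_has_least_nat[of Q r d] by blast
  then obtain r' where \<pi>: "\<pi> \<in> R" "inverse \<pi> \<notin> R" "r' \<in> R" "r = \<pi> * r'" by (auto simp: Q_def)
  have nz: "\<pi> \<noteq> 0" "r' \<noteq> 0" using \<pi>(4) r(2) by auto
  have "d r' < d r" using size_mult[of r' \<pi>] \<pi> nz by (simp add: mult.commute)
  moreover have "(\<exists>y\<in>R. x = \<pi> * y) \<or> (\<exists>y\<in>R. \<exists>z\<in>R. x * y - 1 = \<pi> * z)" if x: "x \<in> R" for x
  proof -
    obtain g x' h u w where g: "g \<in> R" "x' \<in> R" "x = g * x'" "h \<in> R" "\<pi> = g * h"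
        "u \<in> R" "w \<in> R" "g = x * u + \<pi> * w"
      using bezout[OF x \<pi>(1) nz(1)] by blast
    have gh: "g \<noteq> 0" "h \<noteq> 0" using nz(1) g(5) by auto
    show ?thesis
    proof (cases "inverse g \<in> R")
      case True
      have "x * (u * inverse g) - 1 = \<pi> * (- (w * inverse g))"
      proof -
        have "(x * u + \<pi> * w) * inverse g = 1" using gh(1) g(8) by simp
        thus ?thesis by (simp add: algebra_simps)
      qed
      moreover have "u * inverse g \<in> R" "- (w * inverse g) \<in> R" using True g(6,7) by auto
      ultimately show ?thesis by blast
    next
      case False
      have "r = g * (h * r')" using \<pi>(4) g(5) by (simp add: mult.assoc)
      hence "Q g" using False g(1,4) \<pi>(3) by (auto simp: Q_def)
      \<comment> \<open>If \<open>h\<close> were a nonunit, then \<open>g\<close> would be a nonunit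
        divisor of \<open>r\<close> smaller than \<open>\<pi> = g * h\<close>.\<close>
      hence "inverse h \<in> R"
        using min[of g] size_mult[of g h] g(1,4,5) gh by fastforce
      moreover have "x = \<pi> * (inverse h * x')" using g(3,5) gh by simp
      ultimately show ?thesis using g(2) by blast
    qed
  qed
  ultimately show ?thesis using that \<pi> by blast
qed

lemma finite_quotient_self:
  assumes "b \<in> R" "b \<noteq> 0"
  shows "finite_quotient R b"
  unfolding finite_quotient_def
proof (intro exI[of _ "insert 0 {r \<in> R. d r < d b}"] conjI ballI)
  fix a assume "a \<in> R"
  then obtain q r where "q \<in> R" "r \<in> R" "a = b * q + r" "r = 0 \<or> d r < d b"
    using division assms by blast
  thus "\<exists>s\<in>insert 0 {r \<in> R. d r < d b}. \<exists>z\<in>R. a = s + b * z"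
    by (intro bexI[of _ r] bexI[of _ q]) auto
qed (use finite_size in auto)

end

text \<open>The extension enters through two facts. \<open>dependent\<close> is the bound
  \<open>[K : F] \<le> D\<close> with denominators cleared; \<open>integral_multiple\<close> makes
  every element of \<open>K\<close> a fraction of an element of \<open>OK\<close> by one of
  \<open>R\<close>.\<close>

locale integral_extension = euclidean_subring R d
  for R :: "'k::field set" and d :: "'k \<Rightarrow> nat" +
  fixes D :: nat
  assumes dependent: "finite Y \<Longrightarrow> D < card Y \<Longrightarrow>
      \<exists>c. (\<forall>y\<in>Y. c y \<in> R) \<and> (\<exists>y\<in>Y. c y \<noteq> 0) \<and> (\<Sum>y\<in>Y. c y * y) = 0"
    and integral_multiple: "\<exists>r\<in>R. r \<noteq> 0 \<and> r * x \<in> integral_closure R"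
begin

abbreviation OK :: "'k set" where "OK \<equiv> integral_closure R"

sublocale OK: field_subring OK
  by (rule field_subring_integral_closure)

lemma R_OK [intro]: "x \<in> R \<Longrightarrow> x \<in> OK"
  using subset_integral_closure by blast

text \<open>A set that is independent modulo \<open>\<pi>\<close> is linearly independent: in a linear relation with
  coefficients in \<open>R\<close> one could divide all coefficients by \<open>\<pi>\<close> indefinitely. This bounds the
  dimension of \<open>O\<^sub>K / \<pi> O\<^sub>K\<close> without knowing that \<open>O\<^sub>K\<close> is finitely generated.\<close>

lemma finite_quotient_prime:
  assumes \<pi>: "\<pi> \<in> R" "\<pi> \<noteq> 0" "inverse \<pi> \<notin> R"
    and prime: "\<And>x. x \<in> R \<Longrightarrow> (\<exists>y\<in>R. x = \<pi> * y) \<or> (\<exists>y\<in>R. \<exists>z\<in>R. x * y - 1 = \<pi> * z)"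
  shows "finite_quotient OK \<pi>"
proof -
  \<comment> \<open>Linear independence of the classes of \<open>Y\<close> in
    \<open>OK / \<pi> OK\<close> over the field \<open>R / \<pi>\<close>, phrased with
    representatives.\<close>
  define indep where "indep Y \<longleftrightarrow> finite Y \<and> Y \<subseteq> OK \<and>
    (\<forall>c. (\<forall>y\<in>Y. c y \<in> R) \<and> (\<exists>z\<in>OK. (\<Sum>y\<in>Y. c y * y) = \<pi> * z) \<longrightarrow> (\<forall>y\<in>Y. \<exists>b\<in>R. c y = \<pi> * b))" for Y
  have indepD: "\<exists>b\<in>R. c y = \<pi> * b"
    if "indep Y" "\<And>y. y \<in> Y \<Longrightarrow> c y \<in> R" "z \<in> OK" "(\<Sum>y\<in>Y. c y * y) = \<pi> * z" "y \<in> Y" for Y c z y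
    using that unfolding indep_def by blast
  have card: "card Y \<le> D" if Y: "indep Y" for Y
  proof (rule ccontr)
    assume "\<not> card Y \<le> D"
    moreover have "finite Y" using Y by (simp add: indep_def)
    ultimately obtain c y0 where c: "\<forall>y\<in>Y. c y \<in> R" "(\<Sum>y\<in>Y. c y * y) = 0" "y0 \<in> Y" "c y0 \<noteq> 0"
      using dependent[of Y] by auto
    have "c y0 = 0" if "\<forall>y\<in>Y. c y \<in> R" "(\<Sum>y\<in>Y. c y * y) = 0" for c
      using that
    \<comment> \<open>The size of one nonzero coefficient measures the descent: division by the
      nonunit \<open>\<pi>\<close> lowers it.\<close>
    proof (induction "d (c y0)" arbitrary: c rule: less_induct)
      case less
      have "\<forall>y\<in>Y. \<exists>b\<in>R. c y = \<pi> * b"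
        using indepD[OF Y, of c 0] less.prems by auto
      then obtain b where b: "\<forall>y\<in>Y. b y \<in> R \<and> c y = \<pi> * b y" by metis
      have "(\<Sum>y\<in>Y. c y * y) = \<pi> * (\<Sum>y\<in>Y. b y * y)"
        using b by (auto simp: sum_distrib_left mult.assoc intro!: sum.cong)
      hence sum: "(\<Sum>y\<in>Y. b y * y) = 0" using less.prems(2) \<pi>(2) by simp
      show "c y0 = 0"
      proof (rule ccontr)
        assume "c y0 \<noteq> 0"
        hence "b y0 \<noteq> 0" "d (b y0) < d (c y0)"
          using b c(3) size_mult[of "b y0" \<pi>] \<pi> by (auto simp: mult.commute)
        thus False using less.hyps[of b] b sum by blast
      qed
    qed
    thus False using c by blast
  qed
  have "indep {}" by (simp add: indep_def)
  \<comment> \<open>The bound \<open>D\<close> allows the choice of an independent set of maximal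
    size; it spans \<open>OK\<close> modulo \<open>\<pi>\<close>.\<close>
  hence "\<exists>Y. indep Y \<and> (\<forall>Z. indep Z \<longrightarrow> card Z \<le> card Y)"
    using card by (intro ex_has_greatest_nat[where b = "Suc D"]) (auto simp: less_Suc_eq_le)
  then obtain Y where Y: "indep Y" and max: "\<And>Z. indep Z \<Longrightarrow> card Z \<le> card Y"
    by blast
  have fin: "finite Y" and Y_OK: "Y \<subseteq> OK" using Y by (auto simp: indep_def)
  have span: "\<exists>c z. (\<forall>y\<in>Y. c y \<in> R) \<and> z \<in> OK \<and> x = (\<Sum>y\<in>Y. c y * y) + \<pi> * z"
    if x: "x \<in> OK" for x
  proof (cases "x \<in> Y")
    case True
    hence "(\<Sum>y\<in>Y. (if y = x then 1 else 0) * y) = x"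
      using fin by (simp add: if_distrib[of "\<lambda>a. a * _"] cong: if_cong)
    thus ?thesis by (intro exI[of _ "\<lambda>y. if y = x then 1 else 0"] exI[of _ 0]) auto
  next
    case False
    have "\<not> indep (insert x Y)" using max[of "insert x Y"] False fin by auto
    then obtain c z where c: "\<forall>y\<in>insert x Y. c y \<in> R" "z \<in> OK" "c x * x + (\<Sum>y\<in>Y. c y * y) = \<pi> * z"
        and nd: "\<not> (\<forall>y\<in>insert x Y. \<exists>b\<in>R. c y = \<pi> * b)"
      using fin Y_OK x False by (auto simp: indep_def)
    \<comment> \<open>If \<open>\<pi>\<close> divided \<open>c x\<close>, that term could move to
      the right, and independence of \<open>Y\<close> would make all coefficients divisible. So
      \<open>c x\<close> is invertible modulo \<open>\<pi>\<close>, and the relation can be solved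
      for \<open>x\<close>.\<close>
    have "\<not> (\<exists>b\<in>R. c x = \<pi> * b)"
    proof
      assume ex: "\<exists>b\<in>R. c x = \<pi> * b"
      then obtain b where b: "b \<in> R" "c x = \<pi> * b" by blast
      have "(\<Sum>y\<in>Y. c y * y) = \<pi> * (z - b * x)"
        using c(3) b(2) by (simp add: algebra_simps)
      moreover have "z - b * x \<in> OK" using c(2) b(1) x by auto
      ultimately show False using indepD[OF Y, of c] c(1) nd ex by blast
    qed
    then obtain e g where e: "e \<in> R" "g \<in> R" "c x * e - 1 = \<pi> * g"
      using prime[of "c x"] c(1) by blast
    have "x = (c x * e - \<pi> * g) * x" using e(3) by (simp add: algebra_simps)
    also have "\<dots> = e * (c x * x) - \<pi> * (g * x)" by (simp add: algebra_simps)
    also have "c x * x = \<pi> * z - (\<Sum>y\<in>Y. c y * y)" using c(3) by (simp add: algebra_simps)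
    also have "e * (\<pi> * z - (\<Sum>y\<in>Y. c y * y)) - \<pi> * (g * x)
        = (\<Sum>y\<in>Y. (- e * c y) * y) + \<pi> * (e * z - g * x)"
      by (simp add: algebra_simps sum_distrib_left sum_negf)
    finally have "x = (\<Sum>y\<in>Y. (- e * c y) * y) + \<pi> * (e * z - g * x)" .
    moreover have "\<forall>y\<in>Y. - e * c y \<in> R" "e * z - g * x \<in> OK" using e(1,2) c(1,2) x by auto
    ultimately show ?thesis
      by (intro exI[of _ "\<lambda>y. - e * c y"] exI[of _ "e * z - g * x"] conjI)
  qed
  obtain S where S: "finite S" "S \<subseteq> R" "\<forall>x\<in>R. \<exists>s\<in>S. \<exists>z\<in>R. x = s + \<pi> * z"
    using finite_quotient_self[OF \<pi>(1,2)] by (auto simp: finite_quotient_def)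
  \<comment> \<open>Coefficients matter only modulo \<open>\<pi>\<close>, so they can be taken from
    the finite set \<open>S\<close>.\<close>
  let ?U = "(\<lambda>c. \<Sum>y\<in>Y. c y * y) ` (Y \<rightarrow>\<^sub>E S)"
  have "\<exists>s\<in>?U. \<exists>z\<in>OK. x = s + \<pi> * z" if x: "x \<in> OK" for x
  proof -
    obtain c z where c: "\<forall>y\<in>Y. c y \<in> R" "z \<in> OK" "x = (\<Sum>y\<in>Y. c y * y) + \<pi> * z"
      using span[OF x] by blast
    have "\<forall>y\<in>Y. \<exists>s w. s \<in> S \<and> w \<in> R \<and> c y = s + \<pi> * w"
    proof
      fix y assume "y \<in> Y"
      hence "c y \<in> R" using c(1) by blast
      from bspec[OF S(3) this] show "\<exists>s w. s \<in> S \<and> w \<in> R \<and> c y = s + \<pi> * w" by blast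
    qed
    from bchoice[OF this] obtain s where "\<forall>y\<in>Y. \<exists>w. s y \<in> S \<and> w \<in> R \<and> c y = s y + \<pi> * w" ..
    from bchoice[OF this] obtain w where s: "\<forall>y\<in>Y. s y \<in> S \<and> w y \<in> R \<and> c y = s y + \<pi> * w y" ..
    have "(\<Sum>y\<in>Y. c y * y) = (\<Sum>y\<in>Y. (s y + \<pi> * w y) * y)"
      using s by (intro sum.cong) auto
    also have "\<dots> = (\<Sum>y\<in>Y. s y * y) + \<pi> * (\<Sum>y\<in>Y. w y * y)"
      by (simp add: algebra_simps sum.distrib sum_distrib_left)
    also have "(\<Sum>y\<in>Y. s y * y) = (\<Sum>y\<in>Y. restrict s Y y * y)"
      by (intro sum.cong) auto
    finally have "x = (\<Sum>y\<in>Y. restrict s Y y * y) + \<pi> * ((\<Sum>y\<in>Y. w y * y) + z)"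
      using c(3) by (simp add: algebra_simps)
    moreover have "restrict s Y \<in> Y \<rightarrow>\<^sub>E S" using s by auto
    moreover have "(\<Sum>y\<in>Y. w y * y) + z \<in> OK" using s c(2) Y_OK by blast
    ultimately show ?thesis by blast
  qed
  moreover have "?U \<subseteq> OK"
    using S(2) Y_OK by (auto intro!: OK.sum_mem OK.mult_mem simp: PiE_def Pi_def)
  ultimately show ?thesis
    unfolding finite_quotient_def using fin S(1)
    by (intro exI[of _ ?U]) (auto intro!: finite_PiE)
qed

text \<open>Induction on the size of \<open>r\<close>, splitting off one prime factor at a time; for
  a unit there is a single residue class.\<close>

lemma finite_quotient_base:
  assumes "r \<in> R" "r \<noteq> 0"
  shows "finite_quotient OK r"
  using assms
proof (induction "d r" arbitrary: r rule: less_induct)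
  case less
  show ?case
  proof (cases "inverse r \<in> R")
    case True
    have "x = 0 + r * (inverse r * x)" for x using less.prems by simp
    moreover have "inverse r * x \<in> OK" if "x \<in> OK" for x using True that by auto
    ultimately show ?thesis
      unfolding finite_quotient_def by (intro exI[of _ "{0}"]) blast
  next
    case False
    obtain \<pi> r' where *: "\<pi> \<in> R" "r' \<in> R" "r = \<pi> * r'" "inverse \<pi> \<notin> R" "d r' < d r"
      "\<And>x. x \<in> R \<Longrightarrow> (\<exists>y\<in>R. x = \<pi> * y) \<or> (\<exists>y\<in>R. \<exists>z\<in>R. x * y - 1 = \<pi> * z)"
      using prime_divisor[OF less.prems False] by metis
    have "finite_quotient OK \<pi>"
      using * less.prems by (intro finite_quotient_prime) auto
    moreover have "finite_quotient OK r'"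
      using * less.prems less.hyps by auto
    ultimately show ?thesis
      using * by (auto intro: OK.finite_quotient_mult)
  qed
qed

text \<open>\<open>OK / a\<close> is a quotient of \<open>OK / (a y)\<close>, where
  \<open>a y\<close> is a nonzero element of the base ring.\<close>

lemma finite_quotient_OK:
  assumes "a \<in> OK" "a \<noteq> 0"
  shows "finite_quotient OK a"
proof -
  obtain y where "y \<in> OK" "a * y \<in> R" "a * y \<noteq> 0"
    using integral_multiple_in_subring[OF assms] by blast
  thus ?thesis using finite_quotient_base OK.finite_quotient_factor by blast
qed

end

section \<open>The valuation of a nonzero prime\<close>

text \<open>This lifts inverses: if \<open>1 - t * y\<close> lies in \<open>P\<close>, then its
  \<open>n\<close>-th power lies in \<open>P ^ n\<close>, so \<open>t * z\<close> is congruent to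
  \<open>1\<close> modulo \<open>P ^ n\<close>.\<close>

lemma (in field_subring) one_minus_power_multiple:
  assumes "t \<in> B" "y \<in> B"
  shows "\<exists>z\<in>B. 1 - (1 - t * y) ^ n = t * z"
proof (induction n)
  case (Suc n)
  then obtain z where z: "z \<in> B" "1 - (1 - t * y) ^ n = t * z" by blast
  have "1 - (1 - t * y) ^ Suc n = t * y + (1 - t * y) * (1 - (1 - t * y) ^ n)"
    by (simp add: algebra_simps)
  also have "\<dots> = t * (y + (1 - t * y) * z)" unfolding z(2) by (simp add: algebra_simps)
  finally have "1 - (1 - t * y) ^ Suc n = t * (y + (1 - t * y) * z)" .
  moreover have "y + (1 - t * y) * z \<in> B" using assms z by auto
  ultimately show ?case by blast
qed (auto intro!: bexI[of _ 0])

text \<open>The abstraction of \<open>prime_ord\<close> on which the treatment of completions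
  rests.\<close>

locale int_valuation =
  fixes v :: "'k::field \<Rightarrow> ereal"
  assumes v_zero [simp]: "v 0 = \<infinity>"
    and v_int: "x \<noteq> 0 \<Longrightarrow> \<exists>i::int. v x = ereal (of_int i)"
    and v_mult: "v (x * y) = v x + v y"
    and v_add: "min (v x) (v y) \<le> v (x + y)"

locale integral_prime = integral_extension R d D
  for R :: "'k::field set" and d :: "'k \<Rightarrow> nat" and D :: nat +
  fixes P :: "'k set"
  assumes nonzero_prime: "nonzero_prime OK P"
begin

lemma P_subset: "P \<subseteq> OK"
  and P_zero [simp]: "0 \<in> P"
  and P_add: "x \<in> P \<Longrightarrow> y \<in> P \<Longrightarrow> x + y \<in> P"
  and P_mult: "a \<in> OK \<Longrightarrow> x \<in> P \<Longrightarrow> a * x \<in> P"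
  and P_one: "1 \<notin> P"
  and P_prime: "a \<in> OK \<Longrightarrow> b \<in> OK \<Longrightarrow> a * b \<in> P \<Longrightarrow> a \<in> P \<or> b \<in> P"
proof -
  interpret primeideal P "ring_on OK"
    using nonzero_prime by (simp add: nonzero_prime_def)
  show sub: "P \<subseteq> OK" using a_subset by simp
  show "0 \<in> P" using additive_subgroup.zero_closed[OF additive_subgroup_axioms] by simp
  show "x + y \<in> P" if "x \<in> P" "y \<in> P"
    using additive_subgroup.a_closed[OF additive_subgroup_axioms that] by simp
  show "a * x \<in> P" if "a \<in> OK" "x \<in> P"
    using I_l_closed[of x a] that by simp
  show "1 \<notin> P" using one_imp_carrier I_notcarr by auto
  show "a \<in> P \<or> b \<in> P" if "a \<in> OK" "b \<in> OK" "a * b \<in> P"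
    using I_prime[of a b] that by simp
qed

lemma P_ideal: "ideal P (ring_on OK)"
  using nonzero_prime by (simp add: nonzero_prime_def primeideal_def)

lemma not_P_mult: "a \<in> OK - P \<Longrightarrow> b \<in> OK - P \<Longrightarrow> a * b \<in> OK - P"
  using P_prime by auto

lemma not_P_power: "a \<in> OK - P \<Longrightarrow> a ^ n \<in> OK - P"
  by (induction n) (use P_one not_P_mult in auto)

lemma ex_nonzero_in_P: "\<exists>r\<in>P. r \<noteq> 0"
  using nonzero_prime P_zero unfolding nonzero_prime_def by blast

text \<open>Two powers \<open>x ^ i\<close> and \<open>x ^ j\<close> agree modulo a nonzero
  \<open>r\<close> in \<open>P\<close>. Hence \<open>x ^ i * (1 - x ^ (j - i))\<close> lies in
  \<open>P\<close> while \<open>x ^ i\<close> does not.\<close>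

lemma inverse_mod_P:
  assumes x: "x \<in> OK - P"
  shows "\<exists>y\<in>OK. 1 - x * y \<in> P"
proof -
  obtain r where r: "r \<in> P" "r \<noteq> 0" using ex_nonzero_in_P by blast
  have "finite_quotient OK r"
    using r P_subset by (intro finite_quotient_OK) auto
  then obtain i j z where ij: "i < j" "z \<in> OK" "x ^ j - x ^ i = r * z"
    using OK.finite_quotient_pigeonhole[of r "\<lambda>n. x ^ n"] x by blast
  define y where "y = x ^ (j - Suc i)"
  have y: "y \<in> OK" using x by (auto simp: y_def)
  have "x ^ j = x ^ i * (x * y)"
    using ij(1) by (simp add: y_def flip: power_Suc power_add)
  hence "x ^ i * (1 - x * y) = (- z) * r"
    using ij(3) by (simp add: algebra_simps)
  also have "\<dots> \<in> P" using ij(2) r(1) by (intro P_mult) auto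
  finally have "x ^ i * (1 - x * y) \<in> P" .
  moreover have "x ^ i \<in> OK - P" using not_P_power[OF x] .
  moreover have "1 - x * y \<in> OK" using x y by auto
  ultimately have "1 - x * y \<in> P" using P_prime by blast
  thus ?thesis using y by blast
qed

text \<open>The ideal \<open>P / r\<close> of the finite ring \<open>O\<^sub>K / r\<close> is the annihilator of an element: among the
  annihilators contained in \<open>P\<close>, a maximal one is all of \<open>P\<close>.\<close>

lemma P_annihilator:
  assumes r: "r \<in> P" "r \<noteq> 0"
  shows "\<exists>b\<in>OK. \<forall>x\<in>OK. x \<in> P \<longleftrightarrow> (\<exists>z\<in>OK. x * b = r * z)"
proof -
  have rOK: "r \<in> OK" using r P_subset by auto
  have fq: "finite_quotient OK r" using r rOK by (intro finite_quotient_OK) auto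
  then obtain S where S: "finite S" "S \<subseteq> OK" "\<forall>x\<in>OK. \<exists>s\<in>S. \<exists>z\<in>OK. x = s + r * z"
    by (auto simp: finite_quotient_def)
  define ann where "ann b = {x \<in> OK. \<exists>z\<in>OK. x * b = r * z}" for b
  define good where "good b \<longleftrightarrow> b \<in> OK \<and> ann b \<subseteq> P" for b
  have ann_mult: "ann b \<subseteq> ann (c * b)" if "c \<in> OK" for b c
  proof
    fix x assume "x \<in> ann b"
    then obtain z where z: "x \<in> OK" "z \<in> OK" "x * b = r * z" by (auto simp: ann_def)
    have "x * (c * b) = r * (c * z)" using z(3) by (metis mult.left_commute)
    thus "x \<in> ann (c * b)" using z(1,2) that by (auto simp: ann_def intro!: bexI[of _ "c * z"])
  qed
  have "x \<in> P" if "x \<in> ann 1" for x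
    using that P_mult[of _ r] r(1) by (auto simp: ann_def mult.commute[of r])
  hence "good 1" by (auto simp: good_def)
  \<comment> \<open>For \<open>c\<close> in \<open>OK\<close> the set \<open>ann c\<close> is a
    union of classes modulo \<open>r\<close>, so its trace on the representatives \<open>S\<close>
    determines it. Maximality can thus be measured by a cardinality.\<close>
  have card_S: "card (ann c \<inter> S) \<le> card S" for c
    using S(1) by (intro card_mono) auto
  have "\<exists>b. good b \<and> (\<forall>c. good c \<longrightarrow> card (ann c \<inter> S) \<le> card (ann b \<inter> S))"
    using \<open>good 1\<close> card_S by (intro ex_has_greatest_nat[where b = "Suc (card S)"])
      (auto simp: less_Suc_eq_le)
  then obtain b where b: "good b" and max: "\<And>c. good c \<Longrightarrow> card (ann c \<inter> S) \<le> card (ann b \<inter> S)"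
    by blast
  have bOK: "b \<in> OK" and bP: "ann b \<subseteq> P" using b by (auto simp: good_def)
  have ann_eq: "ann (c * b) = ann b" if c: "c \<in> OK" "ann (c * b) \<subseteq> P" for c
  proof (rule ccontr)
    assume "ann (c * b) \<noteq> ann b"
    then obtain y where y: "y \<in> ann (c * b)" "y \<notin> ann b"
      using ann_mult[OF c(1), of b] by blast
    then obtain y' where y': "y \<in> OK" "y' \<in> OK" "y * (c * b) = r * y'" by (auto simp: ann_def)
    \<comment> \<open>The representative \<open>s\<close> of \<open>y\<close> separates the two
      annihilators as well, so the trace on \<open>S\<close> grows.\<close>
    obtain s z where s: "s \<in> S" "z \<in> OK" "y = s + r * z" using bspec[OF S(3) y'(1)] by blast
    have "s * (c * b) = r * (y' - z * (c * b))"
      using y'(3) s(3) by (simp add: algebra_simps)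
    moreover have "y' - z * (c * b) \<in> OK" using y'(2) s(2) c(1) bOK by auto
    ultimately have s1: "s \<in> ann (c * b)"
      using s(1) S(2) by (auto simp: ann_def)
    have "s \<notin> ann b"
    proof
      assume "s \<in> ann b"
      then obtain w where w: "w \<in> OK" "s * b = r * w" by (auto simp: ann_def)
      have "y * b = r * (w + z * b)" using w(2) s(3) by (simp add: algebra_simps)
      moreover have "w + z * b \<in> OK" using w(1) s(2) bOK by auto
      ultimately show False using y(2) y'(1) by (auto simp: ann_def)
    qed
    hence "ann b \<inter> S \<subset> ann (c * b) \<inter> S"
      using ann_mult[OF c(1), of b] s(1) s1 by blast
    hence "card (ann b \<inter> S) < card (ann (c * b) \<inter> S)"
      using S(1) by (intro psubset_card_mono) auto
    moreover have "good (c * b)" using c bOK by (auto simp: good_def)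
    ultimately show False using max[of "c * b"] by simp
  qed
  have Pb: "y \<in> ann b" if y: "y \<in> P" for y
  proof -
    have yOK: "y \<in> OK" using y P_subset by auto
    show ?thesis
    proof (cases "\<exists>k. \<not> ann (y ^ k * b) \<subseteq> P")
      case False
      \<comment> \<open>If all these annihilators stay inside \<open>P\<close>, then the repetition
        puts \<open>1 - y ^ (j - i)\<close> into \<open>P\<close>; together with
        \<open>y \<in> P\<close> this gives \<open>1 \<in> P\<close>.\<close>
      obtain i j z where ij: "i < j" "z \<in> OK" "y ^ j - y ^ i = r * z"
        using OK.finite_quotient_pigeonhole[OF fq, of "\<lambda>n. y ^ n"] yOK by blast
      have "y ^ j = y ^ (j - i) * y ^ i" using ij(1) by (simp flip: power_add)
      hence "(1 - y ^ (j - i)) * (y ^ i * b) = r * (- (z * b))"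
        using ij(3) by (simp add: algebra_simps)
      moreover have "- (z * b) \<in> OK" "1 - y ^ (j - i) \<in> OK" using ij(2) bOK yOK by auto
      ultimately have "1 - y ^ (j - i) \<in> ann (y ^ i * b)" unfolding ann_def by blast
      hence "1 - y ^ (j - i) \<in> P" using False by blast
      moreover have "y ^ (j - i) \<in> P"
        using P_mult[of "y ^ (j - i - 1)" y] yOK y ij(1)
        by (cases "j - i") (auto simp: mult.commute)
      ultimately have "1 \<in> P" using P_add by fastforce
      thus ?thesis using P_one by simp
    next
      case True
      \<comment> \<open>At the first exponent \<open>k = l + 1\<close> where the annihilator leaves
        \<open>P\<close>, some \<open>s\<close> outside \<open>P\<close> annihilates
        \<open>y ^ k * b\<close>. Then \<open>s * y\<close> annihilates \<open>y ^ l * b\<close>,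
        hence also \<open>b\<close>, and \<open>y\<close> annihilates \<open>s * b\<close>. As
        \<open>s\<close> is not in \<open>P\<close>, the element \<open>s * b\<close> has the same
        annihilator as \<open>b\<close>.\<close>
      define k where "k = (LEAST k. \<not> ann (y ^ k * b) \<subseteq> P)"
      have k: "\<not> ann (y ^ k * b) \<subseteq> P" unfolding k_def using True by (rule LeastI_ex)
      then obtain l where l: "k = Suc l" using bP by (cases k) auto
      have "ann (y ^ l * b) \<subseteq> P"
        using not_less_Least[of l "\<lambda>k. \<not> ann (y ^ k * b) \<subseteq> P"] l by (auto simp: k_def[symmetric])
      hence eq: "ann (y ^ l * b) = ann b" using ann_eq[of "y ^ l"] yOK by auto
      obtain s where s: "s \<in> ann (y ^ k * b)" "s \<notin> P" using k by blast
      then obtain z where z: "s \<in> OK" "z \<in> OK" "s * (y ^ k * b) = r * z" by (auto simp: ann_def)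
      have "(s * y) * (y ^ l * b) = r * z" using z(3) by (simp add: l mult_ac)
      hence "s * y \<in> ann (y ^ l * b)" using z yOK by (auto simp: ann_def)
      hence "s * y \<in> ann b" using eq by simp
      then obtain w where w: "w \<in> OK" "(s * y) * b = r * w" by (auto simp: ann_def)
      have "ann (s * b) \<subseteq> P"
      proof
        fix x assume "x \<in> ann (s * b)"
        then obtain w where "x \<in> OK" "w \<in> OK" "x * (s * b) = r * w" by (auto simp: ann_def)
        hence "x * s \<in> ann b" using z(1) by (auto simp: ann_def mult.assoc)
        thus "x \<in> P" using bP P_prime[of x s] \<open>x \<in> OK\<close> z(1) s(2) by blast
      qed
      hence "ann (s * b) = ann b" using ann_eq z(1) by auto
      moreover have "y \<in> ann (s * b)" using w yOK by (auto simp: ann_def mult_ac)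
      ultimately show ?thesis by simp
    qed
  qed
  show ?thesis
    using bOK bP Pb by (intro bexI[of _ b]) (auto simp: ann_def)
qed

text \<open>The element \<open>u\<close> generates \<open>P\<^sup>-\<^sup>1\<close> locally at \<open>P\<close>, and \<open>\<omega>\<close> is a uniformizer.\<close>

lemma ex_uniformizer:
  obtains u \<omega> where "\<omega> \<in> P" "\<omega> \<noteq> 0" "u * \<omega> \<in> OK - P" "\<And>x. x \<in> P \<Longrightarrow> u * x \<in> OK" "u \<notin> OK"
proof -
  obtain r where r: "r \<in> P" "r \<noteq> 0" using ex_nonzero_in_P by blast
  then obtain b where b: "b \<in> OK" "\<forall>x\<in>OK. x \<in> P \<longleftrightarrow> (\<exists>z\<in>OK. x * b = r * z)"
    using P_annihilator by blast
  \<comment> \<open>For \<open>x\<close> in \<open>OK\<close>, the property of \<open>b\<close> now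
    reads: \<open>u * x\<close> is in \<open>OK\<close> exactly when \<open>x\<close> is in
    \<open>P\<close>.\<close>
  define u where "u = b / r"
  have uP: "u * x \<in> OK" if x: "x \<in> P" for x
  proof -
    obtain z where "z \<in> OK" "x * b = r * z" using b(2) x P_subset by blast
    moreover from this have "u * x = z" using r(2) by (simp add: u_def field_simps)
    ultimately show ?thesis by simp
  qed
  have u: "u \<notin> OK"
  proof
    assume "u \<in> OK"
    moreover have "1 * b = r * u" using r(2) by (simp add: u_def)
    ultimately have "1 \<in> P" using b(2) OK.one_mem by blast
    thus False using P_one by simp
  qed
  have "\<exists>\<omega>\<in>P. u * \<omega> \<notin> P"
  proof (rule ccontr)
    assume "\<not> (\<exists>\<omega>\<in>P. u * \<omega> \<notin> P)"
    hence stable: "u * x \<in> P" if "x \<in> P" for x using that by blast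
    \<comment> \<open>If \<open>u\<close> mapped \<open>P\<close> into itself, all
      \<open>u ^ n * r\<close> would be integral, and pigeonhole would make \<open>u\<close>
      integral.\<close>
    have "u ^ n * r \<in> P" for n
      by (induction n) (use r(1) stable in \<open>auto simp: mult.assoc\<close>)
    hence mem: "u ^ n * r \<in> OK" for n using P_subset by blast
    have "finite_quotient OK r" using r P_subset by (intro finite_quotient_OK) auto
    then obtain i j z where ij: "i < j" "z \<in> OK" "u ^ j * r - u ^ i * r = r * z"
      using OK.finite_quotient_pigeonhole[of r "\<lambda>n. u ^ n * r"] mem by blast
    have "r * (u ^ j - u ^ i) = r * z" using ij(3) by (simp add: algebra_simps)
    hence "u ^ j - u ^ i \<in> OK" using ij(2) r(2) by simp
    thus False using u integral_closure_power_diff ij(1) by blast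
  qed
  then obtain \<omega> where \<omega>: "\<omega> \<in> P" "u * \<omega> \<notin> P" by blast
  moreover have "\<omega> \<noteq> 0" using \<omega> by auto
  ultimately show ?thesis using that uP u by blast
qed

section \<open>Powers of the prime and additivity of the order\<close>

definition P_pow :: "nat \<Rightarrow> 'k set" where
  "P_pow k = P [^]\<^bsub>ideals_set (ring_on OK)\<^esub> k"

lemma P_pow_0: "P_pow 0 = OK"
  by (simp add: P_pow_def nat_pow_def ideals_set_def)

lemma P_pow_Suc: "P_pow (Suc k) = ideal_prod (ring_on OK) (P_pow k) P"
  by (simp add: P_pow_def nat_pow_def ideals_set_def)

lemma P_pow_ideal: "ideal (P_pow k) (ring_on OK)"
proof (induction k)
  interpret cring "ring_on OK" by (rule OK.cring_ring_on)
  case 0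
  show ?case unfolding P_pow_0 using oneideal by simp
next
  case (Suc k)
  interpret cring "ring_on OK" by (rule OK.cring_ring_on)
  show ?case unfolding P_pow_Suc by (rule ideal_prod_is_ideal[OF Suc P_ideal])
qed

lemma P_pow_add: "x \<in> P_pow k \<Longrightarrow> y \<in> P_pow k \<Longrightarrow> x + y \<in> P_pow k"
  using additive_subgroup.a_closed[OF ideal.axioms(1)[OF P_pow_ideal]] by simp

lemma P_pow_mult: "a \<in> OK \<Longrightarrow> x \<in> P_pow k \<Longrightarrow> a * x \<in> P_pow k"
  using ideal.I_l_closed[OF P_pow_ideal, of x k a] by simp

lemma P_pow_SucI: "x \<in> P_pow k \<Longrightarrow> y \<in> P \<Longrightarrow> x * y \<in> P_pow (Suc k)"
  using ideal_prod.prod[of x "P_pow k" y P "ring_on OK"] unfolding P_pow_Suc by simp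

lemma power_in_P_pow: "x \<in> P \<Longrightarrow> x ^ k \<in> P_pow k"
proof (induction k)
  case (Suc k)
  thus ?case using P_pow_SucI[of "x ^ k" k x] by (simp add: mult.commute)
qed (simp add: P_pow_0)

lemma P_pow_Suc_subset: "P_pow (Suc k) \<subseteq> P_pow k"
proof -
  interpret cring "ring_on OK" by (rule OK.cring_ring_on)
  show ?thesis unfolding P_pow_Suc using ideal_prod_inter[OF P_pow_ideal P_ideal] by blast
qed

lemma P_pow_antimono: "k \<le> l \<Longrightarrow> P_pow l \<subseteq> P_pow k"
  by (induction rule: dec_induct) (use P_pow_Suc_subset in blast)+

text \<open>\<open>P ^ k\<close> consists of sums of products of \<open>k\<close> elements of
  \<open>P\<close>, and each factor absorbs one \<open>u\<close>.\<close>

lemma P_pow_uniformizer: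
  assumes "\<And>x. x \<in> P \<Longrightarrow> u * x \<in> OK" "a \<in> P_pow k"
  shows "u ^ k * a \<in> OK"
  using assms(2)
proof (induction k arbitrary: a)
  case 0
  thus ?case by (simp add: P_pow_0)
next
  case (Suc k)
  show ?case
    using Suc.prems unfolding P_pow_Suc
  proof (induction a rule: ideal_prod.induct)
    case (prod i j)
    have "(u ^ k * i) * (u * j) \<in> OK"
      using Suc.IH[OF prod(1)] assms(1)[OF prod(2)] by (rule OK.mult_mem)
    thus ?case by (simp add: mult_ac)
  next
    case (sum s1 s2)
    thus ?case using OK.add_mem[OF sum.IH] by (simp add: algebra_simps)
  qed
qed

lemma P_pow_bounded:
  assumes a: "a \<in> OK" "a \<noteq> 0"
  shows "\<exists>k. a \<notin> P_pow k"
proof (rule ccontr)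
  assume "\<not> (\<exists>k. a \<notin> P_pow k)"
  hence all: "a \<in> P_pow k" for k by blast
  obtain u where u: "\<And>x. x \<in> P \<Longrightarrow> u * x \<in> OK" "u \<notin> OK" by (rule ex_uniformizer) blast
  have mem: "u ^ k * a \<in> OK" for k
    using P_pow_uniformizer[OF u(1) all] .
  obtain i j z where ij: "i < j" "z \<in> OK" "u ^ j * a - u ^ i * a = a * z"
    using OK.finite_quotient_pigeonhole[OF finite_quotient_OK[OF a], of "\<lambda>n. u ^ n * a"] mem by blast
  have "a * (u ^ j - u ^ i) = a * z" using ij(3) by (simp add: algebra_simps)
  hence "u ^ j - u ^ i \<in> OK" using ij(2) a(2) by simp
  thus False using u(2) integral_closure_power_diff ij(1) by blast
qed

text \<open>The exponents \<open>k\<close> with \<open>a \<in> P_pow k\<close> contain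
  \<open>0\<close>, are bounded and form an initial segment, so the \<open>GREATEST\<close> in the
  definition exists and determines them all.\<close>

lemma P_pow_iff_integral_ord:
  assumes a: "a \<in> OK" "a \<noteq> 0"
  shows "a \<in> P_pow k \<longleftrightarrow> k \<le> integral_ord OK P a"
proof -
  obtain n where n: "a \<notin> P_pow n" using P_pow_bounded[OF a] by blast
  have bound: "l \<le> n" if "a \<in> P_pow l" for l
  proof (rule ccontr)
    assume "\<not> l \<le> n"
    thus False using P_pow_antimono[of n l] that n by auto
  qed
  have "a \<in> P_pow (integral_ord OK P a)"
    unfolding integral_ord_def P_pow_def[symmetric]
    by (rule GreatestI_nat[where k = 0 and b = n]) (use a bound P_pow_0 in auto)
  moreover have "l \<le> integral_ord OK P a" if "a \<in> P_pow l" for l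
    unfolding integral_ord_def P_pow_def[symmetric]
    by (rule Greatest_le_nat[where b = n]) (use that bound in auto)
  ultimately show ?thesis using P_pow_antimono by blast
qed

text \<open>An element outside \<open>P\<close> is invertible modulo every power of
  \<open>P\<close>: with \<open>e \<in> P\<close> and \<open>1 - e ^ k = t * z\<close>, both
  summands of \<open>a = z * (t * a) + a * e ^ k\<close> lie in \<open>P_pow k\<close>.\<close>

lemma P_pow_cancel:
  assumes t: "t \<in> OK - P" "a \<in> OK" "t * a \<in> P_pow k"
  shows "a \<in> P_pow k"
proof -
  obtain y where y: "y \<in> OK" "1 - t * y \<in> P" using inverse_mod_P[OF t(1)] by blast
  define e where "e = 1 - t * y"
  obtain z where z: "z \<in> OK" "1 - e ^ k = t * z"
    using OK.one_minus_power_multiple[of t y k] t(1) y(1) by (auto simp: e_def)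
  have "a = z * (t * a) + a * e ^ k"
  proof -
    have "a = (1 - e ^ k) * a + a * e ^ k" by (simp add: algebra_simps)
    thus ?thesis unfolding z(2) by (simp add: mult_ac)
  qed
  moreover have "e ^ k \<in> P_pow k" using power_in_P_pow y(2) by (simp add: e_def)
  ultimately show ?thesis
    using P_pow_add[OF P_pow_mult[OF z(1) t(3)] P_pow_mult[OF t(2)]] by metis
qed

text \<open>Scaling by the power of \<open>u\<close> given by the order moves \<open>a\<close> and
  \<open>b\<close> outside \<open>P\<close>, and primality keeps the product outside. Powers of
  \<open>\<omega>\<close> undo the scaling up to powers of \<open>u * \<omega>\<close>, which can be
  cancelled.\<close>

lemma integral_ord_mult:
  assumes a: "a \<in> OK" "a \<noteq> 0" and b: "b \<in> OK" "b \<noteq> 0"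
  shows "integral_ord OK P (a * b) = integral_ord OK P a + integral_ord OK P b"
proof -
  obtain u \<omega> where u: "\<omega> \<in> P" "\<omega> \<noteq> 0" "u * \<omega> \<in> OK - P" "\<And>x. x \<in> P \<Longrightarrow> u * x \<in> OK"
    by (rule ex_uniformizer) blast
  have \<omega>_pow: "z * \<omega> ^ k \<in> P_pow k" if "z \<in> OK" for z k
    using P_pow_mult[OF that power_in_P_pow[OF u(1)]] .
  have unit: "u ^ k * c \<in> OK - P" if c: "c \<in> OK" "c \<noteq> 0" and k: "k = integral_ord OK P c" for c k
  proof -
    have "c \<in> P_pow k" using P_pow_iff_integral_ord[OF c] k by simp
    hence mem: "u ^ k * c \<in> OK" using P_pow_uniformizer[OF u(4)] by blast
    have "u ^ k * c \<notin> P"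
    proof
      assume "u ^ k * c \<in> P"
      hence "u * (u ^ k * c) \<in> OK" using u(4) by blast
      hence "u * (u ^ k * c) * \<omega> ^ Suc k \<in> P_pow (Suc k)" by (rule \<omega>_pow)
      moreover have "u * (u ^ k * c) * \<omega> ^ Suc k = (u * \<omega>) ^ Suc k * c"
        by (simp add: power_mult_distrib mult_ac)
      ultimately have "(u * \<omega>) ^ Suc k * c \<in> P_pow (Suc k)" by metis
      hence "c \<in> P_pow (Suc k)"
        using P_pow_cancel[OF not_P_power[OF u(3)] c(1)] by blast
      thus False using P_pow_iff_integral_ord[OF c] k by simp
    qed
    thus ?thesis using mem by blast
  qed
  define k l where "k = integral_ord OK P a" and "l = integral_ord OK P b"
  have ab: "a * b \<in> OK" "a * b \<noteq> 0" using a b by auto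
  have uk: "u ^ k * a \<in> OK - P" "u ^ l * b \<in> OK - P"
    using unit a b k_def l_def by auto
  have "u ^ k * a * (u ^ l * b) \<in> OK - P"
    by (rule not_P_mult[OF uk])
  hence kl: "u ^ (k + l) * (a * b) \<in> OK - P"
    by (simp add: power_add mult_ac)
  have "u ^ (k + l) * (a * b) * \<omega> ^ (k + l) \<in> P_pow (k + l)"
    using kl \<omega>_pow by blast
  hence "(u * \<omega>) ^ (k + l) * (a * b) \<in> P_pow (k + l)"
    by (simp add: power_mult_distrib mult_ac)
  hence "a * b \<in> P_pow (k + l)"
    using P_pow_cancel[OF not_P_power[OF u(3)] ab(1)] by blast
  \<comment> \<open>One more factor \<open>u\<close> would keep the product integral, and
    multiplication by \<open>\<omega>\<close> would put it into \<open>P\<close>; but it is also a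
    product of two elements outside \<open>P\<close>.\<close>
  moreover have "a * b \<notin> P_pow (Suc (k + l))"
  proof
    assume "a * b \<in> P_pow (Suc (k + l))"
    hence "u ^ Suc (k + l) * (a * b) \<in> OK" using P_pow_uniformizer[OF u(4)] by blast
    hence "u ^ Suc (k + l) * (a * b) * \<omega> \<in> P" using P_mult u(1) by blast
    moreover have "u ^ Suc (k + l) * (a * b) * \<omega> = (u * \<omega>) * (u ^ (k + l) * (a * b))"
      by (simp add: mult_ac)
    ultimately show False using not_P_mult[OF u(3) kl] by (metis DiffD2)
  qed
  ultimately show ?thesis
    using P_pow_iff_integral_ord[OF ab] by (simp add: k_def l_def)
qed

text \<open>After cross multiplication, additivity shows that the difference of orders does not
  depend on the chosen fraction, so the \<open>THE\<close> in the definition is determined.\<close>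

lemma prime_ord_fraction:
  assumes a: "a \<in> OK" "a \<noteq> 0" and b: "b \<in> OK" "b \<noteq> 0"
  shows "prime_ord OK P (a / b) = ereal (of_int (int (integral_ord OK P a) - int (integral_ord OK P b)))"
proof -
  have "(THE v. \<exists>a' b'. a' \<in> OK - {0} \<and> b' \<in> OK - {0} \<and> a / b = a' / b' \<and>
          v = int (integral_ord OK P a') - int (integral_ord OK P b'))
        = int (integral_ord OK P a) - int (integral_ord OK P b)"
  proof (rule the_equality)
    show "\<exists>a' b'. a' \<in> OK - {0} \<and> b' \<in> OK - {0} \<and> a / b = a' / b' \<and>
      int (integral_ord OK P a) - int (integral_ord OK P b)
        = int (integral_ord OK P a') - int (integral_ord OK P b')"
      using a b by blast
    fix w assume "\<exists>a' b'. a' \<in> OK - {0} \<and> b' \<in> OK - {0} \<and> a / b = a' / b' \<and>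
      w = int (integral_ord OK P a') - int (integral_ord OK P b')"
    then obtain a' b' where *: "a' \<in> OK" "a' \<noteq> 0" "b' \<in> OK" "b' \<noteq> 0" "a / b = a' / b'"
      "w = int (integral_ord OK P a') - int (integral_ord OK P b')" by blast
    have "a * b' = a' * b" using * b by (simp add: frac_eq_eq)
    hence "integral_ord OK P a + integral_ord OK P b' = integral_ord OK P a' + integral_ord OK P b"
      using integral_ord_mult[OF a *(3,4)] integral_ord_mult[OF *(1,2) b] by simp
    thus "w = int (integral_ord OK P a) - int (integral_ord OK P b)" using *(6) by simp
  qed
  thus ?thesis using a b by (simp add: prime_ord_def)
qed

lemma ex_fraction: "\<exists>a\<in>OK. \<exists>b\<in>OK. b \<noteq> 0 \<and> x = a / b"
proof -
  obtain r where "r \<in> R" "r \<noteq> 0" "r * x \<in> OK" using integral_multiple by blast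
  thus ?thesis by (intro bexI[of _ "r * x"] bexI[of _ r]) auto
qed

text \<open>Multiplicativity is additivity of the order on numerators and denominators. For the
  ultrametric inequality both fractions get the common denominator \<open>b * b'\<close>, and the
  numerators are added inside one power of \<open>P\<close>.\<close>

lemma int_valuation_prime_ord: "int_valuation (prime_ord OK P)"
proof
  show zero: "prime_ord OK P 0 = \<infinity>" by (simp add: prime_ord_def)
  fix x y
  obtain a b where x: "a \<in> OK" "b \<in> OK" "b \<noteq> 0" "x = a / b" using ex_fraction by blast
  obtain a' b' where y: "a' \<in> OK" "b' \<in> OK" "b' \<noteq> 0" "y = a' / b'" using ex_fraction by blast
  show "\<exists>i::int. prime_ord OK P x = ereal (of_int i)" if "x \<noteq> 0"
  proof -
    have "a \<noteq> 0" using x that by auto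
    thus ?thesis using prime_ord_fraction[of a b] x by blast
  qed
  have nmi: "prime_ord OK P z \<noteq> - \<infinity>" for z by (simp add: prime_ord_def)
  show "prime_ord OK P (x * y) = prime_ord OK P x + prime_ord OK P y"
  proof (cases "x = 0 \<or> y = 0")
    case True
    thus ?thesis using zero nmi by auto
  next
    case False
    hence nz: "a \<noteq> 0" "a' \<noteq> 0" using x y by auto
    have xy: "x * y = (a * a') / (b * b')" by (simp add: x y)
    have "prime_ord OK P (x * y) =
      ereal (of_int (int (integral_ord OK P (a * a')) - int (integral_ord OK P (b * b'))))"
      unfolding xy using x y nz by (intro prime_ord_fraction) auto
    thus ?thesis
      using prime_ord_fraction[of a b] prime_ord_fraction[of a' b'] x y nz
      by (simp add: integral_ord_mult)
  qed
  show "min (prime_ord OK P x) (prime_ord OK P y) \<le> prime_ord OK P (x + y)"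
  proof (cases "x = 0 \<or> y = 0 \<or> x + y = 0")
    case True
    thus ?thesis using zero by auto
  next
    case False
    define e f g where "e = a * b'" and "f = a' * b" and "g = b * b'"
    have OK: "e \<in> OK" "f \<in> OK" "g \<in> OK" "e + f \<in> OK" using x y by (auto simp: e_def f_def g_def)
    have eq: "x = e / g" "y = f / g" "x + y = (e + f) / g"
      using x y by (auto simp: e_def f_def g_def field_simps)
    have nz: "e \<noteq> 0" "f \<noteq> 0" "g \<noteq> 0" "e + f \<noteq> 0" using False eq by auto
    define k where "k = min (integral_ord OK P e) (integral_ord OK P f)"
    have "e \<in> P_pow k" "f \<in> P_pow k"
      using P_pow_iff_integral_ord OK nz by (auto simp: k_def)
    hence "e + f \<in> P_pow k" by (rule P_pow_add)
    hence "k \<le> integral_ord OK P (e + f)" using P_pow_iff_integral_ord OK nz by auto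
    thus ?thesis
      unfolding eq(3) unfolding eq(1,2) using OK nz by (auto simp: prime_ord_fraction k_def min_def split: if_splits)
  qed
qed

lemma prime_ord_nonneg: "x \<in> OK \<Longrightarrow> 0 \<le> prime_ord OK P x"
  and prime_ord_ge_1: "x \<in> P \<Longrightarrow> 1 \<le> prime_ord OK P x"
proof -
  have 1: "integral_ord OK P 1 = 0"
    using integral_ord_mult[of 1 1] by simp
  have OK: "prime_ord OK P x = ereal (real (integral_ord OK P x))" if "x \<in> OK" "x \<noteq> 0" for x
    using prime_ord_fraction[OF that, of 1] 1 by simp
  show "0 \<le> prime_ord OK P x" if "x \<in> OK"
    using OK[OF that] by (cases "x = 0") (auto simp: prime_ord_def)
  show "1 \<le> prime_ord OK P x" if x: "x \<in> P"
  proof (cases "x = 0")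
    case False
    have "x \<in> P_pow 1" using power_in_P_pow[OF x, of 1] by simp
    hence "1 \<le> integral_ord OK P x" using P_pow_iff_integral_ord False x P_subset by blast
    thus ?thesis using OK[of x] False x P_subset by auto
  qed (simp add: prime_ord_def)
qed

end

section \<open>Completions\<close>

context int_valuation
begin

lemma v_not_MInf [simp]: "v x \<noteq> - \<infinity>"
  using v_int[of x] by (cases "x = 0") auto

lemma v_eq_PInf_iff [simp]: "v x = \<infinity> \<longleftrightarrow> x = 0"
  using v_int[of x] by (cases "x = 0") auto

lemma v_one [simp]: "v 1 = 0"
  using v_int[of 1] v_mult[of 1 1] by auto

lemma v_uminus [simp]: "v (- x) = v x"
proof -
  have "v (- 1) = 0"
    using v_int[of "- 1"] v_mult[of "- 1" "- 1"] by auto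
  thus ?thesis using v_mult[of "- 1" x] by simp
qed

lemma v_diff: "min (v x) (v y) \<le> v (x - y)"
  using v_add[of x "- y"] by simp

lemma v_add_gt: "b < v x \<Longrightarrow> b < v y \<Longrightarrow> b < v (x + y)"
  using v_add[of x y] by (meson less_le_trans min_less_iff_conj)

lemma v_add_ge: "b \<le> v x \<Longrightarrow> b \<le> v y \<Longrightarrow> b \<le> v (x + y)"
  using v_add[of x y] by (meson order_trans min.boundedI)

lemma v_sum_ge: "(\<And>i. i \<in> I \<Longrightarrow> b \<le> v (f i)) \<Longrightarrow> b \<le> v (sum f I)"
  by (induction I rule: infinite_finite_induct) (auto intro: v_add_ge)

text \<open>The isosceles principle of ultrametrics; every local constancy argument below reduces to
  it.\<close>

lemma v_eq_of_close:
  assumes "v y < v (x - y)"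
  shows "v x = v y"
proof (rule antisym)
  have "v y \<le> v ((x - y) + y)" using assms by (intro v_add_ge) auto
  thus "v y \<le> v x" by simp
  show "v x \<le> v y"
  proof (rule ccontr)
    assume "\<not> v x \<le> v y"
    hence "v y < v (x - (x - y))"
      using assms v_diff[of x "x - y"] by (meson less_le_trans min_less_iff_conj not_le)
    thus False by simp
  qed
qed

lemma v_lower_bound: "\<exists>b::real. ereal b \<le> v x"
  using v_int[of x] by (cases "x = 0") auto

lemma v_mult_gt:
  assumes "ereal b \<le> v x" "ereal (B - b) < v y"
  shows "ereal B < v (x * y)"
  using assms unfolding v_mult by (cases "v x"; cases "v y") auto

lemma v_power_ge: "1 \<le> v x \<Longrightarrow> ereal (real n) \<le> v (x ^ n)"
proof (induction n)
  case (Suc n)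
  thus ?case by (cases "v x"; cases "v (x ^ n)") (auto simp: v_mult)
qed simp

lemma v_divide_nonneg:
  assumes "x \<noteq> 0" "v x \<le> v y"
  shows "0 \<le> v (y / x)"
proof -
  have "v y = v x + v (y / x)" using assms(1) by (simp flip: v_mult)
  thus ?thesis using assms v_int[OF assms(1)] by (cases "v (y / x)") auto
qed

section \<open>Cauchy sequences and null sequences\<close>

lemma cauchy_ring_simps [simp]:
  "s \<otimes>\<^bsub>cauchy_ring v\<^esub> t = (\<lambda>i. s i * t i)" "s \<oplus>\<^bsub>cauchy_ring v\<^esub> t = (\<lambda>i. s i + t i)"
  "\<one>\<^bsub>cauchy_ring v\<^esub> = (\<lambda>i. 1)" "\<zero>\<^bsub>cauchy_ring v\<^esub> = (\<lambda>i. 0)"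
  by (simp_all add: cauchy_ring_def)

abbreviation cauchy :: "(nat \<Rightarrow> 'k) \<Rightarrow> bool" where
  "cauchy s \<equiv> s \<in> carrier (cauchy_ring v)"

lemma cauchy_iff: "cauchy s \<longleftrightarrow> (\<forall>B::real. \<exists>M. \<forall>i\<ge>M. \<forall>j\<ge>M. ereal B < v (s i - s j))"
  by (simp add: cauchy_ring_def)

lemma null_seqs_iff: "s \<in> null_seqs v \<longleftrightarrow> (\<forall>B::real. \<exists>M. \<forall>i\<ge>M. ereal B < v (s i))"
  by (simp add: null_seqs_def tendsto_PInfty eventually_sequentially)

lemma cauchy_const [simp]: "cauchy (\<lambda>i. x)"
  by (simp add: cauchy_iff)

lemma cauchy_add: "cauchy s \<Longrightarrow> cauchy t \<Longrightarrow> cauchy (\<lambda>i. s i + t i)"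
  unfolding cauchy_iff
proof
  fix B :: real
  assume "\<forall>B::real. \<exists>M. \<forall>i\<ge>M. \<forall>j\<ge>M. ereal B < v (s i - s j)"
    and "\<forall>B::real. \<exists>M. \<forall>i\<ge>M. \<forall>j\<ge>M. ereal B < v (t i - t j)"
  then obtain M M' where M: "\<forall>i\<ge>M. \<forall>j\<ge>M. ereal B < v (s i - s j)"
    "\<forall>i\<ge>M'. \<forall>j\<ge>M'. ereal B < v (t i - t j)" by meson
  have "ereal B < v (s i + t i - (s j + t j))" if "i \<ge> max M M'" "j \<ge> max M M'" for i j
  proof -
    have "ereal B < v ((s i - s j) + (t i - t j))" using M that by (intro v_add_gt) auto
    thus ?thesis by (simp add: algebra_simps)
  qed
  thus "\<exists>M. \<forall>i\<ge>M. \<forall>j\<ge>M. ereal B < v (s i + t i - (s j + t j))" by blast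
qed

lemma cauchy_bounded:
  assumes "cauchy s"
  shows "\<exists>b::real. \<exists>M. \<forall>i\<ge>M. ereal b \<le> v (s i)"
proof -
  obtain M where M: "\<forall>i\<ge>M. \<forall>j\<ge>M. ereal 0 < v (s i - s j)"
    using assms unfolding cauchy_iff by meson
  obtain b where b: "ereal b \<le> v (s M)" using v_lower_bound by blast
  have "ereal (min 0 b) \<le> v (s i)" if "i \<ge> M" for i
  proof -
    have "ereal (min 0 b) \<le> ereal 0" by simp
    also have "\<dots> \<le> v (s i - s M)" using M that by (auto intro: less_imp_le)
    finally have "ereal (min 0 b) \<le> v (s i - s M)" .
    moreover have "ereal (min 0 b) \<le> v (s M)" using b by (auto intro: order_trans[rotated])
    ultimately have "ereal (min 0 b) \<le> v ((s i - s M) + s M)" by (rule v_add_ge)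
    thus ?thesis by simp
  qed
  thus ?thesis by blast
qed

lemma null_mult:
  assumes "cauchy s" "t \<in> null_seqs v"
  shows "(\<lambda>i. s i * t i) \<in> null_seqs v"
  unfolding null_seqs_iff
proof
  fix B :: real
  obtain b M where M: "\<forall>i\<ge>M. ereal b \<le> v (s i)" using cauchy_bounded[OF assms(1)] by blast
  obtain M' where M': "\<forall>i\<ge>M'. ereal (B - b) < v (t i)" using assms(2) unfolding null_seqs_iff by meson
  have "ereal B < v (s i * t i)" if "i \<ge> max M M'" for i
    using M M' that by (intro v_mult_gt[of b]) auto
  thus "\<exists>M. \<forall>i\<ge>M. ereal B < v (s i * t i)" by blast
qed

lemma cauchy_mult:
  assumes "cauchy s" "cauchy t"
  shows "cauchy (\<lambda>i. s i * t i)"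
  unfolding cauchy_iff
proof
  fix B :: real
  obtain b M where b: "\<forall>i\<ge>M. ereal b \<le> v (s i)" using cauchy_bounded[OF assms(1)] by blast
  obtain b' M' where b': "\<forall>i\<ge>M'. ereal b' \<le> v (t i)" using cauchy_bounded[OF assms(2)] by blast
  obtain L where L: "\<forall>i\<ge>L. \<forall>j\<ge>L. ereal (B - b') < v (s i - s j)"
    using assms(1) unfolding cauchy_iff by meson
  obtain L' where L': "\<forall>i\<ge>L'. \<forall>j\<ge>L'. ereal (B - b) < v (t i - t j)"
    using assms(2) unfolding cauchy_iff by meson
  have "ereal B < v (s i * t i - s j * t j)"
    if "i \<ge> max (max M M') (max L L')" "j \<ge> max (max M M') (max L L')" for i j
  proof -
    have "ereal B < v (s i * (t i - t j) + t j * (s i - s j))"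
      using b b' L L' that by (intro v_add_gt v_mult_gt[of b] v_mult_gt[of b']) auto
    thus ?thesis by (simp add: algebra_simps)
  qed
  thus "\<exists>M. \<forall>i\<ge>M. \<forall>j\<ge>M. ereal B < v (s i * t i - s j * t j)" by blast
qed

lemma null_add:
  assumes "s \<in> null_seqs v" "t \<in> null_seqs v"
  shows "(\<lambda>i. s i + t i) \<in> null_seqs v"
  unfolding null_seqs_iff
proof
  fix B :: real
  obtain M M' where M: "\<forall>i\<ge>M. ereal B < v (s i)" "\<forall>i\<ge>M'. ereal B < v (t i)"
    using assms unfolding null_seqs_iff by meson
  have "ereal B < v (s i + t i)" if "i \<ge> max M M'" for i
    using M that by (intro v_add_gt) auto
  thus "\<exists>M. \<forall>i\<ge>M. ereal B < v (s i + t i)" by blast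
qed

lemma null_cauchy:
  assumes "s \<in> null_seqs v"
  shows "cauchy s"
  unfolding cauchy_iff
proof
  fix B :: real
  obtain M where M: "\<forall>i\<ge>M. ereal B < v (s i)" using assms unfolding null_seqs_iff by meson
  have "ereal B < v (s i - s j)" if "i \<ge> M" "j \<ge> M" for i j
    using v_add_gt[of "ereal B" "s i" "- s j"] M that by simp
  thus "\<exists>M. \<forall>i\<ge>M. \<forall>j\<ge>M. ereal B < v (s i - s j)" by blast
qed

lemma null_zero: "(\<lambda>i. 0) \<in> null_seqs v"
  by (simp add: null_seqs_iff)

lemma cring_cauchy_ring: "cring (cauchy_ring v)"
proof (rule cringI)
  show "abelian_group (cauchy_ring v)"
  proof (rule abelian_groupI)
    fix s assume "s \<in> carrier (cauchy_ring v)"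
    hence "cauchy (\<lambda>i. - 1 * s i)" by (intro cauchy_mult) auto
    thus "\<exists>t\<in>carrier (cauchy_ring v). t \<oplus>\<^bsub>cauchy_ring v\<^esub> s = \<zero>\<^bsub>cauchy_ring v\<^esub>"
      by (intro bexI[of _ "\<lambda>i. - 1 * s i"]) auto
  qed (auto intro: cauchy_add simp: algebra_simps)
  show "comm_monoid (cauchy_ring v)"
    by (rule comm_monoidI) (auto intro: cauchy_mult simp: algebra_simps)
qed (auto simp: algebra_simps)

lemma ideal_null_seqs: "ideal (null_seqs v) (cauchy_ring v)"
proof (rule idealI)
  interpret cring "cauchy_ring v" by (rule cring_cauchy_ring)
  show "ring (cauchy_ring v)" by (rule ring_axioms)
  show "subgroup (null_seqs v) (add_monoid (cauchy_ring v))"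
  proof (rule add.subgroupI)
    show "null_seqs v \<subseteq> carrier (cauchy_ring v)" using null_cauchy by blast
    show "null_seqs v \<noteq> {}" using null_zero by blast
    fix s assume s: "s \<in> null_seqs v"
    have "\<ominus>\<^bsub>cauchy_ring v\<^esub> s = (\<lambda>i. - 1 * s i)"
    proof (rule minus_equality)
      show "cauchy (\<lambda>i. - 1 * s i)" by (rule cauchy_mult[OF cauchy_const null_cauchy[OF s]])
    qed (use s null_cauchy in auto)
    moreover have "(\<lambda>i. - 1 * s i) \<in> null_seqs v" by (rule null_mult[OF cauchy_const s])
    ultimately show "\<ominus>\<^bsub>cauchy_ring v\<^esub> s \<in> null_seqs v" by simp
  qed (auto intro: null_add)
  fix t s assume *: "t \<in> null_seqs v" "s \<in> carrier (cauchy_ring v)"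
  from null_mult[OF *(2,1)]
  show "s \<otimes>\<^bsub>cauchy_ring v\<^esub> t \<in> null_seqs v" "t \<otimes>\<^bsub>cauchy_ring v\<^esub> s \<in> null_seqs v"
    by (simp_all add: mult.commute)
qed

abbreviation cls :: "(nat \<Rightarrow> 'k) \<Rightarrow> (nat \<Rightarrow> 'k) set" where
  "cls s \<equiv> null_seqs v +>\<^bsub>cauchy_ring v\<^esub> s"

lemma ring_hom_cls: "ring_hom_cring (cauchy_ring v) (completion v) cls"
  unfolding completion_def by (rule ideal.rcos_ring_hom_cring[OF ideal_null_seqs cring_cauchy_ring])

lemma mem_cls_iff: "t \<in> cls s \<longleftrightarrow> (\<exists>n\<in>null_seqs v. t = (\<lambda>i. n i + s i))"
  by (auto simp: a_r_coset_def')

lemma carrier_completionE: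
  assumes "y \<in> carrier (completion v)"
  obtains s where "cauchy s" "y = cls s"
  using assms by (auto simp: completion_def FactRing_def A_RCOSETS_def')

lemma cls_eqD:
  assumes "cls s = cls t"
  shows "(\<lambda>i. s i - t i) \<in> null_seqs v"
proof -
  have "s \<in> cls s" unfolding mem_cls_iff using null_zero by (intro bexI[of _ "\<lambda>i. 0"]) auto
  hence "s \<in> cls t" using assms by simp
  then obtain n where "n \<in> null_seqs v" "s = (\<lambda>i. n i + t i)" unfolding mem_cls_iff by blast
  thus ?thesis by simp
qed

lemma cls_null: "s \<in> null_seqs v \<Longrightarrow> cls s = \<zero>\<^bsub>completion v\<^esub>"
  using ideal.Icarr[OF ideal_null_seqs, of s] ring.ring_simprules(15)[of "cauchy_ring v"]
  using abelian_subgroup.a_rcos_const[OF ideal.axioms(1)[OF ideal_null_seqs, THEN abelian_subgroupI3]]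
  using cring_cauchy_ring
  by (simp add: completion_def FactRing_def cring_def ring_def)

text \<open>The values return infinitely often to at most some \<open>B\<close>. Once the
  differences have values above \<open>B\<close>, a single such entry fixes the value of all later
  ones. So a nonzero class has a finite order, attained by almost all entries.\<close>

lemma cauchy_not_null:
  assumes "cauchy s" "s \<notin> null_seqs v"
  shows "\<exists>l. \<bar>l\<bar> \<noteq> \<infinity> \<and> (\<forall>\<^sub>F i in sequentially. v (s i) = l)"
proof -
  obtain B where B: "\<And>M. \<exists>i\<ge>M. v (s i) \<le> ereal B"
    using assms(2) unfolding null_seqs_iff by (meson not_le)
  obtain M where M: "\<forall>i\<ge>M. \<forall>j\<ge>M. ereal B < v (s i - s j)"
    using assms(1) unfolding cauchy_iff by meson
  obtain k where k: "k \<ge> M" "v (s k) \<le> ereal B" using B by blast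
  have "v (s i) = v (s k)" if "i \<ge> M" for i
    using M k that by (intro v_eq_of_close) (metis le_less_trans)
  moreover have "\<bar>v (s k)\<bar> \<noteq> \<infinity>" using k(2) by (cases "v (s k)") auto
  ultimately show ?thesis
    unfolding eventually_sequentially by (intro exI[of _ "v (s k)"] conjI exI[of _ M]) auto
qed

lemma completion_ord_eqI:
  assumes "\<And>n. n \<in> null_seqs v \<Longrightarrow> (\<lambda>i. v (n i + s i)) \<longlonglongrightarrow> l"
  shows "completion_ord v (cls s) = l"
  unfolding completion_ord_def
proof (rule the_equality)
  show "\<forall>t\<in>cls s. (\<lambda>i. v (t i)) \<longlonglongrightarrow> l" using assms by (auto simp: mem_cls_iff)
  fix l' assume "\<forall>t\<in>cls s. (\<lambda>i. v (t i)) \<longlonglongrightarrow> l'"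
  moreover have "s \<in> cls s" unfolding mem_cls_iff using null_zero by (intro bexI[of _ "\<lambda>i. 0"]) auto
  ultimately have "(\<lambda>i. v (s i)) \<longlonglongrightarrow> l'" by blast
  moreover have "(\<lambda>i. v (s i)) \<longlonglongrightarrow> l" using assms[OF null_zero] by simp
  ultimately show "l' = l" by (rule LIMSEQ_unique)
qed

lemma completion_ord_null:
  assumes "s \<in> null_seqs v"
  shows "completion_ord v (cls s) = \<infinity>"
proof (rule completion_ord_eqI)
  fix n assume "n \<in> null_seqs v"
  from null_add[OF this assms] show "(\<lambda>i. v (n i + s i)) \<longlonglongrightarrow> \<infinity>" by (simp add: null_seqs_def)
qed

lemma completion_ord_eventually:
  assumes l: "\<bar>l\<bar> \<noteq> \<infinity>" "\<forall>\<^sub>F i in sequentially. v (s i) = l"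
  shows "completion_ord v (cls s) = l"
proof (rule completion_ord_eqI)
  fix n assume n: "n \<in> null_seqs v"
  obtain b where b: "l = ereal b" using l(1) by (cases l) auto
  have "\<forall>\<^sub>F i in sequentially. ereal b < v (n i)"
    using n unfolding null_seqs_iff eventually_sequentially by blast
  hence "\<forall>\<^sub>F i in sequentially. v (n i + s i) = l"
    using l(2)
  proof eventually_elim
    case (elim i)
    thus ?case using v_eq_of_close[of "s i" "n i + s i"] b by simp
  qed
  thus "(\<lambda>i. v (n i + s i)) \<longlonglongrightarrow> l"
    by (rule tendsto_eventually)
qed

text \<open>Entries of a null sequence have eventually positive values; otherwise the order is the
  eventual value itself.\<close>

lemma completion_ord_nonneg:
  assumes "cauchy s" "0 \<le> completion_ord v (cls s)"
  shows "\<forall>\<^sub>F i in sequentially. 0 \<le> v (s i)"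
proof (cases "s \<in> null_seqs v")
  case True
  hence "\<forall>\<^sub>F i in sequentially. ereal 0 < v (s i)"
    unfolding null_seqs_iff eventually_sequentially by blast
  thus ?thesis by eventually_elim (auto simp: zero_ereal_def intro: less_imp_le)
next
  case False
  then obtain l where l: "\<bar>l\<bar> \<noteq> \<infinity>" "\<forall>\<^sub>F i in sequentially. v (s i) = l"
    using cauchy_not_null[OF assms(1)] by metis
  have "0 \<le> l" using completion_ord_eventually[OF l] assms(2) by simp
  show ?thesis using l(2) by eventually_elim (use \<open>0 \<le> l\<close> in simp)
qed

end

section \<open>Linear conditions in the completion\<close>

text \<open>Evaluation by plain sums in \<open>K\<close>. The evaluations in \<open>ring_on\<close>
  and, entry by entry, those in the completion reduce to \<open>lin_val\<close> and
  \<open>aff_val\<close>.\<close>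

definition lin_val :: "nat \<Rightarrow> 'k::field linear_poly \<Rightarrow> (nat \<Rightarrow> 'k) \<Rightarrow> 'k" where
  "lin_val N l x = fst l + (\<Sum>i<N. snd l i * x i)"

definition aff_val ::
  "nat \<Rightarrow> (nat \<Rightarrow> nat \<Rightarrow> 'k::field) \<Rightarrow> (nat \<Rightarrow> 'k) \<Rightarrow> (nat \<Rightarrow> 'k) \<Rightarrow> nat \<Rightarrow> 'k" where
  "aff_val m A c y i = (\<Sum>k<m. A i k * y k) + c i"

text \<open>The local conjunct over \<open>K\<close> with its witnesses eliminated: an integral
  cofactor becomes an inequality of values, an inverse becomes nonvanishing.\<close>

fun valued_conjunct ::
  "('k::field \<Rightarrow> ereal) \<Rightarrow> (nat \<Rightarrow> 'k set) \<Rightarrow> 'k set \<Rightarrow> nat \<Rightarrow> (nat \<Rightarrow> 'k) \<Rightarrow> 'k conjunct \<Rightarrow> bool" where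
  "valued_conjunct v p P N x (Div l1 l2) \<longleftrightarrow>
     lin_val N l2 x \<noteq> 0 \<and> v (lin_val N l1 x) \<le> v (lin_val N l2 x)"
| "valued_conjunct v p P N x (Eq0 l) \<longleftrightarrow> True"
| "valued_conjunct v p P N x (Neq0 l) \<longleftrightarrow> lin_val N l x \<noteq> 0"
| "valued_conjunct v p P N x (Ord_gt j l1 l2) \<longleftrightarrow>
     (P = p j \<longrightarrow> lin_val N l1 x \<noteq> 0 \<and> v (lin_val N l2 x) < v (lin_val N l1 x))"

text \<open>Collecting coefficients exhibits the composite as one affine form in \<open>y\<close>,
  so differences and vanishing can be read off its coefficients.\<close>

lemma lin_aff_val:
  "lin_val N l (aff_val m A c y) =
     (fst l + (\<Sum>i<N. snd l i * c i)) + (\<Sum>k<m. (\<Sum>i<N. snd l i * A i k) * y k)"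
proof -
  have "(\<Sum>i<N. snd l i * (\<Sum>k<m. A i k * y k)) = (\<Sum>i<N. \<Sum>k<m. snd l i * A i k * y k)"
    by (simp add: sum_distrib_left mult.assoc)
  also have "\<dots> = (\<Sum>k<m. \<Sum>i<N. snd l i * A i k * y k)" by (rule sum.swap)
  also have "\<dots> = (\<Sum>k<m. (\<Sum>i<N. snd l i * A i k) * y k)" by (simp add: sum_distrib_right)
  finally show ?thesis
    by (simp add: lin_val_def aff_val_def distrib_left sum.distrib algebra_simps)
qed

lemma lin_eval_ring_on:
  assumes "field_subring B" "linear_poly_over B N l" "\<And>i. i < N \<Longrightarrow> x i \<in> B"
  shows "lin_eval (ring_on B) id N l x = lin_val N l x"
proof -
  interpret field_subring B by fact
  have "finsum (ring_on B) (\<lambda>i. snd l i * x i) {..<N} = (\<Sum>i<N. snd l i * x i)"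
    using assms(2,3) by (intro finsum_ring_on) (auto simp: linear_poly_over_def)
  thus ?thesis by (simp add: lin_eval_def lin_val_def)
qed

lemma affine_map_ring_on:
  assumes "field_subring B" "\<And>k. k < m \<Longrightarrow> A i k \<in> B" "\<And>k. k < m \<Longrightarrow> y k \<in> B"
  shows "affine_map (ring_on B) id m A c y i = aff_val m A c y i"
proof -
  interpret field_subring B by fact
  have "finsum (ring_on B) (\<lambda>k. A i k * y k) {..<m} = (\<Sum>k<m. A i k * y k)"
    using assms(2,3) by (intro finsum_ring_on) auto
  thus ?thesis by (simp add: affine_map_def aff_val_def)
qed

context int_valuation
begin

lemma cauchy_sum: "(\<And>i. i \<in> I \<Longrightarrow> cauchy (f i)) \<Longrightarrow> cauchy (\<lambda>j. \<Sum>i\<in>I. f i j)"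
  by (induction I rule: infinite_finite_induct) (auto intro: cauchy_add)

lemma finsum_cauchy_ring:
  assumes "finite I" "\<And>i. i \<in> I \<Longrightarrow> cauchy (f i)"
  shows "finsum (cauchy_ring v) f I = (\<lambda>j. \<Sum>i\<in>I. f i j)"
proof -
  interpret cring "cauchy_ring v" by (rule cring_cauchy_ring)
  show ?thesis
    using assms
  proof (induction I rule: finite_induct)
    case (insert x I)
    thus ?case by (subst finsum_insert) auto
  qed (simp add: finsum_empty)
qed

lemma finsum_completion:
  assumes I: "finite I" "\<And>i. i \<in> I \<Longrightarrow> cauchy (s i)" "\<And>i. i \<in> I \<Longrightarrow> x i = cls (s i)"
  shows "finsum (completion v) (\<lambda>i. completion_emb v (a i) \<otimes>\<^bsub>completion v\<^esub> x i) I =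
           cls (\<lambda>j. \<Sum>i\<in>I. a i * s i j)"
proof -
  interpret H: ring_hom_cring "cauchy_ring v" "completion v" cls by (rule ring_hom_cls)
  have mult: "cauchy (\<lambda>j. a i * s i j)" if "i \<in> I" for i
    using cauchy_mult[OF cauchy_const I(2)[OF that]] .
  have "finsum (completion v) (\<lambda>i. completion_emb v (a i) \<otimes>\<^bsub>completion v\<^esub> x i) I =
        finsum (completion v) (\<lambda>i. cls (\<lambda>j. a i * s i j)) I"
  proof (rule H.S.finsum_cong')
    show "(\<lambda>i. cls (\<lambda>j. a i * s i j)) \<in> I \<rightarrow> carrier (completion v)"
      using mult H.hom_closed by auto
    fix i assume i: "i \<in> I"
    show "completion_emb v (a i) \<otimes>\<^bsub>completion v\<^esub> x i = cls (\<lambda>j. a i * s i j)"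
      using H.hom_mult[OF cauchy_const I(2)[OF i], of "a i"] I(3)[OF i]
      by (simp add: completion_emb_def)
  qed simp
  also have "\<dots> = cls (finsum (cauchy_ring v) (\<lambda>i j. a i * s i j) I)"
    using H.hom_finsum[of "\<lambda>i j. a i * s i j" I] mult by (simp add: comp_def)
  also have "finsum (cauchy_ring v) (\<lambda>i j. a i * s i j) I = (\<lambda>j. \<Sum>i\<in>I. a i * s i j)"
    using I(1) mult by (intro finsum_cauchy_ring) auto
  finally show ?thesis .
qed

lemma cauchy_linear_sum:
  "(\<And>i. i \<in> I \<Longrightarrow> cauchy (s i)) \<Longrightarrow> cauchy (\<lambda>j. \<Sum>i\<in>I. a i * s i j)"
  by (intro cauchy_sum cauchy_mult) auto

lemma lin_eval_completion:
  assumes "\<And>i. i < N \<Longrightarrow> cauchy (s i)" "\<And>i. i < N \<Longrightarrow> x i = cls (s i)"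
  shows "lin_eval (completion v) (completion_emb v) N l x = cls (\<lambda>j. lin_val N l (\<lambda>i. s i j))"
    and "cauchy (\<lambda>j. lin_val N l (\<lambda>i. s i j))"
proof -
  interpret H: ring_hom_cring "cauchy_ring v" "completion v" cls by (rule ring_hom_cls)
  have sum: "cauchy (\<lambda>j. \<Sum>i<N. snd l i * s i j)"
    using assms(1) by (intro cauchy_linear_sum) auto
  show "lin_eval (completion v) (completion_emb v) N l x = cls (\<lambda>j. lin_val N l (\<lambda>i. s i j))"
    using finsum_completion[of "{..<N}" s x "snd l"] assms H.hom_add[OF cauchy_const sum, of "fst l"]
    by (simp add: lin_eval_def lin_val_def completion_emb_def)
  show "cauchy (\<lambda>j. lin_val N l (\<lambda>i. s i j))"
    unfolding lin_val_def by (rule cauchy_add[OF cauchy_const sum])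
qed

lemma affine_map_completion:
  assumes "\<And>k. k < m \<Longrightarrow> cauchy (s k)" "\<And>k. k < m \<Longrightarrow> y k = cls (s k)"
  shows "affine_map (completion v) (completion_emb v) m A c y i = cls (\<lambda>j. aff_val m A c (\<lambda>k. s k j) i)"
    and "cauchy (\<lambda>j. aff_val m A c (\<lambda>k. s k j) i)"
proof -
  interpret H: ring_hom_cring "cauchy_ring v" "completion v" cls by (rule ring_hom_cls)
  have sum: "cauchy (\<lambda>j. \<Sum>k<m. A i k * s k j)"
    using assms(1) by (intro cauchy_linear_sum) auto
  show "affine_map (completion v) (completion_emb v) m A c y i = cls (\<lambda>j. aff_val m A c (\<lambda>k. s k j) i)"
    using finsum_completion[of "{..<m}" s y "A i"] assms H.hom_add[OF sum cauchy_const, of "c i"]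
    by (simp add: affine_map_def aff_val_def completion_emb_def)
  show "cauchy (\<lambda>j. aff_val m A c (\<lambda>k. s k j) i)"
    unfolding aff_val_def by (rule cauchy_add[OF sum cauchy_const])
qed

text \<open>Null sequences form an ideal; an invertible null class would make the constant sequence
  \<open>1\<close> null.\<close>

lemma invertible_not_null:
  assumes s: "cauchy s" and z: "z \<in> carrier (completion v)"
    and one: "cls s \<otimes>\<^bsub>completion v\<^esub> z = \<one>\<^bsub>completion v\<^esub>"
  shows "s \<notin> null_seqs v"
proof
  assume null: "s \<in> null_seqs v"
  interpret H: ring_hom_cring "cauchy_ring v" "completion v" cls by (rule ring_hom_cls)
  obtain t where t: "cauchy t" "z = cls t" using z by (rule carrier_completionE)
  have "cls (\<lambda>i. s i * t i) = cls (\<lambda>i. 1)"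
    using H.hom_mult[OF s t(1)] H.hom_one one t(2) by simp
  hence "(\<lambda>i. s i * t i - 1) \<in> null_seqs v" by (rule cls_eqD)
  moreover have "(\<lambda>i. - t i * s i) \<in> null_seqs v"
    using null_mult[OF cauchy_mult[OF cauchy_const[of "- 1"] t(1)] null] by simp
  ultimately have "(\<lambda>i. (s i * t i - 1) + (- t i * s i)) \<in> null_seqs v" by (rule null_add)
  hence "(\<lambda>i. - 1) \<in> null_seqs v" by (simp add: algebra_simps)
  hence "\<exists>M. \<forall>i\<ge>M. ereal 0 < v (- 1 :: 'k)" unfolding null_seqs_iff by blast
  thus False by auto
qed

text \<open>Every linear form that is nonzero in the completion has, on the \<open>j\<close>-th
  entries, its value there for all large \<open>j\<close>, so comparisons of values pass to the
  entries.\<close>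

lemma local_conjunct_eventually:
  assumes s: "\<And>i. i < N \<Longrightarrow> cauchy (s i)" and x: "\<And>i. i < N \<Longrightarrow> x i = cls (s i)"
    and loc: "local_conjunct (completion v) (completion_emb v) (completion_ord v) p P N x \<psi>"
  shows "\<forall>\<^sub>F j in sequentially. valued_conjunct v p P N (\<lambda>i. s i j) \<psi>"
proof -
  interpret H: ring_hom_cring "cauchy_ring v" "completion v" cls by (rule ring_hom_cls)
  define L where "L l = (\<lambda>j. lin_val N l (\<lambda>i. s i j))" for l
  have L: "lin_eval (completion v) (completion_emb v) N l x = cls (L l)" "cauchy (L l)" for l
    unfolding L_def using lin_eval_completion[of N s x l] s x by auto
  show ?thesis
  proof (cases \<psi>)
    case (Div l1 l2)
    then obtain z1 z2 where z: "z1 \<in> carrier (completion v)" "z2 \<in> carrier (completion v)"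
        "cls (L l1) \<otimes>\<^bsub>completion v\<^esub> z1 = cls (L l2)" "0 \<le> completion_ord v z1"
        "cls (L l2) \<otimes>\<^bsub>completion v\<^esub> z2 = \<one>\<^bsub>completion v\<^esub>"
      using loc L(1) by auto
    obtain t where t: "cauchy t" "z1 = cls t" using z(1) by (rule carrier_completionE)
    have "L l2 \<notin> null_seqs v" using invertible_not_null[OF L(2) z(2,5)] .
    then obtain a where a: "\<bar>a\<bar> \<noteq> \<infinity>" "\<forall>\<^sub>F j in sequentially. v (L l2 j) = a"
      using cauchy_not_null[OF L(2)] by metis
    obtain b where b: "a = ereal b" using a(1) by (cases a) auto
    \<comment> \<open>The product differs from \<open>L l2\<close> by a null sequence, so both
      eventually have the same value; nonnegativity of \<open>v (t j)\<close> then gives the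
      inequality.\<close>
    have "cls (\<lambda>j. L l1 j * t j) = cls (L l2)"
      using H.hom_mult[OF L(2)[of l1] t(1)] z(3) t(2) by simp
    hence "(\<lambda>j. L l1 j * t j - L l2 j) \<in> null_seqs v" by (rule cls_eqD)
    hence "\<forall>\<^sub>F j in sequentially. ereal b < v (L l1 j * t j - L l2 j)"
      unfolding null_seqs_iff eventually_sequentially by blast
    moreover have "\<forall>\<^sub>F j in sequentially. 0 \<le> v (t j)"
      using completion_ord_nonneg t z(4) by simp
    ultimately have "\<forall>\<^sub>F j in sequentially. L l2 j \<noteq> 0 \<and> v (L l1 j) \<le> v (L l2 j)"
      using a(2)
    proof eventually_elim
      case (elim j)
      hence "v (L l1 j * t j) = v (L l2 j)"
        using b by (intro v_eq_of_close) auto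
      moreover have "L l2 j \<noteq> 0" using elim(3) a(1) by auto
      ultimately show ?case
        using elim(2) by (auto simp: v_mult) (metis add.right_neutral add_left_mono)
    qed
    thus ?thesis by (simp add: Div L_def)
  next
    case (Neq0 l)
    then obtain z where "z \<in> carrier (completion v)" "cls (L l) \<otimes>\<^bsub>completion v\<^esub> z = \<one>\<^bsub>completion v\<^esub>"
      using loc L(1) by auto
    hence "L l \<notin> null_seqs v" using invertible_not_null[OF L(2)] by blast
    then obtain a where a: "\<bar>a\<bar> \<noteq> \<infinity>" "\<forall>\<^sub>F j in sequentially. v (L l j) = a"
      using cauchy_not_null[OF L(2)] by metis
    from a(2) have "\<forall>\<^sub>F j in sequentially. L l j \<noteq> 0"
      by eventually_elim (use a(1) in auto)
    thus ?thesis by (simp add: Neq0 L_def)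
  next
    case (Ord_gt k l1 l2)
    show ?thesis
    proof (cases "P = p k")
      case True
      hence gt: "cls (L l1) \<noteq> \<zero>\<^bsub>completion v\<^esub>"
          "completion_ord v (cls (L l2)) < completion_ord v (cls (L l1))"
        using loc L(1) by (auto simp: Ord_gt ord_gt_def)
      have "L l1 \<notin> null_seqs v" using gt(1) cls_null by blast
      then obtain a where a: "\<bar>a\<bar> \<noteq> \<infinity>" "\<forall>\<^sub>F j in sequentially. v (L l1 j) = a"
        using cauchy_not_null[OF L(2)] by metis
      \<comment> \<open>A null class has order \<open>\<infinity>\<close>, which cannot be strictly
        below another value.\<close>
      have "L l2 \<notin> null_seqs v" using gt(2) completion_ord_null by force
      then obtain b where b: "\<bar>b\<bar> \<noteq> \<infinity>" "\<forall>\<^sub>F j in sequentially. v (L l2 j) = b"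
        using cauchy_not_null[OF L(2)] by metis
      have "b < a" using gt(2) completion_ord_eventually[OF a] completion_ord_eventually[OF b] by simp
      have "\<forall>\<^sub>F j in sequentially. L l1 j \<noteq> 0 \<and> v (L l2 j) < v (L l1 j)"
        using a(2) b(2) by eventually_elim (use a(1) \<open>b < a\<close> in auto)
      thus ?thesis by (simp add: Ord_gt L_def)
    qed (simp add: Ord_gt)
  qed simp
qed

text \<open>Finitely many conditions hold on almost all entries of representatives of
  \<open>y\<close>, so a single index \<open>j\<close> satisfies them all, and the
  \<open>j\<close>-th entries are the tuple over \<open>K\<close>.\<close>

lemma local_solution_approx:
  assumes y: "y \<in> tuples (completion v) m"
    and loc: "\<forall>\<psi>\<in>set \<phi>. local_conjunct (completion v) (completion_emb v) (completion_ord v) p P N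
                (affine_map (completion v) (completion_emb v) m A c y) \<psi>"
    and int: "\<forall>i<N. 0 \<le> completion_ord v (affine_map (completion v) (completion_emb v) m A c y i)"
  shows "\<exists>y'. (\<forall>\<psi>\<in>set \<phi>. valued_conjunct v p P N (aff_val m A c y') \<psi>) \<and>
              (\<forall>i<N. 0 \<le> v (aff_val m A c y' i))"
proof -
  have "\<forall>k\<in>{..<m}. \<exists>s. cauchy s \<and> y k = cls s"
  proof
    fix k assume "k \<in> {..<m}"
    hence "y k \<in> carrier (completion v)" using y by (auto simp: tuples_def)
    then obtain s where "cauchy s" "y k = cls s" by (rule carrier_completionE)
    thus "\<exists>s. cauchy s \<and> y k = cls s" by blast
  qed
  from bchoice[OF this] obtain s where "\<forall>k\<in>{..<m}. cauchy (s k) \<and> y k = cls (s k)" ..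
  hence s: "\<And>k. k < m \<Longrightarrow> cauchy (s k)" "\<And>k. k < m \<Longrightarrow> y k = cls (s k)" by auto
  note aff = affine_map_completion[where m = m and A = A and c = c, OF s]
  have "\<forall>\<^sub>F j in sequentially. \<forall>\<psi>\<in>set \<phi>. valued_conjunct v p P N (aff_val m A c (\<lambda>k. s k j)) \<psi>"
  proof (intro eventually_ball_finite ballI)
    fix \<psi> assume "\<psi> \<in> set \<phi>"
    thus "\<forall>\<^sub>F j in sequentially. valued_conjunct v p P N (aff_val m A c (\<lambda>k. s k j)) \<psi>"
      using loc by (intro local_conjunct_eventually[OF aff(2,1)]) auto
  qed simp
  moreover have "\<forall>\<^sub>F j in sequentially. \<forall>i\<in>{..<N}. 0 \<le> v (aff_val m A c (\<lambda>k. s k j) i)"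
  proof (intro eventually_ball_finite ballI)
    fix i assume "i \<in> {..<N}"
    thus "\<forall>\<^sub>F j in sequentially. 0 \<le> v (aff_val m A c (\<lambda>k. s k j) i)"
      using int aff(1) by (intro completion_ord_nonneg[OF aff(2)]) auto
  qed simp
  ultimately have "\<forall>\<^sub>F j in sequentially.
      (\<forall>\<psi>\<in>set \<phi>. valued_conjunct v p P N (aff_val m A c (\<lambda>k. s k j)) \<psi>) \<and>
      (\<forall>i\<in>{..<N}. 0 \<le> v (aff_val m A c (\<lambda>k. s k j) i))" by (rule eventually_conj)
  hence "\<exists>j. (\<forall>\<psi>\<in>set \<phi>. valued_conjunct v p P N (aff_val m A c (\<lambda>k. s k j)) \<psi>) \<and>
      (\<forall>i\<in>{..<N}. 0 \<le> v (aff_val m A c (\<lambda>k. s k j) i))"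
    by (rule eventually_happens'[OF sequentially_bot])
  then obtain j where j: "\<forall>\<psi>\<in>set \<phi>. valued_conjunct v p P N (aff_val m A c (\<lambda>k. s k j)) \<psi>"
      "\<forall>i\<in>{..<N}. 0 \<le> v (aff_val m A c (\<lambda>k. s k j) i)" by blast
  show ?thesis using j by (intro exI[of _ "\<lambda>k. s k j"]) auto
qed

section \<open>Stability of the local conditions under small changes of the tuple\<close>

lemma linear_close:
  fixes m :: nat
  shows "\<forall>\<^sub>F B in at_top. \<forall>y. (\<forall>k<m. ereal B \<le> v (y k - y' k)) \<longrightarrow>
     ereal C \<le> v (\<Sum>k<m. a k * (y k - y' k))"
proof -
  have "\<forall>\<^sub>F B in at_top. \<forall>k\<in>{..<m}. ereal C \<le> v (a k) + ereal B"
  proof (intro eventually_ball_finite ballI)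
    fix k
    obtain b where b: "ereal b \<le> v (a k)" using v_lower_bound by blast
    show "\<forall>\<^sub>F B in at_top. ereal C \<le> v (a k) + ereal B"
      using eventually_ge_at_top[of "C - b"]
      by eventually_elim (use b in \<open>cases "v (a k)"; auto\<close>)
  qed simp
  thus ?thesis
  proof eventually_elim
    case (elim B)
    show ?case
    proof (intro allI impI v_sum_ge)
      fix y k assume "\<forall>k<m. ereal B \<le> v (y k - y' k)" "k \<in> {..<m}"
      hence "ereal C \<le> v (a k) + ereal B" "ereal B \<le> v (y k - y' k)" using elim by auto
      thus "ereal C \<le> v (a k * (y k - y' k))"
        unfolding v_mult using add_left_mono order_trans by blast
    qed
  qed
qed

text \<open>A change with value at least \<open>i + 1\<close> exceeds the finite value
  \<open>i\<close> of the form and therefore cannot alter it.\<close>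

lemma lin_aff_close:
  assumes "lin_val N l (aff_val m A c y') \<noteq> 0"
  shows "\<forall>\<^sub>F B in at_top. \<forall>y. (\<forall>k<m. ereal B \<le> v (y k - y' k)) \<longrightarrow>
     v (lin_val N l (aff_val m A c y)) = v (lin_val N l (aff_val m A c y'))"
proof -
  obtain i where i: "v (lin_val N l (aff_val m A c y')) = ereal (of_int i)"
    using v_int[OF assms] by blast
  show ?thesis
    using linear_close[of m y' "of_int i + 1" "\<lambda>k. \<Sum>i<N. snd l i * A i k"]
  proof eventually_elim
    case (elim B)
    show ?case
    proof (intro allI impI v_eq_of_close)
      fix y assume "\<forall>k<m. ereal B \<le> v (y k - y' k)"
      hence "ereal (of_int i + 1) \<le> v (\<Sum>k<m. (\<Sum>i<N. snd l i * A i k) * (y k - y' k))"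
        using elim by blast
      also have "(\<Sum>k<m. (\<Sum>i<N. snd l i * A i k) * (y k - y' k)) =
          lin_val N l (aff_val m A c y) - lin_val N l (aff_val m A c y')"
        unfolding lin_aff_val by (simp add: right_diff_distrib sum_subtractf)
      finally have *: "ereal (of_int i + 1) \<le>
          v (lin_val N l (aff_val m A c y) - lin_val N l (aff_val m A c y'))" .
      have "v (lin_val N l (aff_val m A c y')) < ereal (of_int i + 1)" using i by simp
      thus "v (lin_val N l (aff_val m A c y')) <
          v (lin_val N l (aff_val m A c y) - lin_val N l (aff_val m A c y'))"
        using * by (rule less_le_trans)
    qed
  qed
qed

lemma v_eq_nonzero: "v x = v y \<Longrightarrow> y \<noteq> 0 \<Longrightarrow> x \<noteq> 0"
  by (metis v_eq_PInf_iff)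

text \<open>In each case the forms that are compared are nonzero at \<open>y'\<close>, so their
  values, and with them the truth of the conjunct, are locally constant.\<close>

lemma valued_conjunct_close:
  assumes "valued_conjunct v p P N (aff_val m A c y') \<psi>"
  shows "\<forall>\<^sub>F B in at_top. \<forall>y. (\<forall>k<m. ereal B \<le> v (y k - y' k)) \<longrightarrow>
     valued_conjunct v p P N (aff_val m A c y) \<psi>"
proof (cases \<psi>)
  case (Div l1 l2)
  have nz: "lin_val N l2 (aff_val m A c y') \<noteq> 0" "lin_val N l1 (aff_val m A c y') \<noteq> 0"
    using assms by (auto simp: Div)
  show ?thesis
    using lin_aff_close[OF nz(1)] lin_aff_close[OF nz(2)]
  proof eventually_elim
    case (elim B)
    show ?case
    proof (intro allI impI)
      fix y assume close: "\<forall>k<m. ereal B \<le> v (y k - y' k)"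
      have e1: "v (lin_val N l2 (aff_val m A c y)) = v (lin_val N l2 (aff_val m A c y'))"
        using elim close by blast
      have e2: "v (lin_val N l1 (aff_val m A c y)) = v (lin_val N l1 (aff_val m A c y'))"
        using elim close by blast
      show "valued_conjunct v p P N (aff_val m A c y) \<psi>"
        using assms v_eq_nonzero[OF e1] v_eq_nonzero[OF e2] nz by (simp add: Div e1 e2)
    qed
  qed
next
  case (Neq0 l)
  have nz: "lin_val N l (aff_val m A c y') \<noteq> 0" using assms by (auto simp: Neq0)
  show ?thesis
    using lin_aff_close[OF nz]
  proof eventually_elim
    case (elim B)
    show ?case
    proof (intro allI impI)
      fix y assume close: "\<forall>k<m. ereal B \<le> v (y k - y' k)"
      have e1: "v (lin_val N l (aff_val m A c y)) = v (lin_val N l (aff_val m A c y'))"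
        using elim close by blast
      show "valued_conjunct v p P N (aff_val m A c y) \<psi>"
        using assms v_eq_nonzero[OF e1] nz by (simp add: Neq0 e1)
    qed
  qed
next
  case (Ord_gt k l1 l2)
  show ?thesis
  proof (cases "P = p k")
    case True
    hence nz: "lin_val N l1 (aff_val m A c y') \<noteq> 0" "lin_val N l2 (aff_val m A c y') \<noteq> 0"
      using assms by (auto simp: Ord_gt)
    show ?thesis
      using lin_aff_close[OF nz(1)] lin_aff_close[OF nz(2)]
    proof eventually_elim
      case (elim B)
    show ?case
    proof (intro allI impI)
      fix y assume close: "\<forall>k<m. ereal B \<le> v (y k - y' k)"
      have e1: "v (lin_val N l1 (aff_val m A c y)) = v (lin_val N l1 (aff_val m A c y'))"
        using elim close by blast
      have e2: "v (lin_val N l2 (aff_val m A c y)) = v (lin_val N l2 (aff_val m A c y'))"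
        using elim close by blast
      show "valued_conjunct v p P N (aff_val m A c y) \<psi>"
        using assms True v_eq_nonzero[OF e1] v_eq_nonzero[OF e2] nz by (simp add: Ord_gt e1 e2)
    qed
    qed
  qed (simp add: Ord_gt)
qed simp

text \<open>An integral change keeps an integral element integral, which also covers an entry equal
  to \<open>0\<close>.\<close>

lemma aff_nonneg_close:
  assumes "0 \<le> v (aff_val m A c y' i)"
  shows "\<forall>\<^sub>F B in at_top. \<forall>y. (\<forall>k<m. ereal B \<le> v (y k - y' k)) \<longrightarrow> 0 \<le> v (aff_val m A c y i)"
  using linear_close[of m y' 0 "A i"]
proof eventually_elim
  case (elim B)
  show ?case
  proof (intro allI impI)
    fix y assume "\<forall>k<m. ereal B \<le> v (y k - y' k)"
    hence "0 \<le> v (\<Sum>k<m. A i k * (y k - y' k))" using elim by (simp add: zero_ereal_def)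
    hence "0 \<le> v ((\<Sum>k<m. A i k * (y k - y' k)) + aff_val m A c y' i)"
      using assms by (rule v_add_ge)
    also have "(\<Sum>k<m. A i k * (y k - y' k)) + aff_val m A c y' i = aff_val m A c y i"
      by (simp add: aff_val_def right_diff_distrib sum_subtractf)
    finally show "0 \<le> v (aff_val m A c y i)" .
  qed
qed

end

section \<open>Weak approximation\<close>

context integral_extension
begin

text \<open>The element is \<open>1 - (1 - x * y) ^ n\<close> for an \<open>x\<close> outside
  \<open>P\<close> that has order at least \<open>n\<close> at every other prime, with
  \<open>x * y\<close> congruent to \<open>1\<close> modulo \<open>P\<close>. It is near
  \<open>1\<close> at \<open>P\<close> by the power, and near \<open>0\<close> elsewhere as a
  multiple of \<open>x\<close>.\<close>

lemma approximate_idempotent: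
  assumes T: "finite T" "\<And>Q. Q \<in> T \<Longrightarrow> nonzero_prime OK Q" and P: "P \<in> T"
  shows "\<exists>e\<in>OK. ereal (real n) \<le> prime_ord OK P (1 - e) \<and>
           (\<forall>Q\<in>T - {P}. ereal (real n) \<le> prime_ord OK Q e)"
proof -
  have ip: "integral_prime R d D Q" if "Q \<in> T" for Q
    using T(2)[OF that] by unfold_locales
  interpret P: integral_prime R d D P using ip[OF P] .
  interpret PV: int_valuation "prime_ord OK P" by (rule P.int_valuation_prime_ord)
  have "\<forall>Q\<in>T - {P}. \<exists>a. a \<in> Q - P"
  proof
    fix Q assume Q: "Q \<in> T - {P}"
    interpret Q: integral_prime R d D Q using ip Q by blast
    show "\<exists>a. a \<in> Q - P"
    proof (rule ccontr)
      assume "\<nexists>a. a \<in> Q - P"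
      \<comment> \<open>Distinct primes are incomparable because \<open>Q\<close> is maximal: an
        element of \<open>P\<close> outside \<open>Q\<close> is invertible modulo \<open>Q\<close>,
        which would put \<open>1\<close> into \<open>P\<close>.\<close>
      hence QP: "Q \<subseteq> P" by blast
      then obtain a where a: "a \<in> P" "a \<notin> Q" using Q by blast
      hence "a \<in> OK - Q" using P.P_subset by blast
      then obtain y where y: "y \<in> OK" "1 - a * y \<in> Q" using Q.inverse_mod_P by blast
      have "y * a \<in> P" using P.P_mult y(1) a(1) by blast
      hence "(1 - a * y) + y * a \<in> P" using P.P_add y(2) QP by blast
      thus False using P.P_one by (simp add: mult.commute)
    qed
  qed
  from bchoice[OF this] obtain a where a: "\<forall>Q\<in>T - {P}. a Q \<in> Q - P" ..
  have aOK: "a Q \<in> OK - P" if Q: "Q \<in> T - {P}" for Q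
  proof -
    interpret Q: integral_prime R d D Q using ip Q by blast
    show ?thesis using a Q Q.P_subset by blast
  qed
  define x where "x = (\<Prod>Q\<in>T - {P}. a Q ^ n)"
  have "(\<Prod>Q\<in>U. a Q ^ n) \<in> OK - P" if "finite U" "U \<subseteq> T - {P}" for U
    using that
  proof (induction U rule: finite_induct)
    case (insert Q U)
    thus ?case using P.not_P_mult[OF P.not_P_power[OF aOK[of Q]]] by auto
  qed (use P.P_one in auto)
  hence x: "x \<in> OK - P" using T(1) by (simp add: x_def)
  then obtain y where y: "y \<in> OK" "1 - x * y \<in> P" using P.inverse_mod_P by blast
  obtain z where z: "z \<in> OK" "1 - (1 - x * y) ^ n = x * z"
    using OK.one_minus_power_multiple[of x y n] x y(1) by blast
  have "ereal (real n) \<le> prime_ord OK P (1 - x * z)"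
    using PV.v_power_ge[OF P.prime_ord_ge_1[OF y(2)], of n] by (simp flip: z(2))
  moreover have "ereal (real n) \<le> prime_ord OK Q (x * z)" if Q: "Q \<in> T - {P}" for Q
  proof -
    interpret Q: integral_prime R d D Q using ip Q by blast
    interpret QV: int_valuation "prime_ord OK Q" by (rule Q.int_valuation_prime_ord)
    have eq: "x * z = a Q ^ n * ((\<Prod>Q'\<in>T - {P} - {Q}. a Q' ^ n) * z)"
      unfolding x_def using T(1) Q by (subst prod.remove[of _ Q]) (auto simp: mult.assoc)
    have "(\<Prod>Q'\<in>T - {P} - {Q}. a Q' ^ n) \<in> OK"
      using aOK by (intro OK.prod_mem OK.power_mem) blast
    hence "0 \<le> prime_ord OK Q ((\<Prod>Q'\<in>T - {P} - {Q}. a Q' ^ n) * z)"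
      using z(1) by (intro Q.prime_ord_nonneg OK.mult_mem)
    moreover have "ereal (real n) \<le> prime_ord OK Q (a Q ^ n)"
      using a Q by (intro QV.v_power_ge Q.prime_ord_ge_1) blast
    ultimately have "ereal (real n) + 0 \<le> prime_ord OK Q (x * z)"
      unfolding eq QV.v_mult by (intro add_mono)
    thus ?thesis by simp
  qed
  moreover have "x * z \<in> OK" using x z by blast
  ultimately show ?thesis by blast
qed

text \<open>The tuple is the sum of the \<open>Y Q\<close> weighted by the approximate idempotents
  of the primes \<open>Q\<close>.\<close>

lemma weak_approximation:
  fixes Y :: "'k set \<Rightarrow> nat \<Rightarrow> 'k" and B :: real
  assumes T: "finite T" "\<And>Q. Q \<in> T \<Longrightarrow> nonzero_prime OK Q"
  shows "\<exists>y. \<forall>P\<in>T. \<forall>k<m. ereal B \<le> prime_ord OK P (y k - Y P k)"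
proof -
  have val: "int_valuation (prime_ord OK Q)" if "Q \<in> T" for Q
  proof -
    interpret integral_prime R d D Q using T(2)[OF that] by unfold_locales
    show ?thesis by (rule int_valuation_prime_ord)
  qed
  \<comment> \<open>The \<open>Y Q k\<close> may have poles at any prime of \<open>T\<close>; the
    accuracy \<open>n\<close> must outweigh these as well as reach \<open>B\<close>.\<close>
  have "\<forall>\<^sub>F n in sequentially. \<forall>P\<in>T. \<forall>Q\<in>T. \<forall>k\<in>{..<m}.
          ereal B \<le> ereal (real n) + prime_ord OK P (Y Q k)"
  proof (intro eventually_ball_finite ballI T(1))
    fix P Q k assume "P \<in> T"
    then obtain b where b: "ereal b \<le> prime_ord OK P (Y Q k)"
      using int_valuation.v_lower_bound[OF val] by blast
    have "\<forall>\<^sub>F n in sequentially. B - b \<le> real n"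
      using filterlim_real_sequentially by (simp add: filterlim_at_top)
    thus "\<forall>\<^sub>F n in sequentially. ereal B \<le> ereal (real n) + prime_ord OK P (Y Q k)"
      by eventually_elim (use b in \<open>cases "prime_ord OK P (Y Q k)"; auto\<close>)
  qed simp
  hence "\<exists>n. \<forall>P\<in>T. \<forall>Q\<in>T. \<forall>k\<in>{..<m}. ereal B \<le> ereal (real n) + prime_ord OK P (Y Q k)"
    by (rule eventually_happens'[OF sequentially_bot])
  then obtain n where n: "\<And>P Q k. P \<in> T \<Longrightarrow> Q \<in> T \<Longrightarrow> k < m \<Longrightarrow>
      ereal B \<le> ereal (real n) + prime_ord OK P (Y Q k)" by blast
  have "\<forall>P\<in>T. \<exists>e. e \<in> OK \<and> ereal (real n) \<le> prime_ord OK P (1 - e) \<and>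
           (\<forall>Q\<in>T - {P}. ereal (real n) \<le> prime_ord OK Q e)"
    using approximate_idempotent[OF T] by blast
  from bchoice[OF this] obtain e where e: "\<forall>P\<in>T. e P \<in> OK \<and> ereal (real n) \<le> prime_ord OK P (1 - e P) \<and>
           (\<forall>Q\<in>T - {P}. ereal (real n) \<le> prime_ord OK Q (e P))" ..
  have "ereal B \<le> prime_ord OK P ((\<Sum>Q\<in>T. e Q * Y Q k) - Y P k)" if P: "P \<in> T" and k: "k < m" for P k
  proof -
    interpret int_valuation "prime_ord OK P" by (rule val[OF P])
    have summand: "ereal B \<le> prime_ord OK P (a * Y Q k)"
      if "Q \<in> T" "ereal (real n) \<le> prime_ord OK P a" for a Q
      unfolding v_mult using n[OF P that(1) k] add_right_mono[OF that(2)] by (rule order_trans)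
    \<comment> \<open>In this form each summand of the error has a factor of value at least
      \<open>n\<close> at \<open>P\<close>.\<close>
    have eq: "(\<Sum>Q\<in>T. e Q * Y Q k) - Y P k = (\<Sum>Q\<in>T - {P}. e Q * Y Q k) + - ((1 - e P) * Y P k)"
      using T(1) P by (subst sum.remove[of _ P]) (auto simp: algebra_simps)
    have "ereal B \<le> prime_ord OK P (\<Sum>Q\<in>T - {P}. e Q * Y Q k)"
      using e P by (intro v_sum_ge summand) auto
    moreover have "ereal B \<le> prime_ord OK P (- ((1 - e P) * Y P k))"
      unfolding v_uminus using e P by (intro summand) auto
    ultimately show ?thesis unfolding eq by (rule v_add_ge)
  qed
  thus ?thesis by (intro exI[of _ "\<lambda>k. \<Sum>Q\<in>T. e Q * Y Q k"]) blast
qed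

text \<open>An intersection of valuation rings, each of which contains \<open>OK\<close>.\<close>

lemma field_subring_S_integers:
  assumes "\<And>Q. Q \<in> T \<Longrightarrow> nonzero_prime OK Q"
  shows "field_subring (S_integers OK T)" "OK \<subseteq> S_integers OK T"
proof -
  have ip: "integral_prime R d D Q" if "Q \<in> T" for Q
    using assms[OF that] by unfold_locales
  have val: "int_valuation (prime_ord OK Q)" if "Q \<in> T" for Q
    using integral_prime.int_valuation_prime_ord[OF ip[OF that]] .
  show OK: "OK \<subseteq> S_integers OK T"
    using integral_prime.prime_ord_nonneg[OF ip] by (auto simp: S_integers_def)
  show "field_subring (S_integers OK T)"
  proof
    show "0 \<in> S_integers OK T" "1 \<in> S_integers OK T" using OK by auto
    fix x y assume *: "x \<in> S_integers OK T" "y \<in> S_integers OK T"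
    show "x + y \<in> S_integers OK T"
      using * int_valuation.v_add_ge[OF val] by (auto simp: S_integers_def)
    show "x * y \<in> S_integers OK T"
      using * int_valuation.v_mult[OF val] by (auto simp: S_integers_def)
  next
    fix x assume "x \<in> S_integers OK T"
    thus "- x \<in> S_integers OK T"
      using int_valuation.v_uminus[OF val] by (auto simp: S_integers_def)
  qed
qed

end

section \<open>From the local solutions to the global one\<close>

text \<open>The parametrization speaks of tuples over \<open>F\<close>, whereas weak approximation
  yields entries in \<open>K\<close>. Evaluation at the zero vector and at the unit vectors, which
  are over \<open>F\<close>, shows that all coefficients of the composite affine form
  vanish.\<close>

lemma parametrization_solves:
  assumes F: "field_subring F" and l: "l \<in> linear_system \<phi>" "linear_poly_over F N l"
    and par: "parametrization F N m \<phi> A c"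
  shows "lin_val N l (aff_val m A c y) = 0"
proof -
  interpret field_subring F by (rule F)
  have A: "\<And>i k. i < N \<Longrightarrow> k < m \<Longrightarrow> A i k \<in> F" and c: "\<And>i. i < N \<Longrightarrow> c i \<in> F"
    and sol: "\<And>y. y \<in> tuples (ring_on F) m \<Longrightarrow> solves_system F N \<phi> (affine_map (ring_on F) id m A c y)"
    using par by (auto simp: parametrization_def)
  define g0 where "g0 = fst l + (\<Sum>i<N. snd l i * c i)"
  define g where "g k = (\<Sum>i<N. snd l i * A i k)" for k
  have zero: "g0 + (\<Sum>k<m. g k * y k) = 0" if y: "\<And>k. k < m \<Longrightarrow> y k \<in> F" for y
  proof -
    have "y \<in> tuples (ring_on F) m" using y by (simp add: tuples_def)
    note sol = sol[OF this, unfolded solves_system_def]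
    have aff: "affine_map (ring_on F) id m A c y i = aff_val m A c y i" if "i < N" for i
      using A that y by (intro affine_map_ring_on[OF F]) auto
    have "lin_val N l (aff_val m A c y) = lin_val N l (affine_map (ring_on F) id m A c y)"
      using aff by (simp add: lin_val_def)
    also have "\<dots> = lin_eval (ring_on F) id N l (affine_map (ring_on F) id m A c y)"
      using sol by (intro lin_eval_ring_on[OF F l(2), symmetric]) (auto simp: tuples_def)
    also have "\<dots> = 0" using sol l(1) by blast
    finally show ?thesis by (simp add: lin_aff_val g0_def g_def)
  qed
  have g0: "g0 = 0" using zero[of "\<lambda>_. 0"] by simp
  have "g k = 0" if "k < m" for k
  proof -
    have "(\<Sum>i<m. g i * (if i = k then 1 else 0)) = g k"
      using that by (simp add: if_distrib[of "\<lambda>a. _ * a"] cong: if_cong)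
    thus ?thesis using zero[of "\<lambda>i. if i = k then 1 else 0"] g0 by simp
  qed
  thus ?thesis by (simp add: lin_aff_val g0[unfolded g0_def] g_def[symmetric])
qed

theorem theorem2p6:
  fixes R F OK :: "'k::field set"
    and n N m :: nat
    and p :: "nat \<Rightarrow> 'k set"
    and \<phi> :: "'k conjunct list"
    and A :: "nat \<Rightarrow> nat \<Rightarrow> 'k"
    and c :: "nat \<Rightarrow> 'k"
  assumes "is_Z_or_Fp_t R"
    and "F = fraction_field R"
    and "finite_extension F"
    and "separable_extension F"
    and "OK = integral_closure R"
    and "n \<ge> 1"
    and "\<forall>j\<in>{1..n}. nonzero_prime OK (p j)"
    and "normal_sentence R n N \<phi>"
    and "\<exists>x. solves_system F N \<phi> x"
    and "parametrization F N m \<phi> A c"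
    and "\<forall>P\<in>p ` {1..n}. local_sat OK p P N m A c \<phi>"
  shows "global_sat OK n p N \<phi>"
proof -
  obtain d where "euclidean_subring R d" using is_Z_or_Fp_t_euclidean[OF assms(1)] by blast
  then interpret euclidean_subring R d .
  obtain D where D: "\<forall>Y :: 'k set. finite Y \<longrightarrow> D < card Y \<longrightarrow>
      (\<exists>c. (\<forall>y\<in>Y. c y \<in> R) \<and> (\<exists>y\<in>Y. c y \<noteq> 0) \<and> (\<Sum>y\<in>Y. c y * y) = 0)"
    using finite_extension_dependent[OF assms(3)[unfolded assms(2)]] ..
  \<comment> \<open>The minimal polynomial provides the monic equation over \<open>F\<close> whose
    denominators are cleared.\<close>
  have mult: "\<exists>r\<in>R. r \<noteq> 0 \<and> r * x \<in> integral_closure R" for x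
  proof -
    obtain f where "is_minimal_poly F x f"
      using assms(4) by (auto simp: separable_extension_def)
    thus ?thesis
      using algebraic_integral_multiple[of f x] assms(2) by (auto simp: is_minimal_poly_def)
  qed
  interpret integral_extension R d D
    by unfold_locales (rule D[rule_format], assumption+, rule mult)
  define T where "T = p ` {1..n}"
  note OK_eq = assms(5)
  have T: "finite T" "\<And>Q. Q \<in> T \<Longrightarrow> nonzero_prime (integral_closure R) Q"
    using assms(5,7) by (auto simp: T_def)
  define V where "V = (\<lambda>P. prime_ord (integral_closure R) P)"
  have val: "int_valuation (V P)" if "P \<in> T" for P
  proof -
    interpret integral_prime R d D P using T(2)[OF that] by unfold_locales
    show ?thesis unfolding V_def by (rule int_valuation_prime_ord)
  qed
  define OS where "OS = S_integers (integral_closure R) T"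
  have OS: "field_subring OS" and OK_OS: "integral_closure R \<subseteq> OS"
    unfolding OS_def using field_subring_S_integers[OF T(2)] by auto
  have OS_iff: "x \<in> OS \<longleftrightarrow> (\<forall>P\<in>T. 0 \<le> V P x)" for x
    by (simp add: OS_def S_integers_def V_def)

  have "\<forall>P\<in>T. \<exists>y. (\<forall>\<psi>\<in>set \<phi>. valued_conjunct (V P) p P N (aff_val m A c y) \<psi>) \<and>
              (\<forall>i<N. 0 \<le> V P (aff_val m A c y i))"
  proof
    fix P assume P: "P \<in> T"
    hence "local_sat (integral_closure R) p P N m A c \<phi>" using assms(5,11) by (auto simp: T_def)
    thus "\<exists>y. (\<forall>\<psi>\<in>set \<phi>. valued_conjunct (V P) p P N (aff_val m A c y) \<psi>) \<and>
              (\<forall>i<N. 0 \<le> V P (aff_val m A c y i))"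
      using int_valuation.local_solution_approx[OF val[OF P]]
      unfolding local_sat_def Let_def V_def by blast
  qed
  from bchoice[OF this] obtain Y where
    Y: "\<forall>P\<in>T. (\<forall>\<psi>\<in>set \<phi>. valued_conjunct (V P) p P N (aff_val m A c (Y P)) \<psi>) \<and>
              (\<forall>i<N. 0 \<le> V P (aff_val m A c (Y P) i))" ..
  have "\<forall>\<^sub>F B in at_top. \<forall>P\<in>T. \<forall>\<psi>\<in>set \<phi>. \<forall>y. (\<forall>k<m. ereal B \<le> V P (y k - Y P k)) \<longrightarrow>
          valued_conjunct (V P) p P N (aff_val m A c y) \<psi>"
    using Y by (intro eventually_ball_finite ballI T(1) int_valuation.valued_conjunct_close[OF val]) auto
  moreover have "\<forall>\<^sub>F B in at_top. \<forall>P\<in>T. \<forall>i\<in>{..<N}. \<forall>y. (\<forall>k<m. ereal B \<le> V P (y k - Y P k)) \<longrightarrow>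
          0 \<le> V P (aff_val m A c y i)"
    using Y by (intro eventually_ball_finite ballI T(1) int_valuation.aff_nonneg_close[OF val]) auto
  ultimately have "\<forall>\<^sub>F B in at_top. (\<forall>P\<in>T. \<forall>\<psi>\<in>set \<phi>. \<forall>y. (\<forall>k<m. ereal B \<le> V P (y k - Y P k)) \<longrightarrow>
          valued_conjunct (V P) p P N (aff_val m A c y) \<psi>) \<and>
        (\<forall>P\<in>T. \<forall>i\<in>{..<N}. \<forall>y. (\<forall>k<m. ereal B \<le> V P (y k - Y P k)) \<longrightarrow>
          0 \<le> V P (aff_val m A c y i))" by (rule eventually_conj)
  \<comment> \<open>\<open>T\<close>, \<open>\<phi>\<close> and the set of coordinates are finite,
    so a single accuracy \<open>B\<close> serves all of them.\<close>
  from eventually_happens'[OF trivial_limit_at_top_linorder this] obtain B :: real where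
    B1: "\<forall>P\<in>T. \<forall>\<psi>\<in>set \<phi>. \<forall>y. (\<forall>k<m. ereal B \<le> V P (y k - Y P k)) \<longrightarrow>
          valued_conjunct (V P) p P N (aff_val m A c y) \<psi>"
    and B2: "\<forall>P\<in>T. \<forall>i\<in>{..<N}. \<forall>y. (\<forall>k<m. ereal B \<le> V P (y k - Y P k)) \<longrightarrow>
          0 \<le> V P (aff_val m A c y i)" by auto
  obtain y where y: "\<forall>P\<in>T. \<forall>k<m. ereal B \<le> V P (y k - Y P k)"
    using weak_approximation[OF T] unfolding V_def by blast
  define x where "x = aff_val m A c y"
  have conj: "valued_conjunct (V P) p P N x \<psi>" if "P \<in> T" "\<psi> \<in> set \<phi>" for P \<psi>
    using B1 y that unfolding x_def by blast
  have x_OS: "x i \<in> OS" if "i < N" for i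
    using B2 y that unfolding x_def OS_iff by blast
  \<comment> \<open>The nonvanishing demanded by \<open>Div\<close> and \<open>Neq0\<close> is read
    off at a single prime, and \<open>n \<ge> 1\<close> supplies one.\<close>
  have "p 1 \<in> T" using assms(6) by (simp add: T_def)
  then obtain P0 where P0: "P0 \<in> T" ..
  have R_OS: "R \<subseteq> OS" using OK_OS by blast
  have eval: "lin_eval (ring_on OS) id N l x = lin_val N l x" if "linear_poly_over R N l" for l
    using that R_OS x_OS by (intro lin_eval_ring_on[OF OS]) (auto simp: linear_poly_over_def)
  have "global_conjunct OK p OS N x \<psi>" if \<psi>: "\<psi> \<in> set \<phi>" for \<psi>
  proof -
    have norm: "normal_conjunct R n N \<psi>" using assms(8) \<psi> by (simp add: normal_sentence_def)
    show ?thesis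
    proof (cases \<psi>)
      case (Div l1 l2)
      have l: "linear_poly_over R N l1" "linear_poly_over R N l2" using norm by (auto simp: Div)
      have c: "lin_val N l2 x \<noteq> 0" "V P (lin_val N l1 x) \<le> V P (lin_val N l2 x)" if "P \<in> T" for P
        using conj[OF that \<psi>] by (auto simp: Div)
      have nz: "lin_val N l2 x \<noteq> 0" using c(1) P0 by blast
      have nz1: "lin_val N l1 x \<noteq> 0"
      proof
        assume "lin_val N l1 x = 0"
        hence "V P0 (lin_val N l2 x) = \<infinity>" using c(2)[OF P0] int_valuation.v_zero[OF val[OF P0]] by simp
        thus False using nz int_valuation.v_eq_PInf_iff[OF val[OF P0]] by blast
      qed
      \<comment> \<open>The inequality of values holds at every prime of \<open>T\<close>, which is
        the membership test for \<open>OS\<close>.\<close>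
      have "lin_val N l2 x / lin_val N l1 x \<in> OS"
        unfolding OS_iff using int_valuation.v_divide_nonneg[OF val nz1 c(2)] by blast
      moreover have "lin_val N l2 x = lin_val N l1 x * (lin_val N l2 x / lin_val N l1 x)"
        using nz1 by simp
      ultimately have "lin_val N l1 x divides\<^bsub>ring_on OS\<^esub> lin_val N l2 x"
        unfolding factor_def by (intro bexI) auto
      thus ?thesis using nz by (simp add: Div eval[OF l(1)] eval[OF l(2)])
    next
      case (Eq0 l)
      have l: "linear_poly_over R N l" using norm by (simp add: Eq0)
      hence "linear_poly_over F N l"
        using subset_fraction_field assms(2) by (auto simp: linear_poly_over_def)
      moreover have "l \<in> linear_system \<phi>" using \<psi> by (simp add: linear_system_def Eq0)
      ultimately have "lin_val N l x = 0"
        unfolding x_def using field_subring_fraction_field assms(2,10) parametrization_solves by blast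
      thus ?thesis by (simp add: Eq0 eval[OF l])
    next
      case (Neq0 l)
      have l: "linear_poly_over R N l" using norm by (simp add: Neq0)
      thus ?thesis using conj[OF P0 \<psi>] by (simp add: Neq0 eval[OF l])
    next
      case (Ord_gt j l1 l2)
      have l: "linear_poly_over R N l1" "linear_poly_over R N l2" and "p j \<in> T"
        using norm by (auto simp: Ord_gt T_def)
      from conj[OF this(3) \<psi>] show ?thesis
        by (simp add: Ord_gt eval[OF l(1)] eval[OF l(2)] ord_gt_def V_def OK_eq)
    qed
  qed
  moreover have "x \<in> tuples (ring_on OS) N" using x_OS by (simp add: tuples_def)
  ultimately show ?thesis
    unfolding global_sat_def Let_def T_def[symmetric] OK_eq OS_def[symmetric] by (auto simp: OK_eq)
qed

end
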